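(* Fix $\nu,\lambda>0$. For data $U_0,\Theta_0,v_0,\vartheta_0$ and a constant $C>0$ define $$L_C:=\Big(\|v_0\|_{H^3}^2+\|\vartheta_0\|_{H^3}^2+E_0\Big)\exp\big(CF_0+CE_0\big),$$ with $E_0,F_0$ as in the context. (i) ($d=2$) Let $v_0=\vartheta_0=0$, $U_0=\nabla^\perp a_0=(\partial_2a_0,-\partial_1a_0)^T$, $\Theta_0=a_0$, where $a_0\in L^2(\mathbb R^2)$ with $\hat a_0\in L^1(\mathbb R^2)$ and $$\operatorname{supp}\hat a_0\subset\Big\{\xi\in\mathbb R^2:\ |\xi_1-\xi_2|\le\varepsilon,\ \tfrac43\le|\xi|\le\tfrac32\Big\},\qquad \varepsilon>0.$$ Then for every $C>0$ there is a constant $C'>0$, independent of $a_0$ and $\varepsilon$, such that $$L_C\le C'\varepsilon\|a_0\|_{L^2}\|\hat a_0\|_{L^1}\exp\Big(C'\varepsilon\|a_0\|_{L^2}\|\hat a_0\|_{L^1}+C'\|\hat a_0\|_{L^1}\Big).$$ (ii) ($d=3$) Let $v_0=\vartheta_0=0$, $U_0=(\partial_2a_0,-\partial_1a_0,0)^T$, $\Theta_0=a_0$, where $a_0\in L^2(\mathbb R^3)$ with $\hat a_0\in L^1(\mathbb R^3)$ and $$\operatorname{supp}\hat a_0\subset\Big\{\xi\in\mathbb R^3:\ |\xi_1-\xi_2|\le\varepsilon,\ \tfrac{41}{30}\le|\xi_h|\le\tfrac{22}{15},\ \varepsilon\le|\xi_3|\le2\varepsilon\Big\},\qquad \xi_h=(\xi_1,\xi_2),$$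 with $\varepsilon>0$ small enough (smaller than a constant independent of $a_0$). Then for every $C>0$ there is a constant $C'>0$, independent of $a_0$ and $\varepsilon$, such that $$L_C\le C'\varepsilon\|a_0\|_{L^2}\|\hat a_0\|_{L^1}\exp\Big(C'\varepsilon\|a_0\|_{L^2}\|\hat a_0\|_{L^1}+C'\|\hat a_0\|_{L^1}\Big).$$
   Context: $\hat f$ is the Fourier transform of $f$ on $\mathbb R^d$; norms are over $\mathbb R^d$ in the space variable; $e_d=(0,\dots,0,1)^T$; $\|(f,g)\|_X:=\|f\|_X+\|g\|_X$. Given divergence-free $U_0$ and scalar $\Theta_0$ (Fourier supported in an annulus), $(U,\Theta)$ is the solution of the linearized damped Boussinesq system $$\partial_tU+\nu U+\nabla p=\Theta e_d,\qquad \partial_t\Theta+\lambda\Theta=0,\qquad \operatorname{div}U=0,\qquad (U,\Theta)|_{t=0}=(U_0,\Theta_0),$$ namely $\Theta(t)=e^{-\lambda t}\Theta_0$ and $U(t)=e^{-\nu t}U_0+\rho(t)\,\mathbb P(\Theta_0e_d)$, where $\rho(t)=\frac{e^{-\lambda t}-e^{-\nu t}}{\nu-\lambda}$ if $\nu\ne\lambda$, $\rho(t)=te^{-\nu t}$ if $\nu=\lambda$, and $\mathbb P$ is the Leray projector (Fourier multiplier $I-\xi\xi^T/|\xi|^2$). Moreover $$E_0=\int_0^\infty\big(\|U\cdot\nabla U\|_{H^3}+\|U\cdot\nabla\Theta\|_{H^3}\big)\,dt,\qquad F_0=\int_0^\infty\|(U,\Theta)\|_{L^\infty}\,dt .$$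 *)

theory Defs
  imports "HOL-Analysis.Analysis" "HOL-Probability.Essential_Supremum"
begin

text \<open>
  Elements of \<open>L\<^sup>2\<close> are represented by Borel functions. Every notion below that is applied to such
  a function depends only on its class modulo Lebesgue null sets, or (if it returns a function again)
  is itself only determined modulo null sets.
\<close>

definition square_integrable :: "('a::euclidean_space \<Rightarrow> 'b::real_normed_vector) \<Rightarrow> bool" where
  "square_integrable f \<longleftrightarrow>
     f \<in> borel_measurable lborel \<and> integrable lborel (\<lambda>x. (norm (f x))\<^sup>2)"

definition L1_norm :: "('a::euclidean_space \<Rightarrow> 'b::real_normed_vector) \<Rightarrow> real" where
  "L1_norm f = (LINT x|lborel. norm (f x))"

definition L2_norm :: "('a::euclidean_space \<Rightarrow> 'b::real_normed_vector) \<Rightarrow> real" where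
  "L2_norm f = sqrt (LINT x|lborel. (norm (f x))\<^sup>2)"

definition Linf_norm :: "('a::euclidean_space \<Rightarrow> 'b::real_normed_vector) \<Rightarrow> ennreal" where
  "Linf_norm f = esssup lborel (\<lambda>x. ennreal (norm (f x)))"

definition fourier_L1 :: "('a::euclidean_space \<Rightarrow> complex) \<Rightarrow> 'a \<Rightarrow> complex" where
  "fourier_L1 f \<xi> = (LINT x|lborel. cis (- (x \<bullet> \<xi>)) * f x)"

text \<open>
  The Fourier transform on \<open>L\<^sup>2\<close> is the extension by density of the Fourier integral
  from \<open>L\<^sup>1 \<inter> L\<^sup>2\<close>.
\<close>

definition has_fourier_L2 ::
    "('a::euclidean_space \<Rightarrow> complex) \<Rightarrow> ('a \<Rightarrow> complex) \<Rightarrow> bool" where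
  "has_fourier_L2 f g \<longleftrightarrow> square_integrable f \<and> square_integrable g \<and>
     (\<exists>F :: nat \<Rightarrow> 'a \<Rightarrow> complex.
        (\<forall>n. integrable lborel (F n) \<and> square_integrable (F n)) \<and>
        (\<lambda>n. \<integral>\<^sup>+ x. ennreal ((norm (F n x - f x))\<^sup>2) \<partial>lborel) \<longlonglongrightarrow> 0 \<and>
        (\<lambda>n. \<integral>\<^sup>+ \<xi>. ennreal ((norm (fourier_L1 (F n) \<xi> - g \<xi>))\<^sup>2) \<partial>lborel) \<longlonglongrightarrow> 0)"

definition fourier :: "('a::euclidean_space \<Rightarrow> real) \<Rightarrow> 'a \<Rightarrow> complex" where
  "fourier f = (SOME g. has_fourier_L2 (\<lambda>x. complex_of_real (f x)) g)"

text \<open>Support of a function defined modulo null sets: the complement of the largest open set on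
  which it vanishes almost everywhere.\<close>

definition ess_support :: "('a::euclidean_space \<Rightarrow> complex) \<Rightarrow> 'a set" where
  "ess_support g = - \<Union>{V. open V \<and> (AE \<xi> in lborel. \<xi> \<in> V \<longrightarrow> g \<xi> = 0)}"

definition ennreal_sqrt :: "ennreal \<Rightarrow> ennreal" where
  "ennreal_sqrt x = (if x = \<infinity> then \<infinity> else ennreal (sqrt (enn2real x)))"

definition sobolev_norm :: "real \<Rightarrow> ('a::euclidean_space \<Rightarrow> real) \<Rightarrow> ennreal" where
  "sobolev_norm s f =
     (if square_integrable f
      then ennreal_sqrt (\<integral>\<^sup>+ \<xi>. ennreal ((1 + (norm \<xi>)\<^sup>2) powr s * (norm (fourier f \<xi>))\<^sup>2) \<partial>lborel)
      else \<infinity>)"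

definition sobolev_norm_vec :: "real \<Rightarrow> ('a::euclidean_space \<Rightarrow> real ^ 'm) \<Rightarrow> ennreal" where
  "sobolev_norm_vec s v = ennreal_sqrt (\<Sum>i\<in>UNIV. (sobolev_norm s (\<lambda>x. v x $ i))\<^sup>2)"

text \<open>
  A function given modulo null sets is differentiated classically, after passing to its
  everywhere differentiable representative. That representative is unique if it exists; it exists,
  and is smooth, for every \<open>L\<^sup>2\<close> function whose Fourier transform has compact support.
\<close>

definition differentiable_rep :: "(real ^ 'n \<Rightarrow> real) \<Rightarrow> real ^ 'n \<Rightarrow> real" where
  "differentiable_rep f =
     (THE g. (\<forall>x. g differentiable (at x)) \<and> (AE x in lborel. g x = f x))"

definition partial :: "'n \<Rightarrow> (real ^ 'n \<Rightarrow> real) \<Rightarrow> real ^ 'n \<Rightarrow> real" where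
  "partial j f x = frechet_derivative (differentiable_rep f) (at x) (axis j 1)"

definition advect :: "(real ^ 'n \<Rightarrow> real ^ 'n) \<Rightarrow> (real ^ 'n \<Rightarrow> real) \<Rightarrow> real ^ 'n \<Rightarrow> real" where
  "advect u f x = (\<Sum>j\<in>UNIV. u x $ j * partial j f x)"

definition advect_vec ::
    "(real ^ 'n \<Rightarrow> real ^ 'n) \<Rightarrow> (real ^ 'n \<Rightarrow> real ^ 'n) \<Rightarrow> real ^ 'n \<Rightarrow> real ^ 'n" where
  "advect_vec u v x = (\<chi> i. advect u (\<lambda>y. v y $ i) x)"

definition leray :: "(real ^ 'n \<Rightarrow> real ^ 'n) \<Rightarrow> real ^ 'n \<Rightarrow> real ^ 'n" where
  "leray w = (SOME v. square_integrable v \<and>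
     (\<forall>i. AE \<xi> in lborel. fourier (\<lambda>x. v x $ i) \<xi> =
        (\<Sum>j\<in>UNIV. complex_of_real ((if i = j then 1 else 0) - \<xi> $ i * \<xi> $ j / (norm \<xi>)\<^sup>2)
                     * fourier (\<lambda>x. w x $ j) \<xi>)))"

definition bous_rho :: "real \<Rightarrow> real \<Rightarrow> real \<Rightarrow> real" where
  "bous_rho \<nu> lam t =
     (if \<nu> \<noteq> lam then (exp (- lam * t) - exp (- \<nu> * t)) / (\<nu> - lam) else t * exp (- \<nu> * t))"

definition bous_Theta :: "real \<Rightarrow> (real ^ 'n \<Rightarrow> real) \<Rightarrow> real \<Rightarrow> real ^ 'n \<Rightarrow> real" where
  "bous_Theta lam \<Theta>0 t x = exp (- lam * t) * \<Theta>0 x"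

text \<open>The index \<open>d\<close> is the vertical direction, i.e. \<open>axis d 1\<close> is the vector \<open>e\<^sub>d\<close>.\<close>

definition bous_U :: "real \<Rightarrow> real \<Rightarrow> 'n \<Rightarrow> (real ^ 'n \<Rightarrow> real ^ 'n) \<Rightarrow> (real ^ 'n \<Rightarrow> real)
    \<Rightarrow> real \<Rightarrow> real ^ 'n \<Rightarrow> real ^ 'n" where
  "bous_U \<nu> lam d U0 \<Theta>0 t x =
     exp (- \<nu> * t) *\<^sub>R U0 x + bous_rho \<nu> lam t *\<^sub>R leray (\<lambda>y. \<Theta>0 y *\<^sub>R axis d 1) x"

definition E_zero :: "real \<Rightarrow> real \<Rightarrow> 'n \<Rightarrow> (real ^ 'n \<Rightarrow> real ^ 'n) \<Rightarrow> (real ^ 'n \<Rightarrow> real)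
    \<Rightarrow> ennreal" where
  "E_zero \<nu> lam d U0 \<Theta>0 =
     (let U = bous_U \<nu> lam d U0 \<Theta>0; \<Theta> = bous_Theta lam \<Theta>0 in
      \<integral>\<^sup>+ t\<in>{0..}. (sobolev_norm_vec 3 (advect_vec (U t) (U t))
                     + sobolev_norm 3 (advect (U t) (\<Theta> t))) \<partial>lborel)"

definition F_zero :: "real \<Rightarrow> real \<Rightarrow> 'n \<Rightarrow> (real ^ 'n \<Rightarrow> real ^ 'n) \<Rightarrow> (real ^ 'n \<Rightarrow> real)
    \<Rightarrow> ennreal" where
  "F_zero \<nu> lam d U0 \<Theta>0 =
     (let U = bous_U \<nu> lam d U0 \<Theta>0; \<Theta> = bous_Theta lam \<Theta>0 in
      \<integral>\<^sup>+ t\<in>{0..}. (Linf_norm (U t) + Linf_norm (\<Theta> t)) \<partial>lborel)"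

text \<open>
  The quantity \<open>L\<^sub>C\<close>. It is set to \<open>\<infinity>\<close> as soon as one of its ingredients is infinite (even if
  the prefactor vanishes), so an upper bound by a real number includes finiteness of all of them.
\<close>

definition L_quant :: "real \<Rightarrow> real \<Rightarrow> 'n \<Rightarrow> real \<Rightarrow> (real ^ 'n \<Rightarrow> real ^ 'n) \<Rightarrow> (real ^ 'n \<Rightarrow> real)
    \<Rightarrow> (real ^ 'n \<Rightarrow> real ^ 'n) \<Rightarrow> (real ^ 'n \<Rightarrow> real) \<Rightarrow> ennreal" where
  "L_quant \<nu> lam d C U0 \<Theta>0 v0 \<theta>0 =
     (let A = (sobolev_norm_vec 3 v0)\<^sup>2 + (sobolev_norm 3 \<theta>0)\<^sup>2 + E_zero \<nu> lam d U0 \<Theta>0;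
          E = E_zero \<nu> lam d U0 \<Theta>0; F = F_zero \<nu> lam d U0 \<Theta>0
      in if A = \<infinity> \<or> F = \<infinity> then \<infinity>
         else ennreal (enn2real A * exp (C * enn2real F + C * enn2real E)))"

end

theory Submission
  imports Defs "HOL-Probability.Probability"
begin

text \<open>
  All functions in play are Fourier multipliers applied to the single function \<open>a\<^sub>0\<close>, with symbols
  that are bounded on the support \<open>S\<close> of \<open>\<F>a\<^sub>0\<close>; here and below \<open>\<F>f\<close> is the Fourier transform. Hence a
  nonlinear term \<open>U \<bullet> \<nabla>f\<close> has as its transform a bilinear convolution of \<open>\<F>a\<^sub>0\<close> with itself, and up to
  bounded factors the bilinear symbol at \<open>(\<xi>, \<eta>)\<close> is \<open>u(\<xi>) \<bullet> \<eta>\<close>, where \<open>u\<close> is the symbol of \<open>U\<close>. The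
  geometry of \<open>S\<close> makes this number \<open>O(\<epsilon>)\<close> on \<open>S \<times> S\<close>, term by term: a rotated gradient
  contributes \<open>\<xi>\<^sub>2 \<eta>\<^sub>1 - \<xi>\<^sub>1 \<eta>\<^sub>2\<close>, which is small because both frequencies lie within \<open>\<epsilon>\<close> of the
  diagonal (\<open>cross_near_diagonal\<close>); the Leray projection of a vertical field contributes
  \<open>\<eta>\<^sub>d - \<xi>\<^sub>d (\<xi> \<bullet> \<eta>) / \<bar>\<xi>\<bar>\<^sup>2\<close>, which in the plane is again a multiple of that cross product
  (\<open>leray_cross_2\<close>) and in space carries a factor \<open>\<xi>\<^sub>3\<close> or \<open>\<eta>\<^sub>3\<close> in each term.
  Young's inequality for convolutions and Plancherel then bound the \<open>L\<^sup>2\<close> norm of the nonlinear term by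
  a multiple of \<open>\<epsilon> \<parallel>\<F>a\<^sub>0\<parallel>\<^sub>1 \<parallel>a\<^sub>0\<parallel>\<^sub>2\<close> (\<open>advect_sobolev_bound\<close>). Its frequencies stay in a fixed ball, so
  passing to \<open>H\<^sup>3\<close> costs only a constant. The time factors \<open>e\<^sup>-\<^sup>\<nu>\<^sup>t\<close>, \<open>e\<^sup>-\<^sup>\<lambda>\<^sup>t\<close> and \<open>\<rho>(t)\<close> share an exponentially
  decaying envelope, which makes \<open>E\<^sub>0\<close> and \<open>F\<^sub>0\<close> finite; for \<open>F\<^sub>0\<close> the sup norm is bounded by the
  \<open>L\<^sup>1\<close> norm of the transform.

  The \<open>L\<^sup>2\<close> Fourier transform is defined through approximating sequences, and its working properties
  come from two facts. The first is the Plancherel inequality on \<open>L\<^sup>1\<close>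
  (\<open>plancherel_inequality\<close>), obtained by inserting a Gaussian weight; it makes the transform of
  an \<open>L\<^sup>2\<close> function exist and be unique almost everywhere. The second is the injectivity of the transform on
  \<open>L\<^sup>1\<close> (\<open>fourier_L1_injective\<close>). Tested against modulated or translated Gaussians, it yields both halves of
  the inversion theorem (\<open>has_fourier_L2_inv_fourier\<close>, \<open>fourier_L2_inversion\<close>). From there on the
  argument lives on the frequency side, in terms of the relation \<open>has_spectrum\<close>, which is preserved by
  linear combinations, products, partial derivatives and the Leray projection.
\<close>

section \<open>Gaussians and their Fourier transforms\<close>

definition gauss :: "real \<Rightarrow> 'a::euclidean_space \<Rightarrow> real" where
  "gauss s x = exp (- (s\<^sup>2 * (norm x)\<^sup>2) / 2)"

lemma gauss_measurable [measurable]: "gauss s \<in> borel_measurable borel"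
  unfolding gauss_def by measurable

lemma gauss_nonneg [simp]: "0 \<le> gauss s x" and gauss_pos: "0 < gauss s x"
  and gauss_le_1: "gauss s x \<le> 1"
  by (auto simp: gauss_def)

lemma gauss_minus [simp]: "gauss s (- x) = gauss s x"
  by (simp add: gauss_def)

lemma norm_cis_mult [simp]: "norm (cis a * z) = norm z" "norm (z * cis a) = norm z"
  by (simp_all add: norm_mult)

lemma measurable_cis [measurable]: "cis \<in> borel_measurable borel"
  by (intro borel_measurable_continuous_onI continuous_intros)

text \<open>The Gaussian is a tensor product, which reduces its transform to dimension one.\<close>

lemma gauss_eq_prod: "gauss s (x::'a::euclidean_space) = (\<Prod>b\<in>Basis. gauss s (x \<bullet> b))"
proof -
  have "(norm x)\<^sup>2 = (\<Sum>b\<in>Basis. (x \<bullet> b)\<^sup>2)"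
    by (metis (mono_tags, lifting) euclidean_inner power2_eq_square power2_norm_eq_inner sum.cong)
  then show ?thesis
    by (simp add: gauss_def exp_sum[symmetric] sum_distrib_left sum_divide_distrib sum_negf[symmetric])
qed

lemma cis_sum: "finite A \<Longrightarrow> cis (\<Sum>a\<in>A. f a) = (\<Prod>a\<in>A. cis (f a))"
  by (induction A rule: finite_induct) (auto simp: cis_mult[symmetric])

text \<open>The one-dimensional transform is the characteristic function of the standard normal distribution, rescaled by \<open>s\<close>.\<close>

lemma gauss_real_integrable: "s > 0 \<Longrightarrow> integrable lborel (gauss s :: real \<Rightarrow> real)"
  and gauss_real_transform: "s > 0 \<Longrightarrow>
    (LINT x|lborel. cis (- (x * t)) * of_real (gauss s x)) = of_real (sqrt (2 * pi) / s * gauss (1 / s) t)"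
proof -
  have d: "std_normal_density (s * x) = gauss s x / sqrt (2*pi)" for s x
    by (simp add: std_normal_density_def gauss_def power_mult_distrib)
  {
    assume s: "s > 0"
    have "integrable lborel std_normal_density"
      by (simp add: integrable_normal_density)
    then have "integrable lborel (\<lambda>x. std_normal_density (0 + s * x))"
      using s by (subst lborel_integrable_real_affine_iff) auto
    from integrable_mult_right[OF this, of "sqrt (2 * pi)"] show "integrable lborel (gauss s :: real \<Rightarrow> real)"
      by (simp add: d)
    have "complex_of_real (exp (- ((- t/s)^2) / 2)) = char std_normal_distribution (- t/s)"
      by (simp add: char_std_normal_distribution)
    also have "\<dots> = (LINT x|lborel. std_normal_density x *\<^sub>R iexp (- t/s * x))"
      unfolding char_def by (subst integral_density) auto
    also have "\<dots> = s *\<^sub>R (LINT x|lborel. std_normal_density (0 + s * x) *\<^sub>R iexp (- t/s * (0 + s * x)))"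
      using s by (subst lborel_integral_real_affine[where c=s and t=0]) auto
    also have "(LINT x|lborel. std_normal_density (0 + s * x) *\<^sub>R iexp (- t/s * (0 + s * x)))
       = (LINT x|lborel. of_real (1 / sqrt (2*pi)) * (cis (- (x * t)) * of_real (gauss s x)))"
      using s by (intro Bochner_Integration.integral_cong refl)
        (simp add: d cis_conv_exp scaleR_conv_of_real, simp add: mult_ac)
    also have "\<dots> = of_real (1 / sqrt (2*pi)) * (LINT x|lborel. (cis (- (x * t)) * of_real (gauss s x)))"
      by simp
    finally have *: "complex_of_real (exp (- ((- t/s)^2) / 2)) =
      of_real (s / sqrt (2*pi)) * (LINT x|lborel. (cis (- (x * t)) * of_real (gauss s x)))"
      by (simp add: scaleR_conv_of_real mult_ac)
    have g: "gauss (1/s) t = exp (- ((- t/s)^2) / 2)"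
      by (simp add: gauss_def power_divide)
    have "of_real (sqrt (2 * pi) / s * gauss (1 / s) t)
       = complex_of_real (sqrt (2 * pi) / s) * complex_of_real (exp (- ((- t/s)^2) / 2))"
      by (simp add: g)
    also have "\<dots> = complex_of_real (sqrt (2 * pi) / s * (s / sqrt (2*pi))) *
      (LINT x|lborel. (cis (- (x * t)) * of_real (gauss s x)))"
      unfolding * by (simp only: of_real_mult mult_ac)
    also have "sqrt (2 * pi) / s * (s / sqrt (2*pi)) = 1" using s by simp
    finally show "(LINT x|lborel. cis (- (x * t)) * of_real (gauss s x)) = of_real (sqrt (2 * pi) / s * gauss (1 / s) t)"
      by simp
  }
qed

lemma fourier_gauss:
  fixes \<xi> :: "'a::euclidean_space"
  assumes s: "s > 0"
  shows gauss_integrable: "integrable lborel (gauss s :: 'a \<Rightarrow> real)"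
    and "fourier_L1 (\<lambda>x. of_real (gauss s x)) \<xi> = of_real ((sqrt (2 * pi) / s) ^ DIM('a) * gauss (1 / s) \<xi>)"
proof -
  interpret P: product_sigma_finite "\<lambda>b::'a. lborel :: real measure" ..
  let ?M = "\<Pi>\<^sub>M b\<in>(Basis::'a set). (lborel::real measure)"
  let ?T = "\<lambda>f. \<Sum>b\<in>Basis. f b *\<^sub>R (b::'a)"
  have T[measurable]: "?T \<in> ?M \<rightarrow>\<^sub>M borel"
    by measurable
  have inner: "?T f \<bullet> b = f b" if "b \<in> Basis" for f b
    using that by (simp add: inner_sum_left inner_Basis if_distrib sum.delta' cong: if_cong)
  have "integrable ?M (\<lambda>f. \<Prod>b\<in>Basis. gauss s (f b))"
    using s by (intro P.product_integrable_prod gauss_real_integrable) auto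
  then have "integrable ?M (\<lambda>f. gauss s (?T f))"
    by (simp add: gauss_eq_prod[of s "?T _"] inner)
  then show "integrable lborel (gauss s :: 'a \<Rightarrow> real)"
    by (subst lborel_eq) (simp add: integrable_distr_eq)
  have "fourier_L1 (\<lambda>x. of_real (gauss s x)) \<xi> =
    (\<integral>f. cis (- (?T f \<bullet> \<xi>)) * of_real (gauss s (?T f)) \<partial>?M)"
    unfolding fourier_L1_def by (subst lborel_eq, subst integral_distr) auto
  also have "\<dots> = (\<integral>f. (\<Prod>b\<in>Basis. cis (- (f b * (\<xi> \<bullet> b))) * of_real (gauss s (f b))) \<partial>?M)"
    by (intro Bochner_Integration.integral_cong refl)
       (simp add: gauss_eq_prod[of s "?T _"] inner euclidean_inner[of "?T _" \<xi>] sum_negf[symmetric]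
         cis_sum prod.distrib)
  also have "\<dots> = (\<Prod>b\<in>Basis. LINT x|lborel. cis (- (x * (\<xi> \<bullet> b))) * of_real (gauss s x))"
  proof (intro P.product_integral_prod)
    fix b :: 'a
    show "integrable lborel (\<lambda>x. cis (- (x * (\<xi> \<bullet> b))) * of_real (gauss s x))"
      using gauss_real_integrable[OF s] by (rule Bochner_Integration.integrable_bound) auto
  qed auto
  also have "\<dots> = (\<Prod>b\<in>Basis. of_real (sqrt (2 * pi) / s * gauss (1 / s) (\<xi> \<bullet> b)))"
    using s by (simp add: gauss_real_transform)
  also have "\<dots> = of_real ((sqrt (2 * pi) / s) ^ DIM('a) * gauss (1 / s) \<xi>)"
    unfolding gauss_eq_prod[of "1/s" \<xi>] of_real_prod[symmetric] by (simp add: prod.distrib prod_dividef power_divide)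
  finally show "fourier_L1 (\<lambda>x. of_real (gauss s x)) \<xi> = of_real ((sqrt (2 * pi) / s) ^ DIM('a) * gauss (1 / s) \<xi>)" .
qed

lemma integral_gauss:
  "s > 0 \<Longrightarrow> (LINT x|lborel. gauss s (x::'a::euclidean_space)) = (sqrt (2 * pi) / s) ^ DIM('a)"
  using fourier_gauss(2)[of s "0::'a"] unfolding fourier_L1_def
  by (simp add: gauss_def flip: of_real_power of_real_divide)

section \<open>Fubini with a bounded kernel\<close>

lemma (in pair_sigma_finite) integrable_tensor_kernel:
  fixes f :: "'a \<Rightarrow> complex" and g :: "'b \<Rightarrow> complex"
  assumes f: "integrable M1 f" and g: "integrable M2 g"
    and K[measurable]: "(\<lambda>(x, y). K x y) \<in> borel_measurable (M1 \<Otimes>\<^sub>M M2)" and K1: "\<And>x y. norm (K x y) \<le> B"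
  shows "integrable (M1 \<Otimes>\<^sub>M M2) (\<lambda>(x, y). f x * (K x y * g y))"
proof -
  have [measurable]: "f \<in> borel_measurable M1" "g \<in> borel_measurable M2" using f g by auto
  have "integrable (M1 \<Otimes>\<^sub>M M2) (\<lambda>p. f (fst p) * g (snd p))"
  proof (rule Fubini_integrable)
    show "integrable M1 (\<lambda>x. \<integral> y. norm (f (fst (x, y)) * g (snd (x, y))) \<partial>M2)"
      using f by (auto simp: norm_mult)
  qed (use g in auto)
  then have "integrable (M1 \<Otimes>\<^sub>M M2) (\<lambda>p. B * norm (f (fst p) * g (snd p)))" by auto
  then show ?thesis
  proof (rule Bochner_Integration.integrable_bound)
    show "AE p in M1 \<Otimes>\<^sub>M M2. norm (case p of (x, y) \<Rightarrow> f x * (K x y * g y)) \<le> norm (B * norm (f (fst p) * g (snd p)))"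
    proof (rule AE_I2)
      fix p
      have "norm (K (fst p) (snd p)) * (norm (f (fst p)) * norm (g (snd p))) \<le> B * (norm (f (fst p)) * norm (g (snd p)))"
        using K1 by (intro mult_right_mono) auto
      also have "\<dots> \<le> \<bar>B * (norm (f (fst p)) * norm (g (snd p)))\<bar>" by simp
      finally show "norm (case p of (x, y) \<Rightarrow> f x * (K x y * g y)) \<le> norm (B * norm (f (fst p) * g (snd p)))"
        by (simp add: norm_mult split_beta mult_ac)
    qed
  qed measurable
qed

text \<open>
  The only form of Fubini needed for oscillatory integrals: a bounded kernel between two
  integrable functions. It gives the multiplication formula, the weighted Plancherel identity and
  the pairing of \<open>f\<close> with mollified test functions.
\<close>

lemma (in pair_sigma_finite) integral_kernel_swap:
  fixes f :: "'a \<Rightarrow> complex" and g :: "'b \<Rightarrow> complex"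
  assumes f: "integrable M1 f" and g: "integrable M2 g"
    and K: "(\<lambda>(x, y). K x y) \<in> borel_measurable (M1 \<Otimes>\<^sub>M M2)" and K1: "\<And>x y. norm (K x y) \<le> B"
  shows "(LINT x|M1. f x * (LINT y|M2. K x y * g y)) = (LINT y|M2. g y * (LINT x|M1. K x y * f x))"
proof -
  have "(LINT x|M1. f x * (LINT y|M2. K x y * g y)) = (LINT x|M1. LINT y|M2. f x * (K x y * g y))"
    by simp
  also have "\<dots> = (LINT y|M2. LINT x|M1. f x * (K x y * g y))"
    using integrable_tensor_kernel[OF assms] by (intro Fubini_integral[symmetric])
  also have "\<dots> = (LINT y|M2. LINT x|M1. g y * (K x y * f x))"
    by (simp add: mult_ac)
  finally show ?thesis by simp
qed

lemma integrable_tensor: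
  fixes f :: "'a::euclidean_space \<Rightarrow> complex" and g :: "'b::euclidean_space \<Rightarrow> complex"
  assumes "integrable lborel f" "integrable lborel g"
  shows "integrable lborel (\<lambda>p. f (fst p) * g (snd p))"
  using lborel_pair.integrable_tensor_kernel[OF assms, of "\<lambda>_ _. 1" 1] by (simp add: lborel_prod case_prod_beta')

lemma fourier_L1_measurable [measurable]: 
  assumes [measurable]: "f \<in> borel_measurable borel"
  shows "fourier_L1 f \<in> borel_measurable borel"
  unfolding fourier_L1_def by measurable

lemma integrable_cis:
  "integrable lborel f \<Longrightarrow> integrable lborel (\<lambda>x. cis (- (x \<bullet> \<xi>)) * f x)"
  for f :: "'a::euclidean_space \<Rightarrow> complex"
  by (rule Bochner_Integration.integrable_bound[of _ f]) auto

lemma fourier_L1_multiplication: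
  fixes f g :: "'a::euclidean_space \<Rightarrow> complex"
  assumes "integrable lborel f" "integrable lborel g"
  shows "(LINT x|lborel. f x * fourier_L1 g x) = (LINT x|lborel. fourier_L1 f x * g x)"
  unfolding fourier_L1_def
  using lborel_pair.integral_kernel_swap[OF assms, of "\<lambda>x y. cis (- (x \<bullet> y))" 1]
  by (simp add: inner_commute mult.commute)

lemma fourier_L1_bound: 
  assumes "integrable lborel f"
  shows "norm (fourier_L1 f \<xi>) \<le> L1_norm f"
  unfolding fourier_L1_def L1_norm_def 
  by (rule order_trans[OF integral_norm_bound]) simp

lemma fourier_L1_diff:
  assumes "integrable lborel f" "integrable lborel g"
  shows "fourier_L1 (\<lambda>x. f x - g x) \<xi> = fourier_L1 f \<xi> - fourier_L1 g \<xi>"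
  unfolding fourier_L1_def using integrable_cis[OF assms(1)] integrable_cis[OF assms(2)] by (simp add: right_diff_distrib)

section \<open>The Plancherel inequality\<close>

definition L2sq :: "('a::euclidean_space \<Rightarrow> 'b::real_normed_vector) \<Rightarrow> ennreal" where
  "L2sq f = (\<integral>\<^sup>+ x. ennreal ((norm (f x))\<^sup>2) \<partial>lborel)"

lemma borel_measurable_fst_snd [measurable]:
  "fst \<in> borel_measurable (borel :: ('a::euclidean_space \<times> 'b::euclidean_space) measure)"
  "snd \<in> borel_measurable (borel :: ('a::euclidean_space \<times> 'b::euclidean_space) measure)"
  by (auto intro!: borel_measurable_continuous_onI continuous_intros)

lemma lborel_reflect: "lborel = distr lborel borel (\<lambda>y. x - y :: 'a::euclidean_space)"
  using lborel_affine[of "-1" x] by (simp add: density_1)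

lemma nn_integral_reflect:
  assumes [measurable]: "F \<in> borel_measurable borel"
  shows "(\<integral>\<^sup>+ y. F (x - y :: 'a::euclidean_space) \<partial>lborel) = (\<integral>\<^sup>+ y. F y \<partial>lborel)"
  by (subst (2) lborel_reflect[of x]) (simp add: nn_integral_distr)

lemma integral_reflect:
  fixes F :: "'a::euclidean_space \<Rightarrow> complex"
  assumes [measurable]: "F \<in> borel_measurable borel"
  shows "(LINT y|lborel. F (x - y)) = (LINT y|lborel. F y)"
  by (subst (2) lborel_reflect[of x]) (simp add: integral_distr)

lemma integrable_reflect:
  fixes F :: "'a::euclidean_space \<Rightarrow> complex"
  assumes "integrable lborel F"
  shows "integrable lborel (\<lambda>y. F (x - y))"
proof -
  have [measurable]: "F \<in> borel_measurable borel" using assms by auto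
  show ?thesis
    using assms by (subst (asm) lborel_reflect[of x]) (simp add: integrable_distr_eq)
qed

lemma nn_integral_gauss:
  "s > 0 \<Longrightarrow> (\<integral>\<^sup>+ y. ennreal (gauss s (y::'a::euclidean_space)) \<partial>lborel) = ennreal ((sqrt (2 * pi) / s) ^ DIM('a))"
  by (subst nn_integral_eq_integral) (auto simp: integral_gauss intro: gauss_integrable)

lemma integral_tensor:
  fixes f :: "'a::euclidean_space \<Rightarrow> complex" and g :: "'b::euclidean_space \<Rightarrow> complex"
  assumes "integrable lborel f" "integrable lborel g"
  shows "(LINT p|lborel. f (fst p) * g (snd p)) = (LINT x|lborel. f x) * (LINT y|lborel. g y)"
proof -
  have "(LINT p|lborel. f (fst p) * g (snd p)) = (LINT x|lborel. LINT y|lborel. f (fst (x, y)) * g (snd (x, y)))"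
    using integrable_tensor[OF assms] unfolding lborel_prod[symmetric]
    by (subst lborel_pair.integral_fst'[symmetric]) auto
  then show ?thesis by simp
qed

text \<open>Fatou in the form used throughout: an eventual bound on the integrals passes to the pointwise limit.\<close>

lemma nn_integral_le_of_tendsto:
  fixes u :: "nat \<Rightarrow> 'a \<Rightarrow> ennreal"
  assumes u: "\<And>n. u n \<in> borel_measurable M" and lim: "AE x in M. (\<lambda>n. u n x) \<longlonglongrightarrow> v x"
    and bound: "eventually (\<lambda>n. (\<integral>\<^sup>+ x. u n x \<partial>M) \<le> C) sequentially"
  shows "(\<integral>\<^sup>+ x. v x \<partial>M) \<le> C"
proof -
  have "(\<integral>\<^sup>+ x. v x \<partial>M) = (\<integral>\<^sup>+ x. liminf (\<lambda>n. u n x) \<partial>M)"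
    using lim by (intro nn_integral_cong_AE, eventually_elim) (simp add: lim_imp_Liminf)
  also have "\<dots> \<le> liminf (\<lambda>n. \<integral>\<^sup>+ x. u n x \<partial>M)"
    by (rule nn_integral_liminf[OF u])
  also have "\<dots> \<le> limsup (\<lambda>n. \<integral>\<^sup>+ x. u n x \<partial>M)" by (simp add: Liminf_le_Limsup)
  also have "\<dots> \<le> C" using bound by (rule Limsup_bounded)
  finally show ?thesis .
qed

text \<open>
  Against the weight \<open>gauss s\<close> everything is absolutely integrable, so the square of the transform
  can be expanded and the \<open>\<xi>\<close>-integral carried out first. It turns the left-hand side into the
  integral of \<open>f(x) cnj (f(y))\<close> against a Gaussian kernel in \<open>x - y\<close>; estimating
  \<open>\<bar>f(x) f(y)\<bar>\<close> by half the sum of the squares then leaves only the total mass of that kernel.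
\<close>

lemma plancherel_weighted:
  fixes f :: "'a::euclidean_space \<Rightarrow> complex"
  assumes f: "integrable lborel f" and s: "s > 0"
  shows "(\<integral>\<^sup>+ \<xi>. ennreal ((norm (fourier_L1 f \<xi>))\<^sup>2 * gauss s \<xi>) \<partial>lborel) \<le> ennreal ((2 * pi) ^ DIM('a)) * L2sq f"
proof -
  have [measurable]: "f \<in> borel_measurable borel" using f by auto
  define h where "h z = f (fst z) * cnj (f (snd z))" for z
  have h: "integrable lborel h"
    unfolding h_def using f by (intro integrable_tensor integrable_cnj)
  have [measurable]: "h \<in> borel_measurable borel" using h by auto
  define c where "c = (sqrt (2 * pi) / s) ^ DIM('a)"
  have c: "c \<ge> 0" using s by (simp add: c_def)
  have ga: "integrable lborel (\<lambda>\<xi>::'a. complex_of_real (gauss s \<xi>))"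
    using gauss_integrable[OF s] by auto
  have gauss_transform: "(LINT \<xi>|lborel. cis (- (w \<bullet> \<xi>)) * of_real (gauss s \<xi>)) = of_real (c * gauss (1 / s) w)" for w :: 'a
    using fourier_gauss(2)[OF s, of w] by (simp add: fourier_L1_def inner_commute[of w] c_def)
  have sq: "complex_of_real ((norm (fourier_L1 f \<xi>))\<^sup>2) = (LINT z|lborel. cis (- ((fst z - snd z) \<bullet> \<xi>)) * h z)" for \<xi>
  proof -
    have "complex_of_real ((norm (fourier_L1 f \<xi>))\<^sup>2) = fourier_L1 f \<xi> * cnj (fourier_L1 f \<xi>)"
      by (rule complex_norm_square)
    also have "\<dots> = (LINT p|lborel. (cis (- (fst p \<bullet> \<xi>)) * f (fst p)) * cnj (cis (- (snd p \<bullet> \<xi>)) * f (snd p)))"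
      unfolding fourier_L1_def Bochner_Integration.integral_cnj[symmetric]
      by (intro integral_tensor[symmetric] integrable_cis f integrable_cnj)
    also have "\<dots> = (LINT z|lborel. cis (- ((fst z - snd z) \<bullet> \<xi>)) * h z)"
    proof (intro Bochner_Integration.integral_cong refl)
      fix z :: "'a \<times> 'a"
      have "cis (- ((fst z - snd z) \<bullet> \<xi>)) = cis (snd z \<bullet> \<xi>) * cis (- (fst z \<bullet> \<xi>))"
        by (simp add: cis_mult inner_diff_left)
      then show "(cis (- (fst z \<bullet> \<xi>)) * f (fst z)) * cnj (cis (- (snd z \<bullet> \<xi>)) * f (snd z))
          = cis (- ((fst z - snd z) \<bullet> \<xi>)) * h z"
        by (simp add: h_def cis_cnj mult_ac)
    qed
    finally show ?thesis .
  qed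
  have "(LINT \<xi>|lborel. complex_of_real ((norm (fourier_L1 f \<xi>))\<^sup>2 * gauss s \<xi>)) =
     (LINT \<xi>|lborel. of_real (gauss s \<xi>) * (LINT z|lborel. cis (- ((fst z - snd z) \<bullet> \<xi>)) * h z))"
    unfolding sq[symmetric] of_real_mult[symmetric] by (simp only: mult.commute)
  also have "\<dots> = (LINT z|lborel. h z * (LINT \<xi>|lborel. cis (- ((fst z - snd z) \<bullet> \<xi>)) * of_real (gauss s \<xi>)))"
  proof (rule lborel_pair.integral_kernel_swap[OF h ga, of _ 1, symmetric])
    show "(\<lambda>(z, \<xi>). cis (- ((fst z - snd z) \<bullet> \<xi>))) \<in> borel_measurable (lborel \<Otimes>\<^sub>M lborel)"
      unfolding lborel_prod case_prod_beta' measurable_lborel2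
      by (intro borel_measurable_continuous_onI continuous_intros)
  qed auto
  also have "\<dots> = (LINT z|lborel. h z * of_real (c * gauss (1 / s) (fst z - snd z)))"
    unfolding gauss_transform ..
  finally have eq: "(LINT \<xi>|lborel. complex_of_real ((norm (fourier_L1 f \<xi>))\<^sup>2 * gauss s \<xi>)) =
     (LINT z|lborel. h z * of_real (c * gauss (1 / s) (fst z - snd z)))" .
  have "integrable lborel (\<lambda>\<xi>::'a. (norm (fourier_L1 f \<xi>))\<^sup>2 * gauss s \<xi>)"
  proof (rule Bochner_Integration.integrable_bound)
    show "integrable lborel (\<lambda>\<xi>::'a. (L1_norm f)\<^sup>2 * gauss s \<xi>)"
      using gauss_integrable[OF s] by auto
    show "AE \<xi>::'a in lborel. norm ((norm (fourier_L1 f \<xi>))\<^sup>2 * gauss s \<xi>) \<le> norm ((L1_norm f)\<^sup>2 * gauss s \<xi>)"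
      by (auto intro!: mult_right_mono power_mono fourier_L1_bound f simp: abs_mult)
  qed measurable
  then have "(\<integral>\<^sup>+ \<xi>. ennreal ((norm (fourier_L1 f \<xi>))\<^sup>2 * gauss s \<xi>) \<partial>lborel)
     = ennreal (LINT \<xi>|lborel. (norm (fourier_L1 f \<xi>))\<^sup>2 * gauss s \<xi>)"
    by (intro nn_integral_eq_integral) auto
  also have "\<dots> = ennreal (norm (LINT \<xi>|lborel. complex_of_real ((norm (fourier_L1 f \<xi>))\<^sup>2 * gauss s \<xi>)))"
    unfolding integral_complex_of_real norm_of_real by (subst abs_of_nonneg) auto
  also have "\<dots> \<le> (\<integral>\<^sup>+ z. ennreal (norm (h z * of_real (c * gauss (1 / s) (fst z - snd z)))) \<partial>lborel)"
    unfolding eq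
  proof (rule integral_norm_bound_ennreal, rule Bochner_Integration.integrable_bound)
    show "integrable lborel (\<lambda>z. complex_of_real c * h z)" using h by auto
    show "AE z in lborel. norm (h z * of_real (c * gauss (1 / s) (fst z - snd z))) \<le> norm (of_real c * h z)"
    proof (rule AE_I2)
      fix z :: "'a \<times> 'a"
      have "c * gauss (1 / s) (fst z - snd z) \<le> c"
        using c by (intro mult_left_le gauss_le_1)
      from mult_left_mono[OF this, of "norm (h z)"] c
      show "norm (h z * of_real (c * gauss (1 / s) (fst z - snd z))) \<le> norm (of_real c * h z)"
        by (simp add: norm_mult mult.commute)
    qed
  qed measurable
  also have "\<dots> \<le> (\<integral>\<^sup>+ z. ennreal (c / 2) * (ennreal ((norm (f (fst z)))\<^sup>2) * ennreal (gauss (1 / s) (fst z - snd z)))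
      + ennreal (c / 2) * (ennreal ((norm (f (snd z)))\<^sup>2) * ennreal (gauss (1 / s) (fst z - snd z))) \<partial>lborel)"
  proof (rule nn_integral_mono)
    fix z :: "'a \<times> 'a"
    let ?g = "gauss (1 / s) (fst z - snd z)"
    have "norm (f (fst z)) * norm (f (snd z)) \<le> ((norm (f (fst z)))\<^sup>2 + (norm (f (snd z)))\<^sup>2) / 2"
      using sum_squares_bound[of "norm (f (fst z))" "norm (f (snd z))"] by simp
    then have "(norm (f (fst z)) * norm (f (snd z))) * (c * ?g) \<le> ((norm (f (fst z)))\<^sup>2 + (norm (f (snd z)))\<^sup>2) / 2 * (c * ?g)"
      using c by (intro mult_right_mono) auto
    also have "\<dots> = c / 2 * ((norm (f (fst z)))\<^sup>2 * ?g) + c / 2 * ((norm (f (snd z)))\<^sup>2 * ?g)"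
      by (simp add: field_simps)
    finally show "ennreal (norm (h z * of_real (c * ?g))) \<le> ennreal (c / 2) * (ennreal ((norm (f (fst z)))\<^sup>2) * ennreal ?g)
      + ennreal (c / 2) * (ennreal ((norm (f (snd z)))\<^sup>2) * ennreal ?g)"
      using c by (simp add: h_def norm_mult ennreal_mult'[symmetric] ennreal_plus[symmetric] ennreal_leI del: ennreal_plus)
  qed
  also have "\<dots> = ennreal (c / 2) * (\<integral>\<^sup>+ z. ennreal ((norm (f (fst z)))\<^sup>2) * ennreal (gauss (1 / s) (fst z - snd z)) \<partial>lborel)
     + ennreal (c / 2) * (\<integral>\<^sup>+ z. ennreal ((norm (f (snd z)))\<^sup>2) * ennreal (gauss (1 / s) (fst z - snd z)) \<partial>lborel)"
    by (simp add: nn_integral_add nn_integral_cmult)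
  also have "(\<integral>\<^sup>+ z. ennreal ((norm (f (fst z)))\<^sup>2) * ennreal (gauss (1 / s) (fst z - snd z)) \<partial>lborel)
     = (\<integral>\<^sup>+ x. \<integral>\<^sup>+ y. ennreal ((norm (f x))\<^sup>2) * ennreal (gauss (1 / s) (x - y)) \<partial>lborel \<partial>lborel)"
    unfolding lborel_prod[symmetric] by (subst lborel.nn_integral_fst[symmetric]) auto
  also have "\<dots> = ennreal ((sqrt (2 * pi) * s) ^ DIM('a)) * L2sq f"
    using s by (simp add: nn_integral_cmult nn_integral_multc nn_integral_reflect[of "\<lambda>y. ennreal (gauss _ y)"] nn_integral_gauss L2sq_def mult.commute)
  also have "(\<integral>\<^sup>+ z. ennreal ((norm (f (snd z)))\<^sup>2) * ennreal (gauss (1 / s) (fst z - snd z)) \<partial>lborel)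
     = (\<integral>\<^sup>+ y. \<integral>\<^sup>+ x. ennreal ((norm (f y))\<^sup>2) * ennreal (gauss (1 / s) (y - x)) \<partial>lborel \<partial>lborel)"
    unfolding lborel_prod[symmetric]
    by (subst lborel_pair.nn_integral_snd[symmetric]) (auto intro!: nn_integral_cong simp: gauss_def norm_minus_commute)
  also have "\<dots> = ennreal ((sqrt (2 * pi) * s) ^ DIM('a)) * L2sq f"
    using s by (simp add: nn_integral_cmult nn_integral_multc nn_integral_reflect[of "\<lambda>y. ennreal (gauss _ y)"] nn_integral_gauss L2sq_def mult.commute)
  also have "ennreal (c / 2) * (ennreal ((sqrt (2 * pi) * s) ^ DIM('a)) * L2sq f) + ennreal (c / 2) * (ennreal ((sqrt (2 * pi) * s) ^ DIM('a)) * L2sq f)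
    = ennreal (c / 2 + c / 2) * (ennreal ((sqrt (2 * pi) * s) ^ DIM('a)) * L2sq f)"
    unfolding distrib_right[symmetric] using c by (subst ennreal_plus) auto
  also have "\<dots> = ennreal (c * (sqrt (2 * pi) * s) ^ DIM('a)) * L2sq f"
    using c s by (subst ennreal_mult) (auto simp: mult.assoc)
  also have "c * (sqrt (2 * pi) * s) ^ DIM('a) = (2 * pi) ^ DIM('a)"
    unfolding c_def power_mult_distrib[symmetric] using s by simp
  finally show ?thesis .
qed

text \<open>Let the Gaussian weight increase to \<open>1\<close>.\<close>

lemma plancherel_inequality:
  fixes f :: "'a::euclidean_space \<Rightarrow> complex"
  assumes f: "integrable lborel f"
  shows "L2sq (fourier_L1 f) \<le> ennreal ((2 * pi) ^ DIM('a)) * L2sq f"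
  unfolding L2sq_def[of "fourier_L1 f"]
proof (rule nn_integral_le_of_tendsto)
  have [measurable]: "f \<in> borel_measurable borel" using f by auto
  let ?s = "\<lambda>n. 1 / real (Suc n)"
  show "AE \<xi> in lborel. (\<lambda>n. ennreal ((norm (fourier_L1 f \<xi>))\<^sup>2 * gauss (?s n) \<xi>)) \<longlonglongrightarrow> ennreal ((norm (fourier_L1 f \<xi>))\<^sup>2)"
  proof (intro AE_I2 tendsto_ennrealI)
    fix \<xi> :: 'a
    have "?s \<longlonglongrightarrow> 0" by (rule lim_1_over_n[THEN LIMSEQ_Suc])
    then have "(\<lambda>n. (norm (fourier_L1 f \<xi>))\<^sup>2 * gauss (?s n) \<xi>) \<longlonglongrightarrow> (norm (fourier_L1 f \<xi>))\<^sup>2 * exp (- (0\<^sup>2 * (norm \<xi>)\<^sup>2) / 2)"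
      unfolding gauss_def by (intro tendsto_intros) auto
    then show "(\<lambda>n. (norm (fourier_L1 f \<xi>))\<^sup>2 * gauss (?s n) \<xi>) \<longlonglongrightarrow> (norm (fourier_L1 f \<xi>))\<^sup>2" by simp
  qed
  show "\<forall>\<^sub>F n in sequentially. (\<integral>\<^sup>+ \<xi>. ennreal ((norm (fourier_L1 f \<xi>))\<^sup>2 * gauss (?s n) \<xi>) \<partial>lborel) \<le> ennreal ((2 * pi) ^ DIM('a)) * L2sq f"
    by (intro always_eventually allI plancherel_weighted f) auto
  show "(\<lambda>\<xi>. ennreal ((norm (fourier_L1 f \<xi>))\<^sup>2 * gauss (?s n) \<xi>)) \<in> borel_measurable lborel" for n
    by measurable
qed

section \<open>The Fourier transform on \<open>L\<^sup>2\<close>\<close>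

text \<open>
  Sums are estimated with the factor \<open>2\<close> instead of Minkowski's inequality, since only convergence to zero
  and finiteness matter.
\<close>

lemma
  fixes f g :: "'a::euclidean_space \<Rightarrow> complex"
  assumes [measurable]: "f \<in> borel_measurable borel" "g \<in> borel_measurable borel"
  shows L2sq_add_le: "L2sq (\<lambda>x. f x + g x) \<le> 2 * L2sq f + 2 * L2sq g"
    and L2sq_diff_le: "L2sq (\<lambda>x. f x - g x) \<le> 2 * L2sq f + 2 * L2sq g"
proof -
  have *: "(norm (u + v))\<^sup>2 \<le> 2 * (norm u)\<^sup>2 + 2 * (norm v)\<^sup>2" for u v :: complex
  proof -
    have "(norm (u + v))\<^sup>2 \<le> (norm u + norm v)\<^sup>2"
      by (intro power_mono norm_triangle_ineq) auto
    then show ?thesis using sum_squares_bound[of "norm u" "norm v"]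
      by (simp add: power2_sum)
  qed
  have **: "(norm (u - v))\<^sup>2 \<le> 2 * (norm u)\<^sup>2 + 2 * (norm v)\<^sup>2" for u v :: complex
    using *[of u "- v"] by simp
  have e: "ennreal (2 * a) = 2 * ennreal a" if "a \<ge> 0" for a :: real
    using that by (simp add: ennreal_mult)
  have r: "2 * L2sq f + 2 * L2sq g = (\<integral>\<^sup>+ x. ennreal (2 * (norm (f x))\<^sup>2 + 2 * (norm (g x))\<^sup>2) \<partial>lborel)"
    by (simp add: e nn_integral_add nn_integral_cmult L2sq_def)
  show "L2sq (\<lambda>x. f x + g x) \<le> 2 * L2sq f + 2 * L2sq g" "L2sq (\<lambda>x. f x - g x) \<le> 2 * L2sq f + 2 * L2sq g"
    unfolding r unfolding L2sq_def by (intro nn_integral_mono ennreal_leI * **)+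
qed

lemma L2sq_minus_commute: "L2sq (\<lambda>x. f x - g x) = L2sq (\<lambda>x. g x - f x)"
  by (simp add: L2sq_def norm_minus_commute)

lemma L2sq_cong_AE: "AE x in lborel. norm (f x) = norm (g x) \<Longrightarrow> L2sq f = L2sq g"
  unfolding L2sq_def by (intro nn_integral_cong_AE) auto

lemma L2sq_mono_AE: "AE x in lborel. norm (f x) \<le> norm (g x) \<Longrightarrow> L2sq f \<le> L2sq g"
  unfolding L2sq_def by (intro nn_integral_mono_AE) (auto intro!: ennreal_leI power_mono)

lemma L2sq_triangle:
  fixes f g h :: "'a::euclidean_space \<Rightarrow> complex"
  assumes [measurable]: "f \<in> borel_measurable borel" "g \<in> borel_measurable borel" "h \<in> borel_measurable borel"
  shows "L2sq (\<lambda>x. f x - h x) \<le> 2 * L2sq (\<lambda>x. f x - g x) + 2 * L2sq (\<lambda>x. g x - h x)"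
  using L2sq_add_le[of "\<lambda>x. f x - g x" "\<lambda>x. g x - h x"] by simp

lemma square_integrable_iff:
  "square_integrable f \<longleftrightarrow> f \<in> borel_measurable borel \<and> L2sq f < \<infinity>"
proof -
  have "integrable lborel (\<lambda>x. (norm (f x))\<^sup>2) \<longleftrightarrow> L2sq f < \<infinity>" if [measurable]: "f \<in> borel_measurable borel"
    by (simp add: integrable_iff_bounded L2sq_def)
  then show ?thesis unfolding square_integrable_def by auto
qed

lemma square_integrable_measurable: "square_integrable f \<Longrightarrow> f \<in> borel_measurable borel"
  by (simp add: square_integrable_def)

lemma L2sq_eq_0D:
  assumes [measurable]: "f \<in> borel_measurable borel" and "L2sq f = 0"
  shows "AE x in lborel. f x = 0"
  using assms(2) unfolding L2sq_def by (subst (asm) nn_integral_0_iff_AE) auto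

lemma
  fixes f g :: "'a::euclidean_space \<Rightarrow> complex"
  assumes f: "square_integrable f" and g: "square_integrable g"
  shows square_integrable_add: "square_integrable (\<lambda>x. f x + g x)"
    and square_integrable_diff: "square_integrable (\<lambda>x. f x - g x)"
proof -
  have [measurable]: "f \<in> borel_measurable borel" "g \<in> borel_measurable borel"
    using f g by (auto intro: square_integrable_measurable)
  have fin: "2 * L2sq f + 2 * L2sq g < \<infinity>"
    using f g by (auto simp: square_integrable_iff ennreal_mult_less_top)
  show "square_integrable (\<lambda>x. f x + g x)" "square_integrable (\<lambda>x. f x - g x)"
    using le_less_trans[OF L2sq_add_le fin] le_less_trans[OF L2sq_diff_le fin]
    by (simp_all add: square_integrable_iff)
qed

text \<open>
  Completeness of \<open>L\<^sup>2\<close> for sequences that are Cauchy at the rate \<open>4\<^sup>-\<^sup>n\<close>. The rate makes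
  \<open>\<Sum> 2\<^sup>n \<bar>F\<^sub>n - F\<^sub>n\<^sub>+\<^sub>1\<bar>\<^sup>2\<close> finite almost everywhere, and this controls \<open>\<Sum> \<bar>F\<^sub>n - F\<^sub>n\<^sub>+\<^sub>1\<bar>\<close>
  because \<open>a \<le> 2\<^sup>n a\<^sup>2 + 2\<^sup>-\<^sup>n\<close>.
\<close>

lemma L2_fast_cauchy_converges:
  fixes F :: "nat \<Rightarrow> 'a::euclidean_space \<Rightarrow> complex"
  assumes [measurable]: "\<And>n. F n \<in> borel_measurable borel"
    and cauchy: "\<And>n k. n \<le> k \<Longrightarrow> L2sq (\<lambda>x. F n x - F k x) \<le> ennreal (c / 4 ^ n)" and c: "c \<ge> 0"
  obtains g where "g \<in> borel_measurable borel" "\<And>n. L2sq (\<lambda>x. F n x - g x) \<le> ennreal (c / 4 ^ n)"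
proof -
  let ?G = "\<lambda>n x. F n x - F (Suc n) x"
  have "(\<integral>\<^sup>+ x. (\<Sum>n. ennreal (2 ^ n * (norm (?G n x))\<^sup>2)) \<partial>lborel) =
     (\<Sum>n. \<integral>\<^sup>+ x. ennreal (2 ^ n) * ennreal ((norm (?G n x))\<^sup>2) \<partial>lborel)"
    by (subst nn_integral_suminf[symmetric]) (auto simp: ennreal_mult)
  also have "\<dots> = (\<Sum>n. ennreal (2 ^ n) * L2sq (?G n))"
    by (subst nn_integral_cmult) (auto simp: L2sq_def)
  also have "\<dots> \<le> (\<Sum>n. ennreal (c * (1 / 2) ^ n))"
  proof (intro suminf_le summableI allI)
    fix n
    have "ennreal (2 ^ n) * L2sq (?G n) \<le> ennreal (2 ^ n) * ennreal (c / 4 ^ n)"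
      by (intro mult_left_mono cauchy) auto
    also have "\<dots> = ennreal (c * (1 / 2) ^ n)"
      using c by (simp add: ennreal_mult[symmetric] field_simps power_mult_distrib[symmetric])
    finally show "ennreal (2 ^ n) * L2sq (?G n) \<le> ennreal (c * (1 / 2) ^ n)" .
  qed
  also have "\<dots> = ennreal (\<Sum>n. c * (1 / 2) ^ n)"
    using c by (intro suminf_ennreal2) (auto intro!: summable_mult summable_geometric)
  also have "\<dots> < \<infinity>" by simp
  finally have "AE x in lborel. (\<Sum>n. ennreal (2 ^ n * (norm (?G n x))\<^sup>2)) \<noteq> \<infinity>"
    by (intro nn_integral_PInf_AE) auto
  then have conv: "AE x in lborel. convergent (\<lambda>n. F n x)"
  proof eventually_elim
    fix x assume "(\<Sum>n. ennreal (2 ^ n * (norm (?G n x))\<^sup>2)) \<noteq> \<infinity>"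
    then have "summable (\<lambda>n. 2 ^ n * (norm (?G n x))\<^sup>2)"
      by (intro summable_suminf_not_top) auto
    then have "summable (\<lambda>n. 2 ^ n * (norm (?G n x))\<^sup>2 + (1 / 2) ^ n)"
      by (intro summable_add summable_geometric) auto
    then have "summable (\<lambda>n. ?G n x)"
    proof (rule summable_comparison_test'[where N=0])
      fix n
      have "0 \<le> (2 ^ n * norm (?G n x) - 1)\<^sup>2 + 2 ^ n * norm (?G n x)" by simp
      also have "\<dots> = 2 ^ n * (2 ^ n * (norm (?G n x))\<^sup>2 + (1 / 2) ^ n - norm (?G n x))"
        by (simp add: power2_eq_square algebra_simps power_one_over)
      finally show "norm (?G n x) \<le> 2 ^ n * (norm (?G n x))\<^sup>2 + (1 / 2) ^ n"
        using zero_less_power[of "2::real" n] unfolding zero_le_mult_iff by linarith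
    qed
    then have "convergent (\<lambda>n. \<Sum>k<n. ?G k x)"
      by (simp add: summable_iff_convergent)
    also have "(\<lambda>n. \<Sum>k<n. ?G k x) = (\<lambda>n. F 0 x - F n x)"
      by (intro ext, rule sum_lessThan_telescope')
    finally have "convergent (\<lambda>n. F 0 x - F n x)" .
    from convergent_diff[OF convergent_const[of "F 0 x"] this]
    have "convergent (\<lambda>n. F 0 x - (F 0 x - F n x))" .
    moreover have "(\<lambda>n. F 0 x - (F 0 x - F n x)) = (\<lambda>n. F n x)" by auto
    ultimately show "convergent (\<lambda>n. F n x)" by (simp only:)
  qed
  define g where "g x = lim (\<lambda>n. F n x)" for x
  have [measurable]: "g \<in> borel_measurable borel"
    unfolding g_def by measurable
  have "L2sq (\<lambda>x. F n x - g x) \<le> ennreal (c / 4 ^ n)" for n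
    unfolding L2sq_def
  proof (rule nn_integral_le_of_tendsto)
    show "AE x in lborel. (\<lambda>k. ennreal ((norm (F n x - F k x))\<^sup>2)) \<longlonglongrightarrow> ennreal ((norm (F n x - g x))\<^sup>2)"
      using conv by eventually_elim (auto simp: g_def convergent_LIMSEQ_iff intro!: tendsto_intros tendsto_ennrealI)
    show "\<forall>\<^sub>F k in sequentially. (\<integral>\<^sup>+ x. ennreal ((norm (F n x - F k x))\<^sup>2) \<partial>lborel) \<le> ennreal (c / 4 ^ n)"
      using cauchy unfolding L2sq_def eventually_sequentially by blast
    show "(\<lambda>x. ennreal ((norm (F n x - F k x))\<^sup>2)) \<in> borel_measurable lborel" for k
      by measurable
  qed
  from that[OF _ this] show thesis by simp
qed

lemma ball_truncation:
  fixes f :: "'a::euclidean_space \<Rightarrow> complex"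
  assumes f: "square_integrable f"
  defines "T \<equiv> \<lambda>n x. indicator (cball 0 (real n)) x * f x"
  shows "integrable lborel (T n)" "square_integrable (T n)" "(\<lambda>n. L2sq (\<lambda>x. T n x - f x)) \<longlonglongrightarrow> 0"
proof -
  have [measurable]: "f \<in> borel_measurable borel" and fin: "integrable lborel (\<lambda>x. (norm (f x))\<^sup>2)"
    using f by (auto simp: square_integrable_def)
  have [measurable]: "T n \<in> borel_measurable borel" for n
    unfolding T_def by (intro borel_measurable_times borel_measurable_indicator) auto
  have ib: "integrable lborel (indicator (cball 0 (real n)) :: 'a \<Rightarrow> real)"
    using emeasure_lborel_cball_finite[of "0::'a" "real n"] by (auto intro!: integrable_real_indicator)
  have le: "a \<le> 1 + a\<^sup>2" for a :: real
    using sum_squares_bound[of a 1] by (cases "a \<ge> 0") (auto, smt (verit) zero_le_power2)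
  show "integrable lborel (T n)"
    using Bochner_Integration.integrable_add[OF ib fin]
    by (rule Bochner_Integration.integrable_bound)
       (auto simp: T_def indicator_def norm_mult le)
  have "L2sq (T n) \<le> L2sq f"
    by (intro L2sq_mono_AE) (auto simp: T_def indicator_def)
  then show "square_integrable (T n)"
    using f by (auto simp: square_integrable_iff)
  have "(\<lambda>n. \<integral>\<^sup>+ x. ennreal ((norm (T n x - f x))\<^sup>2) \<partial>lborel) \<longlonglongrightarrow> (\<integral>\<^sup>+ (x::'a). 0 \<partial>lborel)"
  proof (rule nn_integral_dominated_convergence[where w="\<lambda>x. ennreal ((norm (f x))\<^sup>2)"])
    show "AE x in lborel. ennreal ((norm (T n x - f x))\<^sup>2) \<le> ennreal ((norm (f x))\<^sup>2)" for n
      by (auto simp: T_def indicator_def)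
    show "(\<integral>\<^sup>+ x. ennreal ((norm (f x))\<^sup>2) \<partial>lborel) < \<infinity>"
      using f by (simp add: square_integrable_iff L2sq_def)
    show "AE x in lborel. (\<lambda>n. ennreal ((norm (T n x - f x))\<^sup>2)) \<longlonglongrightarrow> 0"
    proof (rule AE_I2)
      fix x :: 'a
      have "\<forall>\<^sub>F n in sequentially. ennreal ((norm (T n x - f x))\<^sup>2) = 0"
        using eventually_ge_at_top[of "nat \<lceil>norm x\<rceil>"]
        by eventually_elim (auto simp: T_def indicator_def nat_le_iff ceiling_le_iff)
      then show "(\<lambda>n. ennreal ((norm (T n x - f x))\<^sup>2)) \<longlonglongrightarrow> 0"
        by (rule tendsto_eventually)
    qed
  qed auto
  then show "(\<lambda>n. L2sq (\<lambda>x. T n x - f x)) \<longlonglongrightarrow> 0" by (simp add: L2sq_def)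
qed

lemma has_fourier_L2_iff:
  "has_fourier_L2 f g \<longleftrightarrow> square_integrable f \<and> square_integrable g \<and>
     (\<exists>F. (\<forall>n. integrable lborel (F n) \<and> square_integrable (F n)) \<and>
        (\<lambda>n. L2sq (\<lambda>x. F n x - f x)) \<longlonglongrightarrow> 0 \<and> (\<lambda>n. L2sq (\<lambda>\<xi>. fourier_L1 (F n) \<xi> - g \<xi>)) \<longlonglongrightarrow> 0)"
  unfolding has_fourier_L2_def L2sq_def ..

lemma ennreal_tendsto_0_le:
  fixes f g :: "nat \<Rightarrow> ennreal"
  assumes "g \<longlonglongrightarrow> 0" "\<And>n. f n \<le> g n"
  shows "f \<longlonglongrightarrow> 0"
  using tendsto_sandwich[of "\<lambda>_. 0" f sequentially g 0] assms by auto

text \<open>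
  Truncations of \<open>f\<close> to balls, thinned out to converge fast, have transforms that converge fast
  by the Plancherel inequality.
\<close>

lemma has_fourier_L2_exists:
  fixes f :: "'a::euclidean_space \<Rightarrow> complex"
  assumes f: "square_integrable f"
  shows "\<exists>g. has_fourier_L2 f g"
proof -
  define T where "T = (\<lambda>n x. indicator (cball 0 (real n)) x * f x)"
  have T: "integrable lborel (T n)" "square_integrable (T n)" "(\<lambda>n. L2sq (\<lambda>x. T n x - f x)) \<longlonglongrightarrow> 0" for n
    unfolding T_def using ball_truncation[OF f] by blast+
  have [measurable]: "f \<in> borel_measurable borel" using f by (rule square_integrable_measurable)
  have "\<exists>m. L2sq (\<lambda>x. T m x - f x) < ennreal ((1 / 4) ^ n)" for n
    using order_tendstoD(2)[OF T(3), of "ennreal ((1 / 4) ^ n)"] by (auto simp: eventually_sequentially)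
  then obtain r where r: "\<And>n. L2sq (\<lambda>x. T (r n) x - f x) < ennreal ((1 / 4) ^ n)" by metis
  define F where "F n = T (r n)" for n
  have Fi: "integrable lborel (F n)" and Fs: "square_integrable (F n)" for n unfolding F_def using T by auto
  have [measurable]: "F n \<in> borel_measurable borel" for n using Fi[of n] by auto
  have Fr: "L2sq (\<lambda>x. F n x - f x) \<le> ennreal ((1 / 4) ^ n)" for n unfolding F_def using r[of n] by simp
  let ?d = "(2 * pi) ^ DIM('a)"
  have "L2sq (\<lambda>\<xi>. fourier_L1 (F n) \<xi> - fourier_L1 (F k) \<xi>) \<le> ennreal (?d * 4 / 4 ^ n)" if "n \<le> k" for n k
  proof -
    have "L2sq (\<lambda>\<xi>. fourier_L1 (F n) \<xi> - fourier_L1 (F k) \<xi>) = L2sq (fourier_L1 (\<lambda>x. F n x - F k x))"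
      by (simp only: fourier_L1_diff[OF Fi Fi, symmetric])
    also have "\<dots> \<le> ennreal ?d * L2sq (\<lambda>x. F n x - F k x)"
      by (intro plancherel_inequality Bochner_Integration.integrable_diff Fi)
    also have "\<dots> \<le> ennreal ?d * (2 * L2sq (\<lambda>x. F n x - f x) + 2 * L2sq (\<lambda>x. F k x - f x))"
      by (subst L2sq_minus_commute[of "F k"]) (intro mult_left_mono L2sq_triangle, auto)
    also have "\<dots> \<le> ennreal ?d * (2 * ennreal ((1 / 4) ^ n) + 2 * ennreal ((1 / 4) ^ k))"
      by (intro mult_left_mono add_mono Fr) auto
    also have "\<dots> \<le> ennreal ?d * (2 * ennreal ((1 / 4) ^ n) + 2 * ennreal ((1 / 4) ^ n))"
      using that by (intro mult_left_mono add_mono ennreal_leI power_decreasing) auto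
    also have "\<dots> = ennreal ?d * ennreal (4 * (1 / 4) ^ n)"
      by (simp add: ennreal_mult flip: distrib_right)
    also have "\<dots> = ennreal (?d * 4 / 4 ^ n)"
      by (simp add: ennreal_mult'[symmetric] power_one_over field_simps)
    finally show ?thesis .
  qed
  note bound = this
  obtain g where [measurable]: "g \<in> borel_measurable borel"
      and g: "\<And>n. L2sq (\<lambda>\<xi>. fourier_L1 (F n) \<xi> - g \<xi>) \<le> ennreal (?d * 4 / 4 ^ n)"
    by (rule L2_fast_cauchy_converges[of "\<lambda>n. fourier_L1 (F n)" "?d * 4", OF _ bound]) auto
  have "L2sq (\<lambda>\<xi>. fourier_L1 (F 0) \<xi> - (fourier_L1 (F 0) \<xi> - g \<xi>)) \<le>
      2 * L2sq (fourier_L1 (F 0)) + 2 * L2sq (\<lambda>\<xi>. fourier_L1 (F 0) \<xi> - g \<xi>)"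
    by (intro L2sq_diff_le) auto
  then have "L2sq g \<le> 2 * L2sq (fourier_L1 (F 0)) + 2 * L2sq (\<lambda>\<xi>. fourier_L1 (F 0) \<xi> - g \<xi>)" by simp
  also have "\<dots> \<le> 2 * (ennreal ?d * L2sq (F 0)) + 2 * ennreal (?d * 4 / 4 ^ 0)"
    by (intro add_mono mult_left_mono plancherel_inequality Fi g) auto
  also have "\<dots> < \<infinity>"
    using Fs[of 0] by (auto simp: square_integrable_iff ennreal_mult_less_top)
  finally have "square_integrable g" by (simp add: square_integrable_iff)
  moreover have "(\<lambda>n. L2sq (\<lambda>x. F n x - f x)) \<longlonglongrightarrow> 0"
    by (rule ennreal_tendsto_0_le[OF _ Fr]) (auto simp flip: ennreal_0 intro!: tendsto_ennrealI LIMSEQ_power_zero)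
  moreover have "(\<lambda>n. L2sq (\<lambda>\<xi>. fourier_L1 (F n) \<xi> - g \<xi>)) \<longlonglongrightarrow> 0"
  proof (rule ennreal_tendsto_0_le[OF _ g])
    have "(\<lambda>n. ?d * 4 * (1 / 4) ^ n) \<longlonglongrightarrow> ?d * 4 * 0"
      by (intro tendsto_intros LIMSEQ_power_zero) auto
    then show "(\<lambda>n. ennreal (?d * 4 / 4 ^ n)) \<longlonglongrightarrow> 0"
      by (auto simp: power_one_over simp flip: ennreal_0 intro!: tendsto_ennrealI)
  qed
  ultimately show ?thesis
    using f Fi Fs unfolding has_fourier_L2_iff by blast
qed

lemma has_fourier_L2_diff:
  fixes f :: "'a::euclidean_space \<Rightarrow> complex"
  assumes "has_fourier_L2 f g" "has_fourier_L2 f' g'"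
  shows "has_fourier_L2 (\<lambda>x. f x - f' x) (\<lambda>x. g x - g' x)"
proof -
  obtain F where F: "\<And>n. integrable lborel (F n)" "\<And>n. square_integrable (F n)"
       "(\<lambda>n. L2sq (\<lambda>x. F n x - f x)) \<longlonglongrightarrow> 0" "(\<lambda>n. L2sq (\<lambda>\<xi>. fourier_L1 (F n) \<xi> - g \<xi>)) \<longlonglongrightarrow> 0"
     using assms(1) unfolding has_fourier_L2_iff by blast
  obtain F' where F': "\<And>n. integrable lborel (F' n)" "\<And>n. square_integrable (F' n)"
       "(\<lambda>n. L2sq (\<lambda>x. F' n x - f' x)) \<longlonglongrightarrow> 0" "(\<lambda>n. L2sq (\<lambda>\<xi>. fourier_L1 (F' n) \<xi> - g' \<xi>)) \<longlonglongrightarrow> 0"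
     using assms(2) unfolding has_fourier_L2_iff by blast
  have sq: "square_integrable f" "square_integrable g" "square_integrable f'" "square_integrable g'"
    using assms unfolding has_fourier_L2_iff by auto
  have [measurable]: "f \<in> borel_measurable borel" "g \<in> borel_measurable borel" "f' \<in> borel_measurable borel"
     "g' \<in> borel_measurable borel" "\<And>n. F n \<in> borel_measurable borel" "\<And>n. F' n \<in> borel_measurable borel"
    using sq F(2) F'(2) by (auto intro: square_integrable_measurable)
  have lim: "(\<lambda>n. L2sq (\<lambda>x. (U n x - U' n x) - (u x - u' x))) \<longlonglongrightarrow> 0"
    if "(\<lambda>n. L2sq (\<lambda>x. U n x - u x)) \<longlonglongrightarrow> 0" "(\<lambda>n. L2sq (\<lambda>x. U' n x - u' x)) \<longlonglongrightarrow> 0"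
    and [measurable]: "\<And>n. U n \<in> borel_measurable borel" "\<And>n. U' n \<in> borel_measurable borel"
      "u \<in> borel_measurable borel" "u' \<in> borel_measurable borel"
    for U U' and u u' :: "'a \<Rightarrow> complex"
  proof (rule ennreal_tendsto_0_le)
    have "(\<lambda>n. 2 * L2sq (\<lambda>x. U n x - u x) + 2 * L2sq (\<lambda>x. U' n x - u' x)) \<longlonglongrightarrow> 2 * 0 + 2 * 0"
      using that by (intro tendsto_add ennreal_tendsto_cmult) auto
    then show "(\<lambda>n. 2 * L2sq (\<lambda>x. U n x - u x) + 2 * L2sq (\<lambda>x. U' n x - u' x)) \<longlonglongrightarrow> 0" by simp
    fix n
    have "(\<lambda>x. (U n x - U' n x) - (u x - u' x)) = (\<lambda>x. (U n x - u x) - (U' n x - u' x))" by auto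
    then show "L2sq (\<lambda>x. (U n x - U' n x) - (u x - u' x)) \<le> 2 * L2sq (\<lambda>x. U n x - u x) + 2 * L2sq (\<lambda>x. U' n x - u' x)"
      using L2sq_diff_le[of "\<lambda>x. U n x - u x" "\<lambda>x. U' n x - u' x"] by simp
  qed
  show ?thesis
    unfolding has_fourier_L2_iff
  proof (intro conjI exI[of _ "\<lambda>n x. F n x - F' n x"] allI)
    show "(\<lambda>n. L2sq (\<lambda>\<xi>. fourier_L1 (\<lambda>x. F n x - F' n x) \<xi> - (g \<xi> - g' \<xi>))) \<longlonglongrightarrow> 0"
      unfolding fourier_L1_diff[OF F(1) F'(1)] by (intro lim F F') auto
  qed (use F F' sq in \<open>auto intro!: lim square_integrable_diff\<close>)
qed

text \<open>The factor \<open>4\<close> comes from the crude triangle inequality; only some constant matters.\<close>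

lemma has_fourier_L2_bound:
  fixes f :: "'a::euclidean_space \<Rightarrow> complex"
  assumes "has_fourier_L2 f g"
  shows "L2sq g \<le> ennreal (4 * (2 * pi) ^ DIM('a)) * L2sq f"
proof -
  let ?d = "(2 * pi) ^ DIM('a)"
  obtain F where F: "\<And>n. integrable lborel (F n)" "\<And>n. square_integrable (F n)"
       "(\<lambda>n. L2sq (\<lambda>x. F n x - f x)) \<longlonglongrightarrow> 0" "(\<lambda>n. L2sq (\<lambda>\<xi>. fourier_L1 (F n) \<xi> - g \<xi>)) \<longlonglongrightarrow> 0"
     using assms unfolding has_fourier_L2_iff by blast
  have sq: "square_integrable f" "square_integrable g"
    using assms unfolding has_fourier_L2_iff by auto
  have [measurable]: "f \<in> borel_measurable borel" "g \<in> borel_measurable borel" "\<And>n. F n \<in> borel_measurable borel"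
    using sq F(2) by (auto intro: square_integrable_measurable)
  have le: "L2sq g \<le> 2 * L2sq (\<lambda>\<xi>. fourier_L1 (F n) \<xi> - g \<xi>) + 2 * (ennreal ?d * (2 * L2sq (\<lambda>x. F n x - f x) + 2 * L2sq f))" for n
  proof -
    have "L2sq (\<lambda>\<xi>. fourier_L1 (F n) \<xi> - (fourier_L1 (F n) \<xi> - g \<xi>)) \<le>
        2 * L2sq (fourier_L1 (F n)) + 2 * L2sq (\<lambda>\<xi>. fourier_L1 (F n) \<xi> - g \<xi>)"
      by (intro L2sq_diff_le) auto
    then have "L2sq g \<le> 2 * L2sq (\<lambda>\<xi>. fourier_L1 (F n) \<xi> - g \<xi>) + 2 * L2sq (fourier_L1 (F n))"
      by (simp add: add.commute)
    also have "L2sq (fourier_L1 (F n)) \<le> ennreal ?d * L2sq (F n)"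
      by (rule plancherel_inequality[OF F(1)])
    also have "L2sq (F n) \<le> 2 * L2sq (\<lambda>x. F n x - f x) + 2 * L2sq f"
      using L2sq_add_le[of "\<lambda>x. F n x - f x" f] by simp
    finally show ?thesis by (simp add: mult_left_mono)
  qed
  have "(\<lambda>n. 2 * L2sq (\<lambda>\<xi>. fourier_L1 (F n) \<xi> - g \<xi>) + 2 * (ennreal ?d * (2 * L2sq (\<lambda>x. F n x - f x) + 2 * L2sq f)))
     \<longlonglongrightarrow> 2 * 0 + 2 * (ennreal ?d * (2 * 0 + 2 * L2sq f))"
    by (intro tendsto_add ennreal_tendsto_cmult F tendsto_const) auto
  then have "L2sq g \<le> 2 * 0 + 2 * (ennreal ?d * (2 * 0 + 2 * L2sq f))"
    by (rule Lim_bounded2) (use le in auto)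
  also have "\<dots> = (2 * ennreal ?d * 2) * L2sq f" by (simp add: mult_ac)
  also have "2 * ennreal ?d * 2 = (2 * 2) * ennreal ?d" by (simp only: mult_ac)
  also have "\<dots> = ennreal (4 * ?d)" by (subst ennreal_mult) auto
  finally show ?thesis .
qed

text \<open>Apply the bound to the difference: the transform of a null function is null.\<close>

lemma has_fourier_L2_unique:
  fixes f :: "'a::euclidean_space \<Rightarrow> complex"
  assumes "has_fourier_L2 f g" "has_fourier_L2 f' g'" and eq: "AE x in lborel. f x = f' x"
  shows "AE x in lborel. g x = g' x"
proof -
  have "L2sq (\<lambda>x. g x - g' x) \<le> ennreal (4 * (2 * pi) ^ DIM('a)) * L2sq (\<lambda>x. f x - f' x)"
    by (intro has_fourier_L2_bound has_fourier_L2_diff assms)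
  also have "L2sq (\<lambda>x. f x - f' x) = L2sq (\<lambda>x::'a. 0::complex)"
    using eq by (intro L2sq_cong_AE) auto
  also have "\<dots> = 0" by (simp add: L2sq_def)
  finally have "AE x in lborel. g x - g' x = 0"
    using assms by (intro L2sq_eq_0D) (auto simp: has_fourier_L2_iff square_integrable_def)
  then show ?thesis by auto
qed

section \<open>Uniqueness of the Fourier transform on \<open>L\<^sup>1\<close>\<close>

lemma fourier_L1_modulate:
  "fourier_L1 (\<lambda>\<xi>. cis (y \<bullet> \<xi>) * \<phi> \<xi>) x = fourier_L1 \<phi> (x - y)"
proof -
  have "cis (- (\<xi> \<bullet> x)) * (cis (y \<bullet> \<xi>) * \<phi> \<xi>) = cis (- (\<xi> \<bullet> (x - y))) * \<phi> \<xi>" for \<xi>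
    by (simp add: mult.assoc[symmetric] cis_mult inner_diff_right inner_commute)
  then show ?thesis unfolding fourier_L1_def by (simp only:)
qed

lemma integral_lborel_affine:
  fixes F :: "'a::euclidean_space \<Rightarrow> complex"
  assumes [measurable]: "F \<in> borel_measurable borel" and c: "c \<noteq> 0"
  shows "(LINT y|lborel. F y) = of_real (\<bar>c\<bar> ^ DIM('a)) * (LINT w|lborel. F (t + c *\<^sub>R w))"
  by (subst lborel_affine[OF c, of t], subst integral_density)
     (auto simp: integral_distr scaleR_conv_of_real)

lemma fourier_L1_translate:
  fixes \<phi> :: "'a::euclidean_space \<Rightarrow> complex"
  assumes [measurable]: "\<phi> \<in> borel_measurable borel"
  shows "fourier_L1 (\<lambda>x. \<phi> (x - y)) \<xi> = cis (- (y \<bullet> \<xi>)) * fourier_L1 \<phi> \<xi>"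
proof -
  have "fourier_L1 (\<lambda>x. \<phi> (x - y)) \<xi> = (LINT w|lborel. cis (- ((y + w) \<bullet> \<xi>)) * \<phi> w)"
    unfolding fourier_L1_def by (subst integral_lborel_affine[where c=1 and t=y]) auto
  also have "\<dots> = (LINT w|lborel. cis (- (y \<bullet> \<xi>)) * (cis (- (w \<bullet> \<xi>)) * \<phi> w))"
    by (simp add: inner_add_left cis_mult mult.assoc[symmetric])
  finally show ?thesis by (simp add: fourier_L1_def)
qed

lemma integrable_modulate: "integrable lborel f \<Longrightarrow> integrable lborel (\<lambda>x. cis (y \<bullet> x) * f x)"
  for f :: "'a::euclidean_space \<Rightarrow> complex"
  by (rule Bochner_Integration.integrable_bound[of _ f]) auto

lemma gauss_complex_integrable: "s > 0 \<Longrightarrow> integrable lborel (\<lambda>x::'a::euclidean_space. complex_of_real (gauss s x))"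
  using gauss_integrable by auto

text \<open>
  A translated Gaussian is itself the transform of a modulated Gaussian, so the multiplication
  formula moves the transform onto \<open>f\<close>, where it vanishes.
\<close>

lemma orthogonal_translated_gauss:
  fixes f :: "'a::euclidean_space \<Rightarrow> complex"
  assumes f: "integrable lborel f" and f0: "\<And>\<xi>. fourier_L1 f \<xi> = 0" and s: "s > 0"
  shows "(LINT x|lborel. of_real (gauss s (x - y)) * f x) = 0"
proof -
  let ?g = "\<lambda>\<xi>. cis (y \<bullet> \<xi>) * complex_of_real (gauss (1 / s) \<xi>)"
  have "integrable lborel ?g"
    using s by (intro integrable_modulate gauss_complex_integrable) auto
  from fourier_L1_multiplication[OF f this]
  have "(LINT x|lborel. f x * fourier_L1 ?g x) = 0" by (simp add: f0)
  moreover define K where "K = complex_of_real ((sqrt (2 * pi) * s) ^ DIM('a))"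
  have "fourier_L1 ?g x = K * of_real (gauss s (x - y))" for x
    using s fourier_gauss(2)[of "1 / s" "x - y"] by (simp add: fourier_L1_modulate K_def)
  ultimately have "(LINT x|lborel. f x * (K * of_real (gauss s (x - y)))) = 0"
    by (simp only:)
  also have "(\<lambda>x. f x * (K * of_real (gauss s (x - y)))) = (\<lambda>x. K * (of_real (gauss s (x - y)) * f x))"
    by (simp add: mult_ac)
  finally have "K * (LINT x|lborel. of_real (gauss s (x - y)) * f x) = 0"
    by (simp only: integral_mult_right_zero)
  moreover have "K \<noteq> 0" using s by (simp add: K_def)
  ultimately show ?thesis by simp
qed

text \<open>
  Convolve \<open>\<psi>\<close> with Gaussians of width \<open>1 / (n + 1)\<close>: the pairing of \<open>f\<close> with the result is a superposition
  of pairings with translated Gaussians, hence zero, and the mollified functions converge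
  boundedly to a multiple of \<open>\<psi>\<close>.
\<close>

lemma orthogonal_continuous:
  fixes f :: "'a::euclidean_space \<Rightarrow> complex" and \<psi> :: "'a \<Rightarrow> complex"
  assumes f: "integrable lborel f" and f0: "\<And>\<xi>. fourier_L1 f \<xi> = 0"
    and cont: "continuous_on UNIV \<psi>" and \<psi>: "integrable lborel \<psi>" and B: "\<And>x. norm (\<psi> x) \<le> B"
  shows "(LINT x|lborel. f x * \<psi> x) = 0"
proof -
  have [measurable]: "f \<in> borel_measurable borel" "\<psi> \<in> borel_measurable borel" using f \<psi> by auto
  have B0: "B \<ge> 0" using B[of 0] norm_ge_zero order_trans by blast
  define c where "c = sqrt (2 * pi) ^ DIM('a)"
  have c: "c > 0" by (simp add: c_def)
  have gi: "integrable lborel (\<lambda>w::'a. gauss 1 w)" by (rule gauss_integrable) simp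
  define I where "I n x = (LINT w|lborel. complex_of_real (gauss 1 w) * \<psi> (x + (- (1 / real (Suc n))) *\<^sub>R w))" for n x
  have zero: "(LINT x|lborel. f x * I n x) = 0" for n
  proof -
    let ?s = "real (Suc n)"
    have "(LINT x|lborel. f x * (LINT y|lborel. complex_of_real (gauss ?s (x - y)) * \<psi> y))
       = (LINT y|lborel. \<psi> y * (LINT x|lborel. complex_of_real (gauss ?s (x - y)) * f x))"
      by (rule lborel_pair.integral_kernel_swap[OF f \<psi>, of _ 1]) (auto simp: gauss_le_1)
    also have "\<dots> = 0"
      by (simp add: orthogonal_translated_gauss[OF f f0])
    also have "(\<lambda>x. LINT y|lborel. complex_of_real (gauss ?s (x - y)) * \<psi> y) =
        (\<lambda>x. of_real ((1 / ?s) ^ DIM('a)) * I n x)"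
    proof
      fix x :: 'a
      have "gauss ?s (x - (x + (- (1 / ?s)) *\<^sub>R w)) = gauss 1 w" for w
        by (simp add: gauss_def power_mult_distrib power_divide del: of_nat_Suc)
      then show "(LINT y|lborel. complex_of_real (gauss ?s (x - y)) * \<psi> y) = of_real ((1 / ?s) ^ DIM('a)) * I n x"
        by (subst integral_lborel_affine[where c="- (1 / ?s)" and t=x]) (simp_all add: I_def power_abs del: of_nat_Suc)
    qed
    finally have "(LINT x|lborel. f x * (complex_of_real ((1 / ?s) ^ DIM('a)) * I n x)) = 0" .
    also have "(\<lambda>x. f x * (complex_of_real ((1 / ?s) ^ DIM('a)) * I n x)) = (\<lambda>x. complex_of_real ((1 / ?s) ^ DIM('a)) * (f x * I n x))"
      by (simp only: mult_ac)
    finally have "complex_of_real ((1 / ?s) ^ DIM('a)) * (LINT x|lborel. f x * I n x) = 0"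
      by (simp only: integral_mult_right_zero)
    then show ?thesis by (simp del: of_nat_Suc)
  qed
  have gB: "gauss 1 w * norm (\<psi> z) \<le> B * gauss 1 w" for w z :: 'a
    using mult_right_mono[OF B[of z], of "gauss 1 w"] by (simp add: mult.commute)
  have int: "integrable lborel (\<lambda>w. complex_of_real (gauss 1 w) * \<psi> (x + a *\<^sub>R w))" for x and a :: real
    by (rule Bochner_Integration.integrable_bound[of _ "\<lambda>w. B * gauss 1 w"])
       (use gi gB B0 in \<open>auto simp: norm_mult\<close>)
  have lim: "(\<lambda>n. I n x) \<longlonglongrightarrow> of_real c * \<psi> x" for x
  proof -
    have "(\<lambda>n. I n x) \<longlonglongrightarrow> (LINT w|lborel. complex_of_real (gauss 1 (w::'a)) * \<psi> x)"
      unfolding I_def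
    proof (rule integral_dominated_convergence[where w="\<lambda>w::'a. B * gauss 1 w"])
      show "AE w in lborel. (\<lambda>n. complex_of_real (gauss 1 w) * \<psi> (x + (- (1 / real (Suc n))) *\<^sub>R w)) \<longlonglongrightarrow> complex_of_real (gauss 1 w) * \<psi> x"
      proof (intro AE_I2 tendsto_intros)
        fix w
        have "(\<lambda>n. x + (- (1 / real (Suc n))) *\<^sub>R w) \<longlonglongrightarrow> x + (- 0) *\<^sub>R w"
          by (intro tendsto_intros lim_1_over_n[THEN LIMSEQ_Suc])
        moreover have "isCont \<psi> x" using cont by (simp add: continuous_on_eq_continuous_at)
        ultimately show "(\<lambda>n. \<psi> (x + (- (1 / real (Suc n))) *\<^sub>R w)) \<longlonglongrightarrow> \<psi> x"
          by (intro isCont_tendsto_compose[of x \<psi>]) simp_all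
      qed
    qed (use gi gB B0 in \<open>auto simp: norm_mult\<close>)
    also have "(LINT w|lborel. complex_of_real (gauss 1 (w::'a)) * \<psi> x) = of_real c * \<psi> x"
      by (simp add: integral_gauss c_def)
    finally show ?thesis .
  qed
  have [measurable]: "I n \<in> borel_measurable borel" for n
    unfolding I_def by measurable
  have "(\<lambda>n. LINT x|lborel. f x * I n x) \<longlonglongrightarrow> (LINT x|lborel. f x * (of_real c * \<psi> x))"
  proof (rule integral_dominated_convergence[where w="\<lambda>x. norm (f x) * (B * c)"])
    show "AE x in lborel. norm (f x * I n x) \<le> norm (f x) * (B * c)" for n
    proof (rule AE_I2)
      fix x
      have "norm (I n x) \<le> (LINT w|lborel. norm (complex_of_real (gauss 1 w) * \<psi> (x + (- (1 / real (Suc n))) *\<^sub>R w)))"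
        unfolding I_def by (rule integral_norm_bound)
      also have "\<dots> \<le> (LINT w|lborel. B * gauss 1 (w::'a))"
        by (intro integral_mono integrable_norm int)
           (use gi gB in \<open>auto simp: norm_mult\<close>)
      also have "\<dots> = B * c" by (simp add: integral_gauss c_def)
      finally show "norm (f x * I n x) \<le> norm (f x) * (B * c)"
        by (auto simp: norm_mult intro!: mult_left_mono)
    qed
  qed (use lim f in \<open>auto intro!: tendsto_intros\<close>)
  then have "(LINT x|lborel. f x * (of_real c * \<psi> x)) = 0"
    by (simp add: zero LIMSEQ_const_iff)
  then have "of_real c * (LINT x|lborel. f x * \<psi> x) = 0"
    by (simp add: mult.left_commute)
  then show ?thesis using c by simp
qed

text \<open>
  The indicator of a box is the increasing limit of truncated multiples of the distance to its
  complement.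
\<close>

lemma orthogonal_box:
  fixes f :: "'a::euclidean_space \<Rightarrow> complex"
  assumes f: "integrable lborel f" and f0: "\<And>\<xi>. fourier_L1 f \<xi> = 0"
  shows "(LINT x|lborel. f x * indicator (box a b) x) = 0"
proof -
  have [measurable]: "f \<in> borel_measurable borel" using f by auto
  define \<psi> where "\<psi> k x = min 1 (real k * infdist x (- box a b))" for k x
  have ne: "- box a b \<noteq> {}"
    using bounded_box[of a b] not_bounded_UNIV[where 'a='a] by (metis Compl_eq_Diff_UNIV Diff_eq_empty_iff bounded_subset)
  have cl: "closed (- box a b)" by (simp add: open_box closed_Compl)
  have inf0: "infdist x (- box a b) = 0 \<longleftrightarrow> x \<notin> box a b" for x
    using in_closed_iff_infdist_zero[OF cl ne] by auto
  have bd: "0 \<le> \<psi> k x" "\<psi> k x \<le> indicator (box a b) x" for k x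
    by (auto simp: \<psi>_def indicator_def inf0 infdist_nonneg)
  have cont: "continuous_on UNIV (\<lambda>x. complex_of_real (\<psi> k x))" for k
    unfolding \<psi>_def by (intro continuous_intros)
  then have [measurable]: "(\<lambda>x. complex_of_real (\<psi> k x)) \<in> borel_measurable borel" for k
    by (rule borel_measurable_continuous_onI)
  have ib: "integrable lborel (indicator (box a b) :: 'a \<Rightarrow> real)"
    by (auto intro!: integrable_real_indicator emeasure_lborel_box_finite)
  have le1: "norm (complex_of_real (\<psi> k x)) \<le> indicator (box a b) x" for k x
    using bd[of k x] by simp
  have "(LINT x|lborel. f x * complex_of_real (\<psi> k x)) = 0" for k
  proof (rule orthogonal_continuous[OF f f0 cont])
    show "integrable lborel (\<lambda>x. complex_of_real (\<psi> k x))"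
      by (rule Bochner_Integration.integrable_bound[OF ib]) (use le1 in auto)
    show "norm (complex_of_real (\<psi> k x)) \<le> 1" for x
      using le1[of k x] by (rule order_trans) (auto simp: indicator_def)
  qed
  moreover have "(\<lambda>k. LINT x|lborel. f x * complex_of_real (\<psi> k x)) \<longlonglongrightarrow> (LINT x|lborel. f x * indicator (box a b) x)"
  proof (rule integral_dominated_convergence[where w="\<lambda>x. norm (f x)"])
    show "AE x in lborel. norm (f x * complex_of_real (\<psi> k x)) \<le> norm (f x)" for k
    proof (rule AE_I2)
      fix x
      have "norm (complex_of_real (\<psi> k x)) \<le> 1"
        using le1[of k x] by (rule order_trans) (auto simp: indicator_def)
      then show "norm (f x * complex_of_real (\<psi> k x)) \<le> norm (f x)"
        unfolding norm_mult by (intro mult_left_le) auto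
    qed
    show "AE x in lborel. (\<lambda>k. f x * complex_of_real (\<psi> k x)) \<longlonglongrightarrow> f x * indicator (box a b) x"
    proof (intro AE_I2 tendsto_intros)
      fix x
      show "(\<lambda>k. complex_of_real (\<psi> k x)) \<longlonglongrightarrow> indicator (box a b) x"
      proof (cases "x \<in> box a b")
        case True
        then have pos: "infdist x (- box a b) > 0"
          using inf0[of x] infdist_nonneg[of x "- box a b"] by linarith
        then have "\<forall>\<^sub>F k in sequentially. complex_of_real (\<psi> k x) = 1"
          by (intro eventually_sequentiallyI[of "nat \<lceil>1 / infdist x (- box a b)\<rceil>"])
             (simp add: \<psi>_def nat_le_iff ceiling_le_iff field_simps min_def)
        then show ?thesis using True by (auto intro: tendsto_eventually)
      qed (simp add: \<psi>_def inf0)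
    qed
  qed (use f in auto)
  ultimately show ?thesis by (simp add: LIMSEQ_const_iff)
qed

text \<open>
  The positive and the negative part of \<open>g\<close> are densities of finite measures that agree on the
  \<open>\<pi>\<close>-system of boxes.
\<close>

lemma AE_zero_if_box_integrals_zero:
  fixes g :: "'a::euclidean_space \<Rightarrow> real"
  assumes g: "integrable lborel g" and z: "\<And>a b. (LINT x|lborel. g x * indicator (box a b) x) = 0"
  shows "AE x in lborel. g x = 0"
proof -
  have [measurable]: "g \<in> borel_measurable borel" using g by auto
  let ?E = "range (\<lambda>(a, b). box a b :: 'a set)"
  let ?M = "\<lambda>h. density lborel (\<lambda>x. ennreal (h x))"
  have fin: "(\<integral>\<^sup>+ x. ennreal (h x) * indicator A x \<partial>lborel) < \<infinity>" if "h = g \<or> h = (\<lambda>x. - g x)" for h and A :: "'a set"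
  proof -
    have "(\<integral>\<^sup>+ x. ennreal (h x) * indicator A x \<partial>lborel) \<le> (\<integral>\<^sup>+ x. ennreal (norm (g x)) \<partial>lborel)"
      using that by (intro nn_integral_mono) (auto simp: indicator_def intro!: ennreal_leI)
    also have "\<dots> < \<infinity>" using g by (simp add: integrable_iff_bounded)
    finally show ?thesis .
  qed
  have "?M g = ?M (\<lambda>x. - g x)"
  proof (rule measure_eqI_generator_eq)
    show "Int_stable ?E" by (auto simp: Int_stable_def box_Int_box)
    show "?E \<subseteq> Pow UNIV" "sets (?M g) = sigma_sets UNIV ?E" "sets (?M (\<lambda>x. - g x)) = sigma_sets UNIV ?E"
      by (simp_all add: borel_eq_box)
    let ?A = "\<lambda>n::nat. box (- (real n *\<^sub>R One)) (real n *\<^sub>R One) :: 'a set"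
    show "range ?A \<subseteq> ?E" "(\<Union>i. ?A i) = UNIV"
      unfolding UN_box_eq_UNIV by auto
    show "emeasure (?M g) (?A i) \<noteq> \<infinity>" for i
      using fin[of g "?A i"] by (simp add: emeasure_density)
    fix X assume "X \<in> ?E"
    then obtain a b where X: "X = box a b" by auto
    have "integrable lborel (\<lambda>x. g x * indicator (box a b) x)"
      by (rule Bochner_Integration.integrable_bound[OF g]) (auto simp: indicator_def)
    from real_lebesgue_integral_def[OF this] z
    have "enn2real (\<integral>\<^sup>+ x. ennreal (g x * indicator (box a b) x) \<partial>lborel)
      = enn2real (\<integral>\<^sup>+ x. ennreal (- (g x * indicator (box a b) x)) \<partial>lborel)" by simp
    moreover have "ennreal (g x * indicator (box a b) x) = ennreal (g x) * indicator (box a b) x"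
        "ennreal (- (g x * indicator (box a b) x)) = ennreal (- g x) * indicator (box a b) x" for x
      by (auto simp: indicator_def)
    ultimately show "emeasure (?M g) X = emeasure (?M (\<lambda>x. - g x)) X"
      using fin[of g X] fin[of "\<lambda>x. - g x" X]
      by (simp add: X emeasure_density) (metis ennreal_enn2real)
  qed
  then have "AE x in lborel. ennreal (g x) = ennreal (- g x)"
    by (subst (asm) sigma_finite_measure.density_unique_iff[OF sigma_finite_lborel]) auto
  then show ?thesis
    by eventually_elim (metis ennreal_eq_0_iff ennreal_neg linorder_linear neg_le_0_iff_le order_antisym)
qed

theorem fourier_L1_injective:
  fixes f :: "'a::euclidean_space \<Rightarrow> complex"
  assumes f: "integrable lborel f" and f0: "\<And>\<xi>. fourier_L1 f \<xi> = 0"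
  shows "AE x in lborel. f x = 0"
proof -
  have *: "integrable lborel (\<lambda>x. f x * indicator (box a b) x)" for a b
    by (rule Bochner_Integration.integrable_bound[OF f]) (use f in \<open>auto simp: indicator_def\<close>)
  have "Re (LINT x|lborel. f x * indicator (box a b) x) = (LINT x|lborel. Re (f x) * indicator (box a b) x)"
    "Im (LINT x|lborel. f x * indicator (box a b) x) = (LINT x|lborel. Im (f x) * indicator (box a b) x)" for a b
    unfolding integral_Re[OF *, symmetric] integral_Im[OF *, symmetric]
    by (auto intro!: Bochner_Integration.integral_cong simp: indicator_def)
  then have "AE x in lborel. Re (f x) = 0" "AE x in lborel. Im (f x) = 0"
    using f by (auto intro!: AE_zero_if_box_integrals_zero simp: orthogonal_box[OF f f0])
  then show ?thesis by eventually_elim (simp add: complex_eq_iff)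
qed

section \<open>Fourier inversion for \<open>L\<^sup>2\<close> functions with integrable transform\<close>

lemma integrable_mult_L2:
  fixes f g :: "'a::euclidean_space \<Rightarrow> complex"
  assumes "square_integrable f" "square_integrable g"
  shows "integrable lborel (\<lambda>x. f x * g x)"
proof -
  have [measurable]: "f \<in> borel_measurable borel" "g \<in> borel_measurable borel"
    and i: "integrable lborel (\<lambda>x. (norm (f x))\<^sup>2)" "integrable lborel (\<lambda>x. (norm (g x))\<^sup>2)"
    using assms by (auto simp: square_integrable_def)
  have le: "a * b \<le> a\<^sup>2 + b\<^sup>2" if "a \<ge> 0" "b \<ge> 0" for a b :: real
    using sum_squares_bound[of a b] that mult_nonneg_nonneg[OF that] by linarith
  from Bochner_Integration.integrable_add[OF i] show ?thesis
    by (rule Bochner_Integration.integrable_bound) (auto simp: norm_mult le)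
qed

lemma L2_pairing_tendsto:
  fixes f \<psi> :: "'a::euclidean_space \<Rightarrow> complex"
  assumes F: "\<And>n. square_integrable (F n)" and f: "square_integrable f" and \<psi>: "square_integrable \<psi>"
    and lim: "(\<lambda>n. L2sq (\<lambda>x. F n x - f x)) \<longlonglongrightarrow> 0"
  shows "(\<lambda>n. LINT x|lborel. F n x * \<psi> x) \<longlonglongrightarrow> (LINT x|lborel. f x * \<psi> x)"
proof -
  let ?d = "\<lambda>n. (LINT x|lborel. F n x * \<psi> x) - (LINT x|lborel. f x * \<psi> x)"
  have [measurable]: "\<And>n. F n \<in> borel_measurable borel" "f \<in> borel_measurable borel" "\<psi> \<in> borel_measurable borel"
    using assms by (auto intro: square_integrable_measurable)
  have le: "ennreal ((norm (?d n))\<^sup>2) \<le> L2sq (\<lambda>x. F n x - f x) * L2sq \<psi>" for n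
  proof -
    have "?d n = (LINT x|lborel. F n x * \<psi> x - f x * \<psi> x)"
      by (intro Bochner_Integration.integral_diff[symmetric] integrable_mult_L2 F f \<psi>)
    then have "ennreal (norm (?d n))
      \<le> (\<integral>\<^sup>+ x. ennreal (norm (F n x * \<psi> x - f x * \<psi> x)) \<partial>lborel)"
      by (simp only:) (intro integral_norm_bound_ennreal Bochner_Integration.integrable_diff integrable_mult_L2 F f \<psi>)
    also have "\<dots> = (\<integral>\<^sup>+ x. ennreal (norm (F n x - f x)) * ennreal (norm (\<psi> x)) \<partial>lborel)"
      by (intro nn_integral_cong) (simp add: left_diff_distrib[symmetric] norm_mult ennreal_mult)
    finally have "(ennreal (norm (?d n)))\<^sup>2 \<le>
       (\<integral>\<^sup>+ x. ennreal (norm (F n x - f x)) * ennreal (norm (\<psi> x)) \<partial>lborel)\<^sup>2"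
      by (rule power_mono) simp
    also have "\<dots> \<le> (\<integral>\<^sup>+ x. (ennreal (norm (F n x - f x)))\<^sup>2 \<partial>lborel) * (\<integral>\<^sup>+ x. (ennreal (norm (\<psi> x)))\<^sup>2 \<partial>lborel)"
      by (rule Cauchy_Schwarz_nn_integral) auto
    finally show ?thesis by (simp add: L2sq_def ennreal_power)
  qed
  have "(\<lambda>n. L2sq \<psi> * L2sq (\<lambda>x. F n x - f x)) \<longlonglongrightarrow> L2sq \<psi> * 0"
    using \<psi> lim by (intro ennreal_tendsto_cmult) (auto simp: square_integrable_iff)
  then have "(\<lambda>n. ennreal ((norm (?d n))\<^sup>2)) \<longlonglongrightarrow> ennreal 0"
    using ennreal_tendsto_0_le[OF _ le] by (simp add: mult.commute)
  then have "(\<lambda>n. (norm (?d n))\<^sup>2) \<longlonglongrightarrow> 0"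
    by (subst (asm) tendsto_ennreal_iff) auto
  then have "(\<lambda>n. sqrt ((norm (?d n))\<^sup>2)) \<longlonglongrightarrow> sqrt 0"
    by (rule tendsto_real_sqrt)
  then have "(\<lambda>n. norm (?d n)) \<longlonglongrightarrow> 0" by simp
  then show ?thesis
    by (simp add: tendsto_norm_zero_iff LIM_zero_iff)
qed

lemma square_integrable_fourier_L1:
  fixes f :: "'a::euclidean_space \<Rightarrow> complex"
  assumes f: "integrable lborel f" "square_integrable f"
  shows "square_integrable (fourier_L1 f)"
proof -
  have [measurable]: "f \<in> borel_measurable borel" using f by auto
  have "ennreal ((2 * pi) ^ DIM('a)) * L2sq f < \<infinity>"
    using f(2) by (auto simp: square_integrable_iff ennreal_mult_less_top)
  from le_less_trans[OF plancherel_inequality[OF f(1)] this] show ?thesis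
    by (simp add: square_integrable_iff)
qed

text \<open>The multiplication formula survives the \<open>L\<^sup>2\<close> limit when both sides are paired with \<open>L\<^sup>2\<close> functions.\<close>

lemma fourier_L2_duality:
  fixes f g \<phi> :: "'a::euclidean_space \<Rightarrow> complex"
  assumes fg: "has_fourier_L2 f g" and \<phi>: "integrable lborel \<phi>" "square_integrable \<phi>"
  shows "(LINT \<xi>|lborel. g \<xi> * \<phi> \<xi>) = (LINT x|lborel. f x * fourier_L1 \<phi> x)"
proof -
  obtain F where F: "\<And>n. integrable lborel (F n)" "\<And>n. square_integrable (F n)"
       "(\<lambda>n. L2sq (\<lambda>x. F n x - f x)) \<longlonglongrightarrow> 0" "(\<lambda>n. L2sq (\<lambda>\<xi>. fourier_L1 (F n) \<xi> - g \<xi>)) \<longlonglongrightarrow> 0"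
    and sq: "square_integrable f" "square_integrable g"
     using fg unfolding has_fourier_L2_iff by blast
  have "(\<lambda>n. LINT \<xi>|lborel. fourier_L1 (F n) \<xi> * \<phi> \<xi>) \<longlonglongrightarrow> (LINT \<xi>|lborel. g \<xi> * \<phi> \<xi>)"
    by (intro L2_pairing_tendsto square_integrable_fourier_L1 F sq \<phi>)
  moreover have "(\<lambda>n. LINT x|lborel. F n x * fourier_L1 \<phi> x) \<longlonglongrightarrow> (LINT x|lborel. f x * fourier_L1 \<phi> x)"
    by (intro L2_pairing_tendsto square_integrable_fourier_L1 F sq \<phi>)
  ultimately show ?thesis
    unfolding fourier_L1_multiplication[OF F(1) \<phi>(1)] by (rule LIMSEQ_unique)
qed

lemma square_integrable_gauss:
  "s > 0 \<Longrightarrow> square_integrable (\<lambda>x::'a::euclidean_space. complex_of_real (gauss s x))"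
  unfolding square_integrable_def
  by (auto intro!: Bochner_Integration.integrable_bound[OF gauss_integrable[of s]]
           simp: power2_eq_square gauss_le_1 mult_left_le)

lemma square_integrable_mult_bounded:
  fixes f :: "'a::euclidean_space \<Rightarrow> complex"
  assumes f: "square_integrable f" and [measurable]: "m \<in> borel_measurable borel"
    and B: "\<And>x. norm (m x) \<le> B"
  shows "square_integrable (\<lambda>x. m x * f x)"
proof -
  have [measurable]: "f \<in> borel_measurable borel" and i: "integrable lborel (\<lambda>x. (norm (f x))\<^sup>2)"
    using f by (auto simp: square_integrable_def)
  have "integrable lborel (\<lambda>x. B\<^sup>2 * (norm (f x))\<^sup>2)" using i by auto
  then have "integrable lborel (\<lambda>x. (norm (m x * f x))\<^sup>2)"
    by (rule Bochner_Integration.integrable_bound)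
       (auto simp: norm_mult power_mult_distrib intro!: mult_right_mono power_mono B)
  then show ?thesis by (simp add: square_integrable_def)
qed

lemma has_fourier_L2_cong_AE:
  fixes f g :: "'a::euclidean_space \<Rightarrow> complex"
  assumes fg: "has_fourier_L2 f g" and f': "AE x in lborel. f x = f' x" and g': "AE x in lborel. g x = g' x"
    and [measurable]: "f' \<in> borel_measurable borel" "g' \<in> borel_measurable borel"
  shows "has_fourier_L2 f' g'"
proof -
  obtain F where F: "\<And>n. integrable lborel (F n)" "\<And>n. square_integrable (F n)"
       "(\<lambda>n. L2sq (\<lambda>x. F n x - f x)) \<longlonglongrightarrow> 0" "(\<lambda>n. L2sq (\<lambda>\<xi>. fourier_L1 (F n) \<xi> - g \<xi>)) \<longlonglongrightarrow> 0"
    and sq: "square_integrable f" "square_integrable g"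
     using fg unfolding has_fourier_L2_iff by blast
  have "L2sq (\<lambda>x. F n x - f x) = L2sq (\<lambda>x. F n x - f' x)"
       "L2sq (\<lambda>\<xi>. fourier_L1 (F n) \<xi> - g \<xi>) = L2sq (\<lambda>\<xi>. fourier_L1 (F n) \<xi> - g' \<xi>)" for n
    using f' g' by (auto intro!: L2sq_cong_AE)
  moreover have "L2sq f' = L2sq f" "L2sq g' = L2sq g"
    using f' g' by (auto intro!: L2sq_cong_AE)
  ultimately show ?thesis using F sq unfolding has_fourier_L2_iff
    by (intro conjI exI[of _ F]) (auto simp: square_integrable_iff)
qed

text \<open>
  Multiplication by the Gaussian puts an \<open>L\<^sup>2\<close> function into \<open>L\<^sup>1\<close>, and pairings with modulated
  Gaussians are the values of the transform of this product. As the Gaussian never vanishes,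
  injectivity on \<open>L\<^sup>1\<close> separates \<open>L\<^sup>2\<close> functions.
\<close>

lemma AE_eq_if_gauss_modulations_agree:
  fixes f g :: "'a::euclidean_space \<Rightarrow> complex"
  assumes f: "square_integrable f" and g: "square_integrable g"
    and eq: "\<And>y. (LINT x|lborel. f x * (cis (- (y \<bullet> x)) * of_real (gauss 1 x))) = (LINT x|lborel. g x * (cis (- (y \<bullet> x)) * of_real (gauss 1 x)))"
  shows "AE x in lborel. f x = g x"
proof -
  let ?G = "\<lambda>x. complex_of_real (gauss 1 (x::'a))"
  have i: "integrable lborel (\<lambda>x. f x * ?G x)" "integrable lborel (\<lambda>x. g x * ?G x)"
    by (intro integrable_mult_L2 f g square_integrable_gauss zero_less_one)+
  then have "integrable lborel (\<lambda>x. f x * ?G x - g x * ?G x)" by simp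
  moreover have "fourier_L1 (\<lambda>x. f x * ?G x - g x * ?G x) y = 0" for y
  proof -
    have "cis (- (x \<bullet> y)) * (u * v) = u * (cis (- (y \<bullet> x)) * v)" for x u v
      by (simp add: inner_commute[of x y])
    then show ?thesis
      unfolding fourier_L1_diff[OF i] fourier_L1_def using eq[of y] by (simp only: diff_self)
  qed
  ultimately have "AE x in lborel. f x * ?G x - g x * ?G x = 0"
    by (rule fourier_L1_injective)
  then show ?thesis
  proof eventually_elim
    fix x assume "f x * ?G x - g x * ?G x = 0"
    then show "f x = g x" using gauss_pos[of 1 x] by auto
  qed
qed

definition inv_fourier :: "('a::euclidean_space \<Rightarrow> complex) \<Rightarrow> 'a \<Rightarrow> complex" where
  "inv_fourier h x = (LINT \<xi>|lborel. cis (x \<bullet> \<xi>) * h \<xi>) / of_real ((2 * pi) ^ DIM('a))"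

lemma inv_fourier_eq: "inv_fourier h x = fourier_L1 h (- x) / of_real ((2 * pi) ^ DIM('a))"
  for x :: "'a::euclidean_space"
  by (simp add: inv_fourier_def fourier_L1_def inner_commute)

lemma inv_fourier_measurable [measurable]:
  assumes [measurable]: "h \<in> borel_measurable borel"
  shows "inv_fourier h \<in> borel_measurable borel"
  unfolding inv_fourier_eq by measurable

lemma square_integrable_inv_fourier:
  fixes h :: "'a::euclidean_space \<Rightarrow> complex"
  assumes h: "integrable lborel h" "square_integrable h"
  shows "square_integrable (inv_fourier h)"
proof -
  have [measurable]: "h \<in> borel_measurable borel" using h by auto
  have "L2sq (inv_fourier h) \<le> L2sq (\<lambda>x. fourier_L1 h (0 - x))"
  proof (intro L2sq_mono_AE AE_I2)
    fix x :: 'a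
    have "(1::real) \<le> (2 * pi) ^ DIM('a)" using pi_gt3 by (intro one_le_power) auto
    then have "norm (fourier_L1 h (- x)) / (2 * pi) ^ DIM('a) \<le> norm (fourier_L1 h (- x)) / 1"
      by (intro divide_left_mono) auto
    then show "norm (inv_fourier h x) \<le> norm (fourier_L1 h (0 - x))"
      unfolding inv_fourier_eq norm_divide norm_of_real by simp
  qed
  also have "\<dots> = L2sq (fourier_L1 h)"
    unfolding L2sq_def by (rule nn_integral_reflect) measurable
  also have "\<dots> < \<infinity>"
    using square_integrable_fourier_L1[OF h] by (simp add: square_integrable_iff)
  finally show ?thesis by (simp add: square_integrable_iff)
qed

lemma gauss_const_sq: "complex_of_real (sqrt (2 * pi) ^ d) * complex_of_real (sqrt (2 * pi) ^ d) = of_real ((2 * pi) ^ d)"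
  unfolding of_real_mult[symmetric] power_mult_distrib[symmetric] by simp

text \<open>
  Parseval's formula against a modulated Gaussian \<open>\<phi>\<close>, by the multiplication formula and the explicit
  double transform of \<open>\<phi>\<close>. This is the only place where the inversion formula is computed.
\<close>

lemma integral_inv_fourier_fourier_gauss:
  fixes h :: "'a::euclidean_space \<Rightarrow> complex"
  assumes h: "integrable lborel h"
  defines "\<phi> \<equiv> \<lambda>y \<xi>. cis (- (y \<bullet> \<xi>)) * complex_of_real (gauss 1 \<xi>)"
  shows "(LINT x|lborel. inv_fourier h x * fourier_L1 (\<phi> y) x) = (LINT \<xi>|lborel. h \<xi> * \<phi> y \<xi>)"
proof -
  have [measurable]: "h \<in> borel_measurable borel" using h by auto
  let ?c = "complex_of_real (sqrt (2 * pi) ^ DIM('a))"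
  let ?d = "complex_of_real ((2 * pi) ^ DIM('a))"
  let ?k = "\<lambda>x. ?c * complex_of_real (gauss 1 (x - y))"
  have g: "fourier_L1 (\<lambda>x. complex_of_real (gauss 1 x)) \<xi> = ?c * complex_of_real (gauss 1 \<xi>)" for \<xi> :: 'a
    using fourier_gauss(2)[of 1 \<xi>] by simp
  have \<phi>hat: "fourier_L1 (\<phi> y) x = ?c * complex_of_real (gauss 1 (x + y))" for x
    using fourier_L1_modulate[of "- y" "\<lambda>\<xi>. complex_of_real (gauss 1 \<xi>)" x]
    by (simp add: \<phi>_def g)
  have "(LINT x|lborel. inv_fourier h x * fourier_L1 (\<phi> y) x)
      = (LINT x|lborel. inv_fourier h (0 - x) * fourier_L1 (\<phi> y) (0 - x))"
    by (rule integral_reflect[symmetric]) (simp add: \<phi>_def)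
  also have "\<dots> = (LINT x|lborel. fourier_L1 h x * ?k x / ?d)"
  proof (intro Bochner_Integration.integral_cong refl)
    fix x
    have "gauss 1 (- x + y) = gauss 1 (x - y)"
      using gauss_minus[of 1 "x - y"] by simp
    then show "inv_fourier h (0 - x) * fourier_L1 (\<phi> y) (0 - x) = fourier_L1 h x * ?k x / ?d"
      unfolding inv_fourier_eq \<phi>hat by simp
  qed
  also have "\<dots> = (LINT x|lborel. fourier_L1 h x * ?k x) / ?d"
    by simp
  also have "(LINT x|lborel. fourier_L1 h x * ?k x) = (LINT \<xi>|lborel. h \<xi> * fourier_L1 ?k \<xi>)"
  proof (rule fourier_L1_multiplication[OF h, symmetric])
    have "integrable lborel (\<lambda>x. complex_of_real (gauss 1 (y - x)))"
      by (intro integrable_reflect gauss_complex_integrable) simp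
    then show "integrable lborel ?k" by (simp add: gauss_def norm_minus_commute)
  qed
  also have "\<dots> = (LINT \<xi>|lborel. ?d * (h \<xi> * \<phi> y \<xi>))"
  proof (intro Bochner_Integration.integral_cong refl)
    fix \<xi>
    have "fourier_L1 ?k \<xi> = ?c * fourier_L1 (\<lambda>x. complex_of_real (gauss 1 (x - y))) \<xi>"
      unfolding fourier_L1_def mult.left_commute[of _ ?c] by (rule integral_mult_right_zero)
    also have "\<dots> = ?c * (cis (- (y \<bullet> \<xi>)) * (?c * complex_of_real (gauss 1 \<xi>)))"
      by (subst fourier_L1_translate) (simp_all add: g)
    also have "\<dots> = (?c * ?c) * \<phi> y \<xi>"
      unfolding \<phi>_def by (simp only: mult_ac)
    finally show "h \<xi> * fourier_L1 ?k \<xi> = ?d * (h \<xi> * \<phi> y \<xi>)"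
      unfolding gauss_const_sq by (simp only: mult_ac)
  qed
  also have "\<dots> / ?d = (LINT \<xi>|lborel. h \<xi> * \<phi> y \<xi>)"
    by (subst integral_mult_right_zero) simp
  finally show ?thesis .
qed

lemma gauss_modulated_L1_L2:
  "integrable lborel (\<lambda>\<xi>::'a::euclidean_space. cis (- (y \<bullet> \<xi>)) * complex_of_real (gauss 1 \<xi>))"
  "square_integrable (\<lambda>\<xi>::'a. cis (- (y \<bullet> \<xi>)) * complex_of_real (gauss 1 \<xi>))"
  using integrable_modulate[OF gauss_complex_integrable, of 1 "- y"]
  by (auto intro!: square_integrable_mult_bounded[OF square_integrable_gauss])

text \<open>
  Some transform \<open>g\<close> of \<open>inv_fourier h\<close> exists. By duality it has the same pairings with modulated
  Gaussians as \<open>h\<close>, so it equals \<open>h\<close>.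
\<close>

theorem has_fourier_L2_inv_fourier:
  fixes h :: "'a::euclidean_space \<Rightarrow> complex"
  assumes h: "integrable lborel h" "square_integrable h"
  shows "has_fourier_L2 (inv_fourier h) h"
proof -
  have sq: "square_integrable (inv_fourier h)" by (rule square_integrable_inv_fourier[OF h])
  then obtain g where g: "has_fourier_L2 (inv_fourier h) g"
    using has_fourier_L2_exists by blast
  have "AE x in lborel. g x = h x"
  proof (rule AE_eq_if_gauss_modulations_agree)
    show "square_integrable g" "square_integrable h" using g h by (auto simp: has_fourier_L2_iff)
    show "(LINT x|lborel. g x * (cis (- (y \<bullet> x)) * of_real (gauss 1 x))) = (LINT x|lborel. h x * (cis (- (y \<bullet> x)) * of_real (gauss 1 x)))" for y
      by (subst fourier_L2_duality[OF g gauss_modulated_L1_L2]) (rule integral_inv_fourier_fourier_gauss[OF h(1)])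
  qed
  then show ?thesis
    using g sq h by (intro has_fourier_L2_cong_AE[OF g]) (auto intro: square_integrable_measurable)
qed

text \<open>
  The difference of \<open>f\<close> and \<open>inv_fourier g\<close> has transform zero. Duality with a translated Gaussian, whose
  transform is a modulated Gaussian, shows that the difference vanishes.
\<close>

theorem fourier_L2_inversion:
  fixes f g :: "'a::euclidean_space \<Rightarrow> complex"
  assumes fg: "has_fourier_L2 f g" and g: "integrable lborel g"
  shows "AE x in lborel. f x = inv_fourier g x"
proof -
  have sq: "square_integrable f" "square_integrable g" using fg by (auto simp: has_fourier_L2_iff)
  let ?D = "\<lambda>x. f x - inv_fourier g x"
  have D: "has_fourier_L2 ?D (\<lambda>x. g x - g x)"
    by (intro has_fourier_L2_diff fg has_fourier_L2_inv_fourier g sq)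
  have "AE x in lborel. ?D x = (\<lambda>_. 0) x"
  proof (rule AE_eq_if_gauss_modulations_agree)
    show "square_integrable ?D" using D by (simp add: has_fourier_L2_iff)
    show "square_integrable (\<lambda>_::'a. 0::complex)" by (simp add: square_integrable_def)
    fix y :: 'a
    let ?\<phi> = "\<lambda>\<xi>. complex_of_real (gauss 1 (\<xi> - y))"
    have i: "integrable lborel ?\<phi>"
    proof -
      have "integrable lborel (\<lambda>x. complex_of_real (gauss 1 (y - x)))"
        by (intro integrable_reflect gauss_complex_integrable) simp
      then show ?thesis by (simp add: gauss_def norm_minus_commute)
    qed
    have "square_integrable ?\<phi>"
      unfolding square_integrable_def
      using Bochner_Integration.integrable_bound[OF integrable_norm[OF i], of "\<lambda>x. (norm (?\<phi> x))\<^sup>2"]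
      by (auto simp: power2_eq_square gauss_le_1 mult_left_le)
    from fourier_L2_duality[OF D i this]
    have "(LINT x|lborel. ?D x * fourier_L1 ?\<phi> x) = 0" by simp
    moreover define c where "c = complex_of_real (sqrt (2 * pi) ^ DIM('a))"
    have "fourier_L1 ?\<phi> x = c * (cis (- (y \<bullet> x)) * of_real (gauss 1 x))" for x
      using fourier_gauss(2)[of 1 x] by (subst fourier_L1_translate) (simp_all add: c_def)
    ultimately have "(LINT x|lborel. ?D x * (c * (cis (- (y \<bullet> x)) * of_real (gauss 1 x)))) = 0"
      by (simp only:)
    also have "(\<lambda>x. ?D x * (c * (cis (- (y \<bullet> x)) * of_real (gauss 1 x))))
        = (\<lambda>x. c * (?D x * (cis (- (y \<bullet> x)) * of_real (gauss 1 x))))"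
      by (intro ext) (rule mult.left_commute)
    finally have "(LINT x|lborel. c * (?D x * (cis (- (y \<bullet> x)) * of_real (gauss 1 x)))) = 0" .
    moreover have "c \<noteq> 0" by (simp add: c_def)
    ultimately show "(LINT x|lborel. ?D x * (cis (- (y \<bullet> x)) * of_real (gauss 1 x)))
       = (LINT x|lborel. (\<lambda>_. 0) x * (cis (- (y \<bullet> x)) * of_real (gauss 1 x)))"
      by (subst (asm) integral_mult_right_zero) simp
  qed
  then show ?thesis by simp
qed

section \<open>Band-limited functions\<close>

text \<open>
  The relation between a real function and its transform that the rest of the argument works
  with. The inverse transform of \<open>h\<close> is only required to agree with \<open>f\<close> almost everywhere, because \<open>f\<close> may be an arbitrary
  representative, such as a choice of Leray projection; the support of \<open>h\<close> is exact, so that symbols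
  need to be controlled only where \<open>h\<close> does not vanish.
\<close>

definition has_spectrum :: "real \<Rightarrow> ('a::euclidean_space \<Rightarrow> real) \<Rightarrow> ('a \<Rightarrow> complex) \<Rightarrow> bool" where
  "has_spectrum R f h \<longleftrightarrow> f \<in> borel_measurable borel \<and> integrable lborel h \<and> square_integrable h \<and>
     (\<forall>\<xi>. R < norm \<xi> \<longrightarrow> h \<xi> = 0) \<and> (AE x in lborel. complex_of_real (f x) = inv_fourier h x)"

lemma has_spectrumD:
  assumes "has_spectrum R f h"
  shows "f \<in> borel_measurable borel" "integrable lborel h" "square_integrable h" "h \<in> borel_measurable borel"
    "R < norm \<xi> \<Longrightarrow> h \<xi> = 0" "AE x in lborel. complex_of_real (f x) = inv_fourier h x"
  using assms by (auto simp: has_spectrum_def square_integrable_def)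

lemma square_integrable_of_real:
  "square_integrable (\<lambda>x. complex_of_real (f x)) \<longleftrightarrow> square_integrable f"
proof -
  have "(\<lambda>x. complex_of_real (f x)) \<in> borel_measurable borel \<longleftrightarrow> f \<in> borel_measurable borel"
  proof
    assume "(\<lambda>x. complex_of_real (f x)) \<in> borel_measurable borel"
    from measurable_compose[OF this borel_measurable_Re] show "f \<in> borel_measurable borel" by simp
  qed measurable
  then show ?thesis unfolding square_integrable_def norm_of_real by (simp only: measurable_lborel2 power2_abs real_norm_def)
qed

lemma has_spectrum_has_fourier:
  assumes "has_spectrum R f h"
  shows "has_fourier_L2 (\<lambda>x. complex_of_real (f x)) h"
proof -
  note [measurable] = has_spectrumD(1,4)[OF assms]
  have "AE x in lborel. inv_fourier h x = complex_of_real (f x)"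
    using has_spectrumD(6)[OF assms] by eventually_elim simp
  then show ?thesis
    by (rule has_fourier_L2_cong_AE[OF has_fourier_L2_inv_fourier[OF has_spectrumD(2,3)[OF assms]]])
       (simp_all add: has_spectrumD(1,4)[OF assms])
qed

lemma has_fourier_L2_fourier:
  assumes "square_integrable f"
  shows "has_fourier_L2 (\<lambda>x. complex_of_real (f x)) (fourier f)"
  unfolding fourier_def
  by (rule someI_ex[OF has_fourier_L2_exists]) (simp add: square_integrable_of_real assms)

lemma has_spectrum_square_integrable: "has_spectrum R f h \<Longrightarrow> square_integrable f"
  using has_spectrum_has_fourier[of R f h] by (simp add: has_fourier_L2_iff square_integrable_of_real)

lemma has_spectrum_fourier:
  assumes "has_spectrum R f h"
  shows "AE \<xi> in lborel. fourier f \<xi> = h \<xi>"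
  using has_fourier_L2_unique[OF has_fourier_L2_fourier has_spectrum_has_fourier[OF assms]]
    has_spectrum_square_integrable[OF assms] by simp

lemma has_spectrumI_fourier:
  fixes f :: "'a::euclidean_space \<Rightarrow> real"
  assumes f: "square_integrable f" and h: "AE \<xi> in lborel. fourier f \<xi> = h \<xi>"
    and hi: "integrable lborel h" and supp: "\<And>\<xi>. R < norm \<xi> \<Longrightarrow> h \<xi> = 0"
  shows "has_spectrum R f h"
proof -
  have [measurable]: "f \<in> borel_measurable borel" "h \<in> borel_measurable borel"
    using f hi by (auto simp: square_integrable_def)
  have "has_fourier_L2 (\<lambda>x. complex_of_real (f x)) h"
    by (rule has_fourier_L2_cong_AE[OF has_fourier_L2_fourier[OF f] _ h]) auto
  then show ?thesis
    using fourier_L2_inversion[OF _ hi] supp hi by (auto simp: has_spectrum_def has_fourier_L2_iff)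
qed

lemma has_spectrum_bound: "has_spectrum R f h \<Longrightarrow> L2sq h \<le> ennreal (4 * (2 * pi) ^ DIM('a)) * L2sq f"
  for f :: "'a::euclidean_space \<Rightarrow> real"
  using has_fourier_L2_bound[OF has_spectrum_has_fourier, of R f h] by (simp add: L2sq_def)

lemma inv_fourier_add:
  assumes "integrable lborel h" "integrable lborel k"
  shows "inv_fourier (\<lambda>\<xi>. h \<xi> + k \<xi>) x = inv_fourier h x + inv_fourier k x"
  unfolding inv_fourier_def using integrable_modulate[OF assms(1), of x] integrable_modulate[OF assms(2), of x]
  by (simp add: distrib_left add_divide_distrib)

lemma inv_fourier_cmult:
  "inv_fourier (\<lambda>\<xi>. c * h \<xi>) x = c * inv_fourier h x"
proof -
  have "(\<lambda>\<xi>. cis (x \<bullet> \<xi>) * (c * h \<xi>)) = (\<lambda>\<xi>. c * (cis (x \<bullet> \<xi>) * h \<xi>))" by (simp add: mult_ac)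
  then show ?thesis unfolding inv_fourier_def by simp
qed

lemma has_spectrum_zero [simp]: "has_spectrum R (\<lambda>_. 0) (\<lambda>_. 0)"
  by (simp add: has_spectrum_def square_integrable_def inv_fourier_def)

lemma has_spectrum_add:
  assumes f: "has_spectrum R f h" and g: "has_spectrum R g k"
  shows "has_spectrum R (\<lambda>x. f x + g x) (\<lambda>\<xi>. h \<xi> + k \<xi>)"
proof -
  note [measurable] = has_spectrumD(1,4)[OF f] has_spectrumD(1,4)[OF g]
  show ?thesis
    using f g unfolding has_spectrum_def
    by (auto intro!: square_integrable_add simp: inv_fourier_add)
qed

lemma has_spectrum_cmult:
  assumes f: "has_spectrum R f h"
  shows "has_spectrum R (\<lambda>x. c * f x) (\<lambda>\<xi>. complex_of_real c * h \<xi>)"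
  using f unfolding has_spectrum_def
  by (auto intro!: square_integrable_mult_bounded[of h "\<lambda>_. complex_of_real c"] simp: inv_fourier_cmult)

lemma has_spectrum_sum:
  assumes "finite J" "\<And>j. j \<in> J \<Longrightarrow> has_spectrum R (f j) (h j)"
  shows "has_spectrum R (\<lambda>x. \<Sum>j\<in>J. f j x) (\<lambda>\<xi>. \<Sum>j\<in>J. h j \<xi>)"
  using assms by (induction J rule: finite_induct) (auto intro!: has_spectrum_add)

lemma ennreal_sqrt_mono: "x \<le> y \<Longrightarrow> ennreal_sqrt x \<le> ennreal_sqrt y"
  by (auto simp: ennreal_sqrt_def top_unique enn2real_mono less_top)

lemma ennreal_sqrt_ennreal: "a \<ge> 0 \<Longrightarrow> ennreal_sqrt (ennreal a) = ennreal (sqrt a)"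
  by (simp add: ennreal_sqrt_def)

text \<open>
  On frequencies of size at most \<open>R\<close> the Sobolev weight is bounded, so an \<open>L\<^sup>2\<close> bound on the
  spectrum suffices.
\<close>

lemma sobolev_norm_le:
  fixes f :: "'a::euclidean_space \<Rightarrow> real"
  assumes f: "has_spectrum R f h" and s: "s \<ge> 0" and B: "L2sq h \<le> ennreal (B\<^sup>2)" "B \<ge> 0"
  shows "sobolev_norm s f \<le> ennreal (sqrt ((1 + R\<^sup>2) powr s) * B)"
proof -
  have "(\<integral>\<^sup>+ \<xi>. ennreal ((1 + (norm \<xi>)\<^sup>2) powr s * (norm (fourier f \<xi>))\<^sup>2) \<partial>lborel)
    \<le> (\<integral>\<^sup>+ \<xi>. ennreal ((1 + R\<^sup>2) powr s) * ennreal ((norm (h \<xi>))\<^sup>2) \<partial>lborel)"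
  proof (rule nn_integral_mono_AE)
    show "AE \<xi> in lborel. ennreal ((1 + (norm \<xi>)\<^sup>2) powr s * (norm (fourier f \<xi>))\<^sup>2)
        \<le> ennreal ((1 + R\<^sup>2) powr s) * ennreal ((norm (h \<xi>))\<^sup>2)"
      using has_spectrum_fourier[OF f]
    proof eventually_elim
      fix \<xi> assume *: "fourier f \<xi> = h \<xi>"
      show "ennreal ((1 + (norm \<xi>)\<^sup>2) powr s * (norm (fourier f \<xi>))\<^sup>2)
        \<le> ennreal ((1 + R\<^sup>2) powr s) * ennreal ((norm (h \<xi>))\<^sup>2)"
      proof (cases "R < norm \<xi>")
        case True
        then show ?thesis using has_spectrumD(5)[OF f True] by (simp add: *)
      next
        case False
        then have "(1 + (norm \<xi>)\<^sup>2) powr s \<le> (1 + R\<^sup>2) powr s"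
          using s by (intro powr_mono2) (auto intro!: power_mono)
        then show ?thesis by (simp add: * ennreal_mult[symmetric] mult_right_mono ennreal_leI)
      qed
    qed
  qed
  also have "\<dots> = ennreal ((1 + R\<^sup>2) powr s) * L2sq h"
    using has_spectrumD(4)[OF f] by (simp add: nn_integral_cmult L2sq_def)
  also have "\<dots> \<le> ennreal ((1 + R\<^sup>2) powr s) * ennreal (B\<^sup>2)"
    by (intro mult_left_mono B) auto
  also have "\<dots> = ennreal ((1 + R\<^sup>2) powr s * B\<^sup>2)" by (simp add: ennreal_mult)
  finally have "sobolev_norm s f \<le> ennreal_sqrt (ennreal ((1 + R\<^sup>2) powr s * B\<^sup>2))"
    using has_spectrum_square_integrable[OF f] by (simp add: sobolev_norm_def ennreal_sqrt_mono)
  then show ?thesis using B(2) by (simp add: ennreal_sqrt_ennreal real_sqrt_mult)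
qed

section \<open>Products and convolution of spectra\<close>

lemma nn_integral_translate:
  assumes [measurable]: "F \<in> borel_measurable borel"
  shows "(\<integral>\<^sup>+ x. F (x - y :: 'a::euclidean_space) \<partial>lborel) = (\<integral>\<^sup>+ x. F x \<partial>lborel)"
  by (subst lborel_affine[of 1 y]) (simp_all add: density_1 nn_integral_distr)

lemma nn_integral_convolution:
  fixes P Q :: "'a::euclidean_space \<Rightarrow> ennreal"
  assumes [measurable]: "P \<in> borel_measurable borel" "Q \<in> borel_measurable borel"
  shows "(\<integral>\<^sup>+ x. \<integral>\<^sup>+ y. P (x - y) * Q y \<partial>lborel \<partial>lborel) = (\<integral>\<^sup>+ x. P x \<partial>lborel) * (\<integral>\<^sup>+ y. Q y \<partial>lborel)"
proof -
  have "(\<integral>\<^sup>+ x. \<integral>\<^sup>+ y. P (x - y) * Q y \<partial>lborel \<partial>lborel) = (\<integral>\<^sup>+ y. \<integral>\<^sup>+ x. P (x - y) * Q y \<partial>lborel \<partial>lborel)"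
    by (rule lborel_pair.Fubini') measurable
  also have "\<dots> = (\<integral>\<^sup>+ y. (\<integral>\<^sup>+ x. P x \<partial>lborel) * Q y \<partial>lborel)"
    by (simp add: nn_integral_multc nn_integral_translate)
  finally show ?thesis by (simp add: nn_integral_cmult)
qed

text \<open>Young's inequality \<open>L\<^sup>1 * L\<^sup>2 \<subseteq> L\<^sup>2\<close>: Cauchy-Schwarz for the measure \<open>p(x - y) dy\<close>, then Tonelli.\<close>

lemma convolution_L2_bound:
  fixes p :: "'a::euclidean_space \<Rightarrow> real" and Q :: "'a \<Rightarrow> ennreal"
  assumes [measurable]: "p \<in> borel_measurable borel" "Q \<in> borel_measurable borel" and p0: "\<And>x. p x \<ge> 0"
  shows "(\<integral>\<^sup>+ x. (\<integral>\<^sup>+ y. ennreal (p (x - y)) * Q y \<partial>lborel)\<^sup>2 \<partial>lborel) \<le> (\<integral>\<^sup>+ x. ennreal (p x) \<partial>lborel)\<^sup>2 * (\<integral>\<^sup>+ y. (Q y)\<^sup>2 \<partial>lborel)"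
proof -
  have "(\<integral>\<^sup>+ y. ennreal (p (x - y)) * Q y \<partial>lborel)\<^sup>2 \<le> (\<integral>\<^sup>+ x. ennreal (p x) \<partial>lborel) * (\<integral>\<^sup>+ y. ennreal (p (x - y)) * (Q y)\<^sup>2 \<partial>lborel)" for x
  proof -
    have sq: "(ennreal (sqrt (p z)))\<^sup>2 = ennreal (p z)" for z
      using p0[of z] by (simp add: ennreal_power)
    \<comment> \<open>split the weight evenly between the two factors of Cauchy-Schwarz\<close>
    have "(\<integral>\<^sup>+ y. ennreal (p (x - y)) * Q y \<partial>lborel)\<^sup>2
        = (\<integral>\<^sup>+ y. ennreal (sqrt (p (x - y))) * (ennreal (sqrt (p (x - y))) * Q y) \<partial>lborel)\<^sup>2"
      unfolding mult.assoc[symmetric] power2_eq_square[of "ennreal (sqrt _)", symmetric] sq ..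
    also have "\<dots> \<le> (\<integral>\<^sup>+ y. (ennreal (sqrt (p (x - y))))\<^sup>2 \<partial>lborel) * (\<integral>\<^sup>+ y. (ennreal (sqrt (p (x - y))) * Q y)\<^sup>2 \<partial>lborel)"
      by (rule Cauchy_Schwarz_nn_integral) measurable
    also have "\<dots> = (\<integral>\<^sup>+ y. ennreal (p (x - y)) \<partial>lborel) * (\<integral>\<^sup>+ y. ennreal (p (x - y)) * (Q y)\<^sup>2 \<partial>lborel)"
      by (simp add: sq power_mult_distrib)
    also have "(\<integral>\<^sup>+ y. ennreal (p (x - y)) \<partial>lborel) = (\<integral>\<^sup>+ y. ennreal (p y) \<partial>lborel)"
      by (rule nn_integral_reflect[of "\<lambda>y. ennreal (p y)"]) measurable
    finally show ?thesis .
  qed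
  then have "(\<integral>\<^sup>+ x. (\<integral>\<^sup>+ y. ennreal (p (x - y)) * Q y \<partial>lborel)\<^sup>2 \<partial>lborel)
    \<le> (\<integral>\<^sup>+ x. (\<integral>\<^sup>+ x. ennreal (p x) \<partial>lborel) * (\<integral>\<^sup>+ y. ennreal (p (x - y)) * (Q y)\<^sup>2 \<partial>lborel) \<partial>lborel)"
    by (rule nn_integral_mono)
  also have "\<dots> = (\<integral>\<^sup>+ x. ennreal (p x) \<partial>lborel) * (\<integral>\<^sup>+ x. \<integral>\<^sup>+ y. ennreal (p (x - y)) * (Q y)\<^sup>2 \<partial>lborel \<partial>lborel)"
    by (rule nn_integral_cmult) measurable
  also have "\<dots> = (\<integral>\<^sup>+ x. ennreal (p x) \<partial>lborel)\<^sup>2 * (\<integral>\<^sup>+ y. (Q y)\<^sup>2 \<partial>lborel)"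
    by (subst nn_integral_convolution[of "\<lambda>x. ennreal (p x)" "\<lambda>y. (Q y)\<^sup>2"]) (auto simp: power2_eq_square mult.assoc)
  finally show ?thesis .
qed

text \<open>The convolution normalised so that it is the transform of a product.\<close>

definition spectral_product :: "('a::euclidean_space \<Rightarrow> complex) \<Rightarrow> ('a \<Rightarrow> complex) \<Rightarrow> 'a \<Rightarrow> complex" where
  "spectral_product p q \<xi> = (LINT \<eta>|lborel. p (\<xi> - \<eta>) * q \<eta>) / of_real ((2 * pi) ^ DIM('a))"

lemma two_pi_power_ge_1: "1 \<le> (2 * pi) ^ d"
  using pi_gt3 by (intro one_le_power) auto

lemma norm_div_two_pi_power: "norm (z / complex_of_real ((2 * pi) ^ d)) \<le> norm z"
proof -
  have "norm z / (2 * pi) ^ d \<le> norm z / 1"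
    using two_pi_power_ge_1 by (intro divide_left_mono) auto
  then show ?thesis unfolding norm_divide norm_of_real by simp
qed

context
  fixes p q :: "'a::euclidean_space \<Rightarrow> complex"
  assumes p: "integrable lborel p" and q: "integrable lborel q"
begin

lemma pq_measurable [measurable]: "p \<in> borel_measurable borel" "q \<in> borel_measurable borel"
  using p q by auto

lemma integrable_convolution_pair: "integrable (lborel \<Otimes>\<^sub>M lborel) (\<lambda>(\<xi>, \<eta>). p (\<xi> - \<eta>) * q \<eta>)"
proof (rule integrableI_bounded)
  have "(\<integral>\<^sup>+ z. ennreal (norm (case z of (\<xi>, \<eta>) \<Rightarrow> p (\<xi> - \<eta>) * q \<eta>)) \<partial>(lborel \<Otimes>\<^sub>M lborel))
     = (\<integral>\<^sup>+ \<xi>. \<integral>\<^sup>+ \<eta>. ennreal (norm (p (\<xi> - \<eta>))) * ennreal (norm (q \<eta>)) \<partial>lborel \<partial>lborel)"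
    by (subst lborel.nn_integral_fst[symmetric]) (auto simp: norm_mult ennreal_mult)
  also have "\<dots> = (\<integral>\<^sup>+ \<xi>. ennreal (norm (p \<xi>)) \<partial>lborel) * (\<integral>\<^sup>+ \<eta>. ennreal (norm (q \<eta>)) \<partial>lborel)"
    by (rule nn_integral_convolution[of "\<lambda>x. ennreal (norm (p x))" "\<lambda>x. ennreal (norm (q x))"]) measurable
  also have "\<dots> < \<infinity>"
    using p q by (auto simp: integrable_iff_bounded ennreal_mult_less_top)
  finally show "(\<integral>\<^sup>+ z. ennreal (norm (case z of (\<xi>, \<eta>) \<Rightarrow> p (\<xi> - \<eta>) * q \<eta>)) \<partial>(lborel \<Otimes>\<^sub>M lborel)) < \<infinity>" .
qed measurable

lemma spectral_product_integrable: "integrable lborel (spectral_product p q)"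
  unfolding spectral_product_def
  using lborel_pair.integrable_fst'[OF integrable_convolution_pair] by simp

lemma inv_fourier_spectral_product:
  "inv_fourier (spectral_product p q) x = inv_fourier p x * inv_fourier q x"
proof -
  let ?d = "complex_of_real ((2 * pi) ^ DIM('a))"
  have i: "integrable (lborel \<Otimes>\<^sub>M lborel) (\<lambda>(\<xi>, \<eta>). cis (x \<bullet> \<xi>) * (p (\<xi> - \<eta>) * q \<eta>))"
    by (rule Bochner_Integration.integrable_bound[OF integrable_convolution_pair]) auto
  have "(LINT \<xi>|lborel. cis (x \<bullet> \<xi>) * (LINT \<eta>|lborel. p (\<xi> - \<eta>) * q \<eta>))
      = (LINT \<xi>|lborel. LINT \<eta>|lborel. cis (x \<bullet> \<xi>) * (p (\<xi> - \<eta>) * q \<eta>))"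
    by simp
  also have "\<dots> = (LINT \<eta>|lborel. LINT \<xi>|lborel. cis (x \<bullet> \<xi>) * (p (\<xi> - \<eta>) * q \<eta>))"
    by (rule lborel_pair.Fubini_integral[OF i, symmetric])
  also have "\<dots> = (LINT \<eta>|lborel. (LINT \<xi>|lborel. cis (x \<bullet> \<xi>) * p \<xi>) * (cis (x \<bullet> \<eta>) * q \<eta>))"
  proof (intro Bochner_Integration.integral_cong refl)
    fix \<eta>
    have "(LINT \<xi>|lborel. cis (x \<bullet> \<xi>) * (p (\<xi> - \<eta>) * q \<eta>)) =
        (LINT w|lborel. cis (x \<bullet> (\<eta> + w)) * (p w * q \<eta>))"
      by (subst integral_lborel_affine[where c=1 and t=\<eta>]) auto
    also have "\<dots> = (LINT w|lborel. (cis (x \<bullet> w) * p w) * (cis (x \<bullet> \<eta>) * q \<eta>))"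
      by (intro Bochner_Integration.integral_cong refl) (simp add: inner_add_right cis_mult[symmetric])
    finally show "(LINT \<xi>|lborel. cis (x \<bullet> \<xi>) * (p (\<xi> - \<eta>) * q \<eta>)) =
        (LINT \<xi>|lborel. cis (x \<bullet> \<xi>) * p \<xi>) * (cis (x \<bullet> \<eta>) * q \<eta>)" by simp
  qed
  also have "\<dots> = (LINT \<xi>|lborel. cis (x \<bullet> \<xi>) * p \<xi>) * (LINT \<eta>|lborel. cis (x \<bullet> \<eta>) * q \<eta>)"
    by simp
  finally show ?thesis
    unfolding inv_fourier_def spectral_product_def by simp
qed

lemma spectral_product_support:
  assumes "\<And>\<xi>. R < norm \<xi> \<Longrightarrow> p \<xi> = 0" "\<And>\<xi>. S < norm \<xi> \<Longrightarrow> q \<xi> = 0" and \<xi>: "R + S < norm \<xi>"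
  shows "spectral_product p q \<xi> = 0"
proof -
  have "p (\<xi> - \<eta>) * q \<eta> = 0" for \<eta>
  proof (cases "S < norm \<eta>")
    case False
    have "norm \<xi> \<le> norm (\<xi> - \<eta>) + norm \<eta>"
      using norm_triangle_ineq[of "\<xi> - \<eta>" \<eta>] by simp
    with False \<xi> have "R < norm (\<xi> - \<eta>)" by simp
    then show ?thesis using assms by simp
  qed (use assms in simp)
  then show ?thesis unfolding spectral_product_def by (simp only: Bochner_Integration.integral_zero) simp
qed

end

text \<open>
  The smallness of the nonlinear terms enters here: what counts is a bound on the whole bilinear symbol
  \<open>\<Sum> p\<^sub>j(\<xi>) q\<^sub>j(\<eta>)\<close> at each pair of frequencies, not on the individual products.
\<close>

lemma spectral_product_sum_L2_bound:
  fixes p q :: "'n \<Rightarrow> 'a::euclidean_space \<Rightarrow> complex"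
  assumes J: "finite J" and pq: "\<And>j. j \<in> J \<Longrightarrow> integrable lborel (p j)" "\<And>j. j \<in> J \<Longrightarrow> integrable lborel (q j)"
    and P: "integrable lborel P" "\<And>x. 0 \<le> P x" and Q[measurable]: "Q \<in> borel_measurable borel"
    and bound: "\<And>\<xi> \<eta>. norm (\<Sum>j\<in>J. p j \<xi> * q j \<eta>) \<le> P \<xi> * norm (Q \<eta> :: complex)"
  shows "L2sq (\<lambda>\<xi>. \<Sum>j\<in>J. spectral_product (p j) (q j) \<xi>) \<le> ennreal ((L1_norm P)\<^sup>2) * L2sq Q"
proof -
  have [measurable]: "P \<in> borel_measurable borel" using P by auto
  have "AE \<xi> in lborel. \<forall>j\<in>J. integrable lborel (\<lambda>\<eta>. p j (\<xi> - \<eta>) * q j \<eta>)"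
    using lborel_pair.AE_integrable_fst'[OF integrable_convolution_pair[OF pq]] J
    by (intro AE_finite_allI) auto
  then have "AE \<xi> in lborel. ennreal (norm (\<Sum>j\<in>J. spectral_product (p j) (q j) \<xi>))
      \<le> (\<integral>\<^sup>+ \<eta>. ennreal (P (\<xi> - \<eta>)) * ennreal (norm (Q \<eta>)) \<partial>lborel)"
  proof eventually_elim
    fix \<xi> assume i: "\<forall>j\<in>J. integrable lborel (\<lambda>\<eta>. p j (\<xi> - \<eta>) * q j \<eta>)"
    have "(\<Sum>j\<in>J. spectral_product (p j) (q j) \<xi>) = (LINT \<eta>|lborel. (\<Sum>j\<in>J. p j (\<xi> - \<eta>) * q j \<eta>)) / complex_of_real ((2 * pi) ^ DIM('a))"
      using i by (simp add: spectral_product_def sum_divide_distrib)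
    then have "norm (\<Sum>j\<in>J. spectral_product (p j) (q j) \<xi>) \<le> norm (LINT \<eta>|lborel. (\<Sum>j\<in>J. p j (\<xi> - \<eta>) * q j \<eta>))"
      using norm_div_two_pi_power by simp
    then have "ennreal (norm (\<Sum>j\<in>J. spectral_product (p j) (q j) \<xi>)) \<le> ennreal (norm (LINT \<eta>|lborel. (\<Sum>j\<in>J. p j (\<xi> - \<eta>) * q j \<eta>)))"
      by (rule ennreal_leI)
    also have "\<dots> \<le> (\<integral>\<^sup>+ \<eta>. ennreal (norm (\<Sum>j\<in>J. p j (\<xi> - \<eta>) * q j \<eta>)) \<partial>lborel)"
      using i by (intro integral_norm_bound_ennreal) auto
    also have "\<dots> \<le> (\<integral>\<^sup>+ \<eta>. ennreal (P (\<xi> - \<eta>)) * ennreal (norm (Q \<eta>)) \<partial>lborel)"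
      using bound P by (intro nn_integral_mono) (auto simp: ennreal_mult[symmetric] intro!: ennreal_leI)
    finally show "ennreal (norm (\<Sum>j\<in>J. spectral_product (p j) (q j) \<xi>)) \<le> (\<integral>\<^sup>+ \<eta>. ennreal (P (\<xi> - \<eta>)) * ennreal (norm (Q \<eta>)) \<partial>lborel)" .
  qed
  then have "L2sq (\<lambda>\<xi>. \<Sum>j\<in>J. spectral_product (p j) (q j) \<xi>) \<le> (\<integral>\<^sup>+ \<xi>. (\<integral>\<^sup>+ \<eta>. ennreal (P (\<xi> - \<eta>)) * ennreal (norm (Q \<eta>)) \<partial>lborel)\<^sup>2 \<partial>lborel)"
    unfolding L2sq_def by (intro nn_integral_mono_AE, eventually_elim) (simp flip: ennreal_power add: power_mono)
  also have "\<dots> \<le> (\<integral>\<^sup>+ x. ennreal (P x) \<partial>lborel)\<^sup>2 * (\<integral>\<^sup>+ y. (ennreal (norm (Q y)))\<^sup>2 \<partial>lborel)"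
    by (rule convolution_L2_bound) (use P in auto)
  also have "(\<integral>\<^sup>+ x. ennreal (P x) \<partial>lborel) = ennreal (L1_norm P)"
    using P unfolding L1_norm_def by (subst nn_integral_eq_integral) auto
  finally show ?thesis
    using P(2) by (simp add: L2sq_def ennreal_power L1_norm_def)
qed

lemma has_spectrum_mult:
  assumes f: "has_spectrum R f p" and g: "has_spectrum R g q"
  shows "has_spectrum (2 * R) (\<lambda>x. f x * g x) (spectral_product p q)"
proof -
  note [measurable] = has_spectrumD(1,4)[OF f] has_spectrumD(1,4)[OF g]
  note fg = has_spectrumD(2,3)[OF f] has_spectrumD(2,3)[OF g]
  have [measurable]: "spectral_product p q \<in> borel_measurable borel"
    using spectral_product_integrable[OF fg(1,3)] by auto
  have "L2sq (\<lambda>\<xi>. \<Sum>j\<in>{()}. spectral_product p q \<xi>) \<le> ennreal ((L1_norm (\<lambda>x. norm (p x)))\<^sup>2) * L2sq q"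
    by (rule spectral_product_sum_L2_bound) (use fg in \<open>auto simp: norm_mult\<close>)
  also have "\<dots> < \<infinity>" using fg by (auto simp: square_integrable_iff ennreal_mult_less_top)
  finally have "square_integrable (spectral_product p q)"
    by (simp add: square_integrable_iff)
  moreover have "AE x in lborel. complex_of_real (f x * g x) = inv_fourier (spectral_product p q) x"
    using has_spectrumD(6)[OF f] has_spectrumD(6)[OF g]
    by eventually_elim (simp add: inv_fourier_spectral_product[OF fg(1,3)])
  moreover have "spectral_product p q \<xi> = 0" if "2 * R < norm \<xi>" for \<xi>
    by (rule spectral_product_support[OF fg(1,3) has_spectrumD(5)[OF f] has_spectrumD(5)[OF g]])
       (use that in \<open>simp_all only: mult_2\<close>)
  ultimately show ?thesis
    unfolding has_spectrum_def using spectral_product_integrable[OF fg(1,3)]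
    by (intro conjI allI impI) (simp_all only: borel_measurable_times has_spectrumD(1)[OF f] has_spectrumD(1)[OF g])
qed

lemma borel_measurable_cnj [measurable]: "cnj \<in> borel_measurable borel"
  by (intro borel_measurable_continuous_onI continuous_intros)

section \<open>Derivatives of band-limited functions\<close>

text \<open>This makes the differentiable representative of a class of functions unique.\<close>

lemma continuous_AE_eq_imp_eq:
  fixes u v :: "'a::euclidean_space \<Rightarrow> real"
  assumes c: "continuous_on UNIV u" "continuous_on UNIV v" and eq: "AE x in lborel. u x = v x"
  shows "u = v"
proof -
  let ?S = "{x. u x \<noteq> v x}"
  have op: "open ?S" using c by (rule open_Collect_neq)
  have "?S \<in> null_sets lborel"
    using eq op by (subst (asm) AE_iff_null) (auto simp: borel_open)
  then have "negligible ?S"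
    by (simp add: negligible_iff_null_sets null_sets_completionI)
  then have "?S = {}" using op open_not_negligible by blast
  then show ?thesis by auto
qed

lemma norm_cis_sub_linear: "norm (cis a - 1 - \<i> * of_real a) \<le> a\<^sup>2"
proof -
  have "norm (cis a - 1 - \<i> * of_real a) \<le> \<bar>a\<bar> ^ 2 / 2"
    using iexp_approx1[of a 1] by (simp add: cis_conv_exp numeral_2_eq_2 diff_diff_eq fact_numeral)
  also have "\<dots> \<le> a\<^sup>2" by simp
  finally show ?thesis .
qed

lemma norm_inv_fourier_le:
  fixes k :: "'a::euclidean_space \<Rightarrow> complex"
  assumes k: "integrable lborel k"
  shows "norm (inv_fourier k x) \<le> L1_norm k"
proof -
  have "norm (inv_fourier k x) \<le> norm (LINT \<xi>|lborel. cis (x \<bullet> \<xi>) * k \<xi>)"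
    unfolding inv_fourier_def by (rule norm_div_two_pi_power)
  also have "\<dots> \<le> L1_norm k"
    unfolding L1_norm_def by (rule order_trans[OF integral_norm_bound]) simp
  finally show ?thesis .
qed

text \<open>The transform of the derivative in direction \<open>y\<close> of a function with transform \<open>h\<close>.\<close>

definition directional_symbol :: "'a::euclidean_space \<Rightarrow> ('a \<Rightarrow> complex) \<Rightarrow> 'a \<Rightarrow> complex" where
  "directional_symbol y h \<xi> = \<i> * of_real (y \<bullet> \<xi>) * h \<xi>"

context
  fixes h :: "'a::euclidean_space \<Rightarrow> complex" and R :: real
  assumes h: "integrable lborel h" and supp: "\<And>\<xi>. R < norm \<xi> \<Longrightarrow> h \<xi> = 0"
begin

lemma h_measurable [measurable]: "h \<in> borel_measurable borel" using h by auto

lemma norm_directional_symbol_le: "norm (directional_symbol y h \<xi>) \<le> norm y * \<bar>R\<bar> * norm (h \<xi>)"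
proof (cases "R < norm \<xi>")
  case False
  have "\<bar>y \<bullet> \<xi>\<bar> \<le> norm y * norm \<xi>" by (rule Cauchy_Schwarz_ineq2)
  also have "\<dots> \<le> norm y * \<bar>R\<bar>" using False by (intro mult_left_mono) auto
  finally show ?thesis by (simp add: directional_symbol_def norm_mult mult_right_mono)
qed (simp add: directional_symbol_def supp)

lemma integrable_directional_symbol: "integrable lborel (directional_symbol y h)"
proof -
  have "integrable lborel (\<lambda>\<xi>. complex_of_real (norm y * \<bar>R\<bar>) * h \<xi>)" using h by simp
  then show ?thesis
  proof (rule Bochner_Integration.integrable_bound)
    show "AE \<xi> in lborel. norm (directional_symbol y h \<xi>) \<le> norm (complex_of_real (norm y * \<bar>R\<bar>) * h \<xi>)"
      using norm_directional_symbol_le by (simp add: norm_mult)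
  qed (simp add: directional_symbol_def[abs_def])
qed

lemma directional_symbol_add: "directional_symbol (y + z) h = (\<lambda>\<xi>. directional_symbol y h \<xi> + directional_symbol z h \<xi>)"
  by (simp add: fun_eq_iff directional_symbol_def inner_add_left algebra_simps)

lemma bounded_linear_inv_fourier_directional: "bounded_linear (\<lambda>y. inv_fourier (directional_symbol y h) x)"
proof (rule bounded_linear_intro)
  show "inv_fourier (directional_symbol (y + z) h) x = inv_fourier (directional_symbol y h) x + inv_fourier (directional_symbol z h) x" for y z
    unfolding directional_symbol_add by (rule inv_fourier_add integrable_directional_symbol)+
  show "inv_fourier (directional_symbol (r *\<^sub>R y) h) x = r *\<^sub>R inv_fourier (directional_symbol y h) x" for r y
  proof -
    have "directional_symbol (r *\<^sub>R y) h = (\<lambda>\<xi>. of_real r * directional_symbol y h \<xi>)"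
      by (simp add: fun_eq_iff directional_symbol_def)
    then show ?thesis by (simp add: inv_fourier_cmult scaleR_conv_of_real)
  qed
  show "norm (inv_fourier (directional_symbol y h) x) \<le> norm y * (\<bar>R\<bar> * L1_norm h)" for y
  proof -
    have "norm (inv_fourier (directional_symbol y h) x) \<le> L1_norm (directional_symbol y h)"
      by (rule norm_inv_fourier_le[OF integrable_directional_symbol])
    also have "\<dots> \<le> (LINT \<xi>|lborel. norm y * \<bar>R\<bar> * norm (h \<xi>))"
      unfolding L1_norm_def using h
      by (intro integral_mono integrable_norm integrable_directional_symbol norm_directional_symbol_le) auto
    finally show ?thesis by (simp add: L1_norm_def mult.assoc)
  qed
qed

text \<open>
  Differentiation under the integral sign, made quantitative by the bounded support: the remainder
  \<open>cis a - 1 - \<i> a\<close> is at most \<open>a\<^sup>2\<close>, which gives an error quadratic in \<open>y - x\<close>.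
\<close>

lemma inv_fourier_has_derivative:
  "(inv_fourier h has_derivative (\<lambda>y. inv_fourier (directional_symbol y h) x)) (at x)"
  unfolding has_derivative_at_alt
proof (intro conjI allI impI bounded_linear_inv_fourier_directional)
  fix e :: real assume e: "e > 0"
  define K where "K = R\<^sup>2 * L1_norm h"
  have K: "K \<ge> 0" by (simp add: K_def L1_norm_def)
  have quad: "norm (inv_fourier h y - inv_fourier h x - inv_fourier (directional_symbol (y - x) h) x) \<le> K * (norm (y - x))\<^sup>2" for y
  proof -
    let ?D = "directional_symbol (y - x) h"
    let ?r = "\<lambda>\<xi>. cis ((y - x) \<bullet> \<xi>) * h \<xi> - h \<xi> - ?D \<xi>"
    have i: "integrable lborel (\<lambda>\<xi>. cis (x \<bullet> \<xi>) * (cis ((y - x) \<bullet> \<xi>) * h \<xi>))" "integrable lborel (\<lambda>\<xi>. cis (x \<bullet> \<xi>) * h \<xi>)"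
      "integrable lborel (\<lambda>\<xi>. cis (x \<bullet> \<xi>) * ?D \<xi>)"
      by (intro integrable_modulate h integrable_directional_symbol)+
    have ir: "integrable lborel ?r"
      by (intro Bochner_Integration.integrable_diff integrable_modulate h integrable_directional_symbol)
    have "inv_fourier h y = inv_fourier (\<lambda>\<xi>. cis ((y - x) \<bullet> \<xi>) * h \<xi>) x"
      unfolding inv_fourier_def mult.assoc[symmetric] cis_mult by (simp add: inner_diff_left)
    then have "inv_fourier h y - inv_fourier h x - inv_fourier ?D x = inv_fourier ?r x"
      unfolding inv_fourier_def using i by (simp add: right_diff_distrib diff_divide_distrib)
    then have "norm (inv_fourier h y - inv_fourier h x - inv_fourier ?D x) \<le> L1_norm ?r"
      using norm_inv_fourier_le[OF ir] by simp
    also have "\<dots> \<le> (LINT \<xi>|lborel. (R\<^sup>2 * (norm (y - x))\<^sup>2) * norm (h \<xi>))"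
      unfolding L1_norm_def
    proof (intro integral_mono integrable_norm ir)
      fix \<xi>
      show "norm (?r \<xi>) \<le> (R\<^sup>2 * (norm (y - x))\<^sup>2) * norm (h \<xi>)"
      proof (cases "R < norm \<xi>")
        case False
        have "?r \<xi> = (cis ((y - x) \<bullet> \<xi>) - 1 - \<i> * of_real ((y - x) \<bullet> \<xi>)) * h \<xi>"
          by (simp add: directional_symbol_def algebra_simps)
        then have "norm (?r \<xi>) \<le> ((y - x) \<bullet> \<xi>)\<^sup>2 * norm (h \<xi>)"
          unfolding norm_mult[symmetric] by (simp add: norm_mult mult_right_mono norm_cis_sub_linear)
        also have "((y - x) \<bullet> \<xi>)\<^sup>2 \<le> (norm (y - x) * \<bar>R\<bar>)\<^sup>2"
        proof (rule power2_le_iff_abs_le[THEN iffD2])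
          have "\<bar>(y - x) \<bullet> \<xi>\<bar> \<le> norm (y - x) * norm \<xi>" by (rule Cauchy_Schwarz_ineq2)
          also have "\<dots> \<le> norm (y - x) * \<bar>R\<bar>" using False by (intro mult_left_mono) auto
          finally show "\<bar>(y - x) \<bullet> \<xi>\<bar> \<le> norm (y - x) * \<bar>R\<bar>" .
        qed simp
        finally show ?thesis by (simp add: mult_right_mono power_mult_distrib mult.commute)
      qed (simp add: supp directional_symbol_def)
    qed (use h in auto)
    also have "\<dots> = K * (norm (y - x))\<^sup>2" by (simp add: K_def L1_norm_def)
    finally show ?thesis .
  qed
  show "\<exists>d>0. \<forall>y. norm (y - x) < d \<longrightarrow>
      norm (inv_fourier h y - inv_fourier h x - inv_fourier (directional_symbol (y - x) h) x) \<le> e * norm (y - x)"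
  proof (intro exI[of _ "e / (K + 1)"] conjI allI impI)
    show "e / (K + 1) > 0" using e K by simp
    fix y assume "norm (y - x) < e / (K + 1)"
    then have "(K + 1) * norm (y - x) \<le> e" using K by (simp add: field_simps)
    then have "K * norm (y - x) \<le> e"
      using norm_ge_zero[of "y - x"] unfolding distrib_right by linarith
    then have "K * norm (y - x) * norm (y - x) \<le> e * norm (y - x)" by (rule mult_right_mono) simp
    with quad[of y] show "norm (inv_fourier h y - inv_fourier h x - inv_fourier (directional_symbol (y - x) h) x) \<le> e * norm (y - x)"
      by (simp add: power2_eq_square)
  qed
qed

end

text \<open>
  The real part of \<open>inv_fourier h\<close> is the differentiable representative of \<open>f\<close>. The imaginary
  part is continuous and vanishes almost everywhere, hence everywhere, so that its derivative drops out.
\<close>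

lemma has_spectrum_derivative:
  fixes f :: "real ^ 'n \<Rightarrow> real"
  assumes f: "has_spectrum R f h"
  shows "complex_of_real (partial j f x) = inv_fourier (\<lambda>\<xi>. \<i> * of_real (\<xi> $ j) * h \<xi>) x"
proof -
  note [measurable] = has_spectrumD(1,4)[OF f]
  let ?g = "\<lambda>x. Re (inv_fourier h x)" and ?m = "\<lambda>x. Im (inv_fourier h x)"
  note D = inv_fourier_has_derivative[OF has_spectrumD(2)[OF f] has_spectrumD(5)[OF f]]
  let ?D = "\<lambda>x y. inv_fourier (directional_symbol y h) x"
  have Dg: "(?g has_derivative (\<lambda>y. Re (?D x y))) (at x)" and Dm: "(?m has_derivative (\<lambda>y. Im (?D x y))) (at x)" for x
    using bounded_linear.has_derivative[OF bounded_linear_Re D] bounded_linear.has_derivative[OF bounded_linear_Im D]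
    by auto
  have cg: "continuous_on UNIV ?g" and cm: "continuous_on UNIV ?m"
    using has_derivative_continuous[OF Dg] has_derivative_continuous[OF Dm]
    by (simp_all add: continuous_on_eq_continuous_at)
  have ae: "AE x in lborel. ?g x = f x" "AE x in lborel. ?m x = (\<lambda>_. 0) x"
    using has_spectrumD(6)[OF f] by (eventually_elim, metis Re_complex_of_real, eventually_elim, metis Im_complex_of_real)
  \<comment> \<open>any other differentiable representative agrees with this one almost everywhere, hence everywhere\<close>
  have rep: "differentiable_rep f = ?g"
    unfolding differentiable_rep_def
  proof (rule the_equality)
    show "(\<forall>x. ?g differentiable at x) \<and> (AE x in lborel. ?g x = f x)"
      using Dg ae(1) by (auto intro: differentiableI)
    fix g assume g: "(\<forall>x. g differentiable at x) \<and> (AE x in lborel. g x = f x)"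
    show "g = ?g"
    proof (rule continuous_AE_eq_imp_eq[OF _ cg])
      show "continuous_on UNIV g"
        using g by (simp add: continuous_on_eq_continuous_at differentiable_imp_continuous_within)
      show "AE x in lborel. g x = ?g x" using g ae(1) by (auto elim: eventually_elim2)
    qed
  qed
  have "?m = (\<lambda>_. 0)"
    by (rule continuous_AE_eq_imp_eq[OF cm _ ae(2)]) simp
  with Dm[of x] have "((\<lambda>_. 0) has_derivative (\<lambda>y. Im (?D x y))) (at x)" by simp
  then have "(\<lambda>y. Im (?D x y)) = (\<lambda>_. 0)"
    by (rule has_derivative_unique) (rule has_derivative_const)
  then have "Im (?D x (axis j 1)) = 0" by meson
  moreover have "partial j f x = Re (?D x (axis j 1))"
    unfolding partial_def rep frechet_derivative_at[OF Dg, symmetric] ..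
  ultimately have "complex_of_real (partial j f x) = ?D x (axis j 1)"
    by (simp add: complex_eq_iff)
  also have "directional_symbol (axis j 1) h = (\<lambda>\<xi>. \<i> * of_real (\<xi> $ j) * h \<xi>)"
    by (simp add: fun_eq_iff directional_symbol_def inner_axis')
  finally show ?thesis .
qed

lemma has_spectrum_mult_symbol:
  fixes h :: "'a::euclidean_space \<Rightarrow> complex"
  assumes h: "integrable lborel h" "square_integrable h" and [measurable]: "m \<in> borel_measurable borel"
    and B: "\<And>\<xi>. h \<xi> \<noteq> 0 \<Longrightarrow> norm (m \<xi>) \<le> B"
  shows "integrable lborel (\<lambda>\<xi>. m \<xi> * h \<xi>)" "square_integrable (\<lambda>\<xi>. m \<xi> * h \<xi>)"
proof -
  have [measurable]: "h \<in> borel_measurable borel" using h by auto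
  \<comment> \<open>the symbol is bounded only where \<open>h\<close> lives; elsewhere it may be set to zero\<close>
  let ?m = "\<lambda>\<xi>. if h \<xi> = 0 then 0 else m \<xi>"
  have eq: "(\<lambda>\<xi>. m \<xi> * h \<xi>) = (\<lambda>\<xi>. ?m \<xi> * h \<xi>)" by auto
  have mB: "norm (?m \<xi>) \<le> \<bar>B\<bar>" for \<xi> using B[of \<xi>] by auto
  show "square_integrable (\<lambda>\<xi>. m \<xi> * h \<xi>)"
    unfolding eq by (rule square_integrable_mult_bounded[OF h(2) _ mB]) measurable
  have "integrable lborel (\<lambda>\<xi>. complex_of_real \<bar>B\<bar> * h \<xi>)" using h by simp
  then show "integrable lborel (\<lambda>\<xi>. m \<xi> * h \<xi>)"
    unfolding eq by (rule Bochner_Integration.integrable_bound)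
      (auto simp: norm_mult intro!: mult_right_mono order_trans[OF B abs_ge_self])
qed

lemma has_spectrum_partial:
  fixes f :: "real ^ 'n \<Rightarrow> real"
  assumes f: "has_spectrum R f h"
  shows "has_spectrum R (partial j f) (\<lambda>\<xi>. \<i> * of_real (\<xi> $ j) * h \<xi>)"
proof -
  let ?h = "\<lambda>\<xi>. (\<i> * of_real (\<xi> $ j)) * h \<xi>"
  have [measurable]: "h \<in> borel_measurable borel" by (rule has_spectrumD(4)[OF f])
  have [measurable]: "(\<lambda>\<xi>::real^'n. \<xi> $ j) \<in> borel_measurable borel"
    by (intro borel_measurable_continuous_onI continuous_intros)
  have bound: "norm (\<i> * complex_of_real (\<xi> $ j)) \<le> R" if "h \<xi> \<noteq> 0" for \<xi>
  proof -
    have "norm \<xi> \<le> R" using has_spectrumD(5)[OF f, of \<xi>] that by force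
    then show ?thesis
      using component_le_norm_cart[of \<xi> j] by (simp add: norm_mult)
  qed
  have 1: "integrable lborel ?h" "square_integrable ?h"
    by (rule has_spectrum_mult_symbol[OF has_spectrumD(2,3)[OF f] _ bound]; measurable)+
  have "(\<lambda>x. complex_of_real (partial j f x)) \<in> borel_measurable borel"
    unfolding has_spectrum_derivative[OF f] using 1 by (intro inv_fourier_measurable) auto
  from measurable_compose[OF this borel_measurable_Re] have "partial j f \<in> borel_measurable borel" by simp
  then show ?thesis
    unfolding has_spectrum_def using 1 has_spectrumD(5)[OF f] has_spectrum_derivative[OF f] by simp
qed

section \<open>The Leray projection of a band-limited vertical field\<close>

text \<open>The function \<open>cnj (h (- \<xi>))\<close> has the conjugate of \<open>inv_fourier h\<close> as its inverse transform, and the latter is real.\<close>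

lemma hermitian_spectrum:
  fixes f :: "'a::euclidean_space \<Rightarrow> real"
  assumes f: "has_spectrum R f h"
  shows "AE \<xi> in lborel. cnj (h (- \<xi>)) = h \<xi>"
proof -
  note [measurable] = has_spectrumD(1,4)[OF f]
  let ?k = "\<lambda>\<xi>. cnj (h (- \<xi>))"
  have k: "integrable lborel ?k"
    using integrable_reflect[OF has_spectrumD(2)[OF f], of 0] by simp
  have "L2sq ?k = L2sq h"
    unfolding L2sq_def using nn_integral_reflect[of "\<lambda>x. ennreal ((norm (h x))\<^sup>2)" 0] by simp
  then have k2: "square_integrable ?k"
    using has_spectrumD(3)[OF f] k by (simp add: square_integrable_iff borel_measurable_integrable[OF k, simplified])
  have inv: "inv_fourier ?k x = cnj (inv_fourier h x)" for x
  proof -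
    have "(LINT \<xi>|lborel. cis (x \<bullet> \<xi>) * ?k \<xi>) = (LINT \<xi>|lborel. cnj (cis (x \<bullet> (0 - \<xi>)) * h (0 - \<xi>)))"
      by (simp add: cis_cnj)
    also have "\<dots> = cnj (LINT \<xi>|lborel. cis (x \<bullet> (0 - \<xi>)) * h (0 - \<xi>))"
      by (rule Bochner_Integration.integral_cnj)
    also have "(LINT \<xi>|lborel. cis (x \<bullet> (0 - \<xi>)) * h (0 - \<xi>)) = (LINT \<xi>|lborel. cis (x \<bullet> \<xi>) * h \<xi>)"
      by (rule integral_reflect[of "\<lambda>\<xi>. cis (x \<bullet> \<xi>) * h \<xi>"]) measurable
    finally show ?thesis by (simp add: inv_fourier_def)
  qed
  have "AE x in lborel. inv_fourier ?k x = inv_fourier h x"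
    using has_spectrumD(6)[OF f] by eventually_elim (metis inv complex_cnj_complex_of_real)
  from has_fourier_L2_unique[OF has_fourier_L2_inv_fourier[OF k k2] has_fourier_L2_inv_fourier[OF has_spectrumD(2,3)[OF f]] this]
  show ?thesis .
qed

text \<open>An even real multiplier preserves the Hermitian symmetry of the spectrum, hence reality.\<close>

lemma even_multiplier_has_spectrum:
  fixes f :: "'a::euclidean_space \<Rightarrow> real" and m :: "'a \<Rightarrow> real"
  assumes f: "has_spectrum R f h" and [measurable]: "m \<in> borel_measurable borel"
    and even: "\<And>\<xi>. m (- \<xi>) = m \<xi>" and B: "\<And>\<xi>. \<bar>m \<xi>\<bar> \<le> B"
  shows "has_spectrum R (\<lambda>x. Re (inv_fourier (\<lambda>\<xi>. of_real (m \<xi>) * h \<xi>) x)) (\<lambda>\<xi>. of_real (m \<xi>) * h \<xi>)"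
proof -
  note [measurable] = has_spectrumD(1,4)[OF f]
  let ?h = "\<lambda>\<xi>. complex_of_real (m \<xi>) * h \<xi>"
  have 1: "integrable lborel ?h" "square_integrable ?h"
    by (rule has_spectrum_mult_symbol[OF has_spectrumD(2,3)[OF f], of _ B]; use B in simp)+
  have "cnj (inv_fourier ?h x) = inv_fourier ?h x" for x
  proof -
    have "cnj (LINT \<xi>|lborel. cis (x \<bullet> \<xi>) * ?h \<xi>) = (LINT \<xi>|lborel. cnj (cis (x \<bullet> \<xi>) * ?h \<xi>))"
      by (rule Bochner_Integration.integral_cnj[symmetric])
    also have "\<dots> = (LINT \<xi>|lborel. cnj (cis (x \<bullet> (0 - \<xi>)) * ?h (0 - \<xi>)))"
      by (rule integral_reflect[of "\<lambda>\<xi>. cnj (cis (x \<bullet> \<xi>) * ?h \<xi>)" 0, symmetric]) measurable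
    also have "\<dots> = (LINT \<xi>|lborel. cis (x \<bullet> \<xi>) * ?h \<xi>)"
    proof (rule integral_cong_AE)
      show "AE \<xi> in lborel. cnj (cis (x \<bullet> (0 - \<xi>)) * ?h (0 - \<xi>)) = cis (x \<bullet> \<xi>) * ?h \<xi>"
        using hermitian_spectrum[OF f] by eventually_elim (simp add: cis_cnj even)
    qed measurable
    finally show ?thesis by (simp add: inv_fourier_def)
  qed
  then have "complex_of_real (Re (inv_fourier ?h x)) = inv_fourier ?h x" for x
    by (simp add: complex_eq_iff Reals_cnj_iff[symmetric] complex_is_Real_iff)
  moreover have "(\<lambda>x. Re (inv_fourier ?h x)) \<in> borel_measurable borel" by measurable
  ultimately show ?thesis
    unfolding has_spectrum_def using 1 has_spectrumD(5)[OF f] by simp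
qed

definition leray_symbol :: "'n \<Rightarrow> 'n \<Rightarrow> real ^ 'n \<Rightarrow> real" where
  "leray_symbol d i \<xi> = (if i = d then 1 else 0) - \<xi> $ i * \<xi> $ d / (norm \<xi>)\<^sup>2"

lemma leray_symbol_measurable [measurable]: "leray_symbol d i \<in> borel_measurable borel"
proof -
  have [measurable]: "(\<lambda>\<xi>::real^'a. \<xi> $ j) \<in> borel_measurable borel" for j
    by (intro borel_measurable_continuous_onI continuous_intros)
  show ?thesis unfolding leray_symbol_def by measurable
qed

lemma leray_symbol_bound: "\<bar>leray_symbol d i \<xi>\<bar> \<le> 2"
proof -
  have "\<bar>\<xi> $ i * \<xi> $ d\<bar> \<le> norm \<xi> * norm \<xi>"
    unfolding abs_mult by (intro mult_mono component_le_norm_cart) auto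
  then have "\<bar>\<xi> $ i * \<xi> $ d / (norm \<xi>)\<^sup>2\<bar> \<le> 1"
    by (simp add: divide_le_eq power2_eq_square)
  then show ?thesis
    unfolding leray_symbol_def by (cases "i = d"; simp only: if_True if_False simp_thms; linarith)
qed

text \<open>
  The function \<open>leray\<close> selects some field with the prescribed transform. Taking real parts of inverse
  transforms exhibits such a field, and the inversion theorem then determines the
  selected one up to null sets.
\<close>

theorem leray_vertical_has_spectrum:
  fixes a :: "real ^ 'n \<Rightarrow> real"
  assumes a: "has_spectrum R a h"
  shows "has_spectrum R (\<lambda>x. leray (\<lambda>y. a y *\<^sub>R axis d 1) x $ i) (\<lambda>\<xi>. of_real (leray_symbol d i \<xi>) * h \<xi>)"
proof -
  note [measurable] = has_spectrumD(1,4)[OF a]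
  let ?h = "\<lambda>i \<xi>. complex_of_real (leray_symbol d i \<xi>) * h \<xi>"
  let ?w = "\<lambda>y. a y *\<^sub>R (axis d 1 :: real ^ 'n)"
  let ?S = "\<lambda>i \<xi>. \<Sum>j\<in>UNIV. complex_of_real ((if i = j then 1 else 0) - \<xi> $ i * \<xi> $ j / (norm \<xi>)\<^sup>2)
                     * fourier (\<lambda>x. ?w x $ j) \<xi>"
  let ?P = "\<lambda>v. square_integrable v \<and> (\<forall>i. AE \<xi> in lborel. fourier (\<lambda>x. v x $ i) \<xi> =
        ?S i \<xi>)"
  have w: "AE \<xi> in lborel. fourier (\<lambda>x. ?w x $ j) \<xi> = (if j = d then h \<xi> else 0)" for j
  proof (cases "j = d")
    case True
    then show ?thesis using has_spectrum_fourier[OF a] by simp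
  next
    case False
    then have "(\<lambda>x. ?w x $ j) = (\<lambda>_. 0)" by (simp add: fun_eq_iff axis_def)
    then show ?thesis using has_spectrum_fourier[OF has_spectrum_zero] False by simp
  qed
  then have "AE \<xi> in lborel. \<forall>j. fourier (\<lambda>x. ?w x $ j) \<xi> = (if j = d then h \<xi> else 0)"
    by (simp add: AE_all_countable)
  then have rhs: "AE \<xi> in lborel. ?S i \<xi> = ?h i \<xi>" for i
  proof eventually_elim
    fix \<xi> assume *: "\<forall>j. fourier (\<lambda>x. ?w x $ j) \<xi> = (if j = d then h \<xi> else 0)"
    have "?S i \<xi>
        = (\<Sum>j\<in>UNIV. if j = d then ?h i \<xi> else 0)"
      unfolding *[rule_format] by (intro sum.cong refl) (auto simp: leray_symbol_def)
    then show "?S i \<xi> = ?h i \<xi>" by simp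
  qed
  define v where "v x = (\<chi> i. Re (inv_fourier (?h i) x))" for x
  have vi: "has_spectrum R (\<lambda>x. v x $ i) (?h i)" for i
    unfolding v_def vec_lambda_beta
    by (rule even_multiplier_has_spectrum[OF a _ _ leray_symbol_bound]) (simp_all add: leray_symbol_def)
  have "v \<in> borel_measurable borel"
    unfolding borel_measurable_euclidean_space[of v]
    using has_spectrumD(1)[OF vi] by (auto simp: Basis_vec_def inner_axis)
  moreover have "integrable lborel (\<lambda>x. \<Sum>i\<in>UNIV. (v x $ i)\<^sup>2)"
    using has_spectrum_square_integrable[OF vi] by (auto simp: square_integrable_def)
  ultimately have "square_integrable v"
    by (simp add: square_integrable_def norm_vec_def L2_set_def sum_nonneg)
  moreover have "AE \<xi> in lborel. fourier (\<lambda>x. v x $ i) \<xi> =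
        ?S i \<xi>" for i
    using has_spectrum_fourier[OF vi[of i]] rhs[of i] by eventually_elim (simp only:)
  ultimately have "?P v" by blast
  then have P: "?P (leray ?w)"
    unfolding leray_def by (rule someI[of ?P])
  show ?thesis
  proof (rule has_spectrumI_fourier)
    have m: "leray ?w \<in> borel_measurable borel" and i2: "integrable lborel (\<lambda>x. (norm (leray ?w x))\<^sup>2)"
      using P by (auto simp: square_integrable_def)
    have "(\<lambda>x. leray ?w x \<bullet> axis i 1) \<in> borel_measurable borel"
      using m by (intro borel_measurable_inner) auto
    then have mi[measurable]: "(\<lambda>x. leray ?w x $ i) \<in> borel_measurable borel" by (simp add: inner_axis)
    have "integrable lborel (\<lambda>x. (norm (leray ?w x $ i))\<^sup>2)"
    proof (rule Bochner_Integration.integrable_bound[OF i2])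
      show "AE x in lborel. norm ((norm (leray ?w x $ i))\<^sup>2) \<le> norm ((norm (leray ?w x))\<^sup>2)"
        by (intro AE_I2) (simp add: component_le_norm_cart flip: abs_le_square_iff)
    qed measurable
    then show "square_integrable (\<lambda>x. leray ?w x $ i)" using mi by (simp add: square_integrable_def)
    show "AE \<xi> in lborel. fourier (\<lambda>x. leray ?w x $ i) \<xi> = ?h i \<xi>"
      using conjunct2[OF P, rule_format, of i] rhs[of i] by eventually_elim (simp only:)
  qed (use has_spectrumD(2,5)[OF vi] in auto)
qed

lemma Linf_norm_le:
  fixes u :: "real ^ 'm \<Rightarrow> real ^ 'k"
  assumes "u \<in> borel_measurable borel" "\<And>i. AE x in lborel. \<bar>u x $ i\<bar> \<le> B"
  shows "Linf_norm u \<le> ennreal (real CARD('k) * B)"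
  unfolding Linf_norm_def
proof (rule esssup_I)
  have "AE x in lborel. \<forall>i. \<bar>u x $ i\<bar> \<le> B" using assms(2) by (simp add: AE_all_countable)
  then show "AE x in lborel. ennreal (norm (u x)) \<le> ennreal (real CARD('k) * B)"
  proof eventually_elim
    fix x assume "\<forall>i. \<bar>u x $ i\<bar> \<le> B"
    then have "(\<Sum>i\<in>UNIV. \<bar>u x $ i\<bar>) \<le> (\<Sum>i\<in>(UNIV::'k set). B)" by (intro sum_mono) auto
    then show "ennreal (norm (u x)) \<le> ennreal (real CARD('k) * B)"
      using norm_le_l1_cart[of "u x"] by (intro ennreal_leI) simp
  qed
qed (use assms in auto)

lemma has_spectrum_AE_bound:
  assumes "has_spectrum R f h"
  shows "AE x in lborel. \<bar>f x\<bar> \<le> L1_norm h"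
  using has_spectrumD(6)[OF assms]
proof eventually_elim
  fix x assume "complex_of_real (f x) = inv_fourier h x"
  then have "\<bar>f x\<bar> = norm (inv_fourier h x)" by (metis norm_of_real)
  then show "\<bar>f x\<bar> \<le> L1_norm h"
    using norm_inv_fourier_le[OF has_spectrumD(2)[OF assms]] by simp
qed

section \<open>Time decay\<close>

text \<open>\<open>\<rho>\<close> is a difference quotient of \<open>c \<mapsto> - e\<^sup>-\<^sup>c\<^sup>t\<close>, so its size follows from \<open>1 + x \<le> e\<^sup>x\<close>.\<close>

lemma bous_rho_bounds:
  assumes "\<nu> > 0" "lam > 0" "t \<ge> 0"
  shows "0 \<le> bous_rho \<nu> lam t" "bous_rho \<nu> lam t \<le> t * exp (- min \<nu> lam * t)"
proof -
  have *: "0 \<le> (exp (- a * t) - exp (- b * t)) / (b - a) \<and> (exp (- a * t) - exp (- b * t)) / (b - a) \<le> t * exp (- a * t)"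
    if "a < b" for a b :: real
  proof -
    have "exp (- b * t) = exp (- a * t) * exp (- (b - a) * t)"
      by (simp add: exp_add[symmetric] algebra_simps)
    also have "\<dots> \<ge> exp (- a * t) * (1 + - (b - a) * t)"
      by (intro mult_left_mono exp_ge_add_one_self) auto
    finally have "exp (- a * t) - exp (- b * t) \<le> t * exp (- a * t) * (b - a)"
      by (simp add: algebra_simps)
    moreover have "exp (- b * t) \<le> exp (- a * t)" using that assms by (simp add: mult_right_mono)
    ultimately show ?thesis using that by (simp add: divide_le_eq)
  qed
  have "0 \<le> bous_rho \<nu> lam t \<and> bous_rho \<nu> lam t \<le> t * exp (- min \<nu> lam * t)"
  proof (cases \<nu> lam rule: linorder_cases)
    case less
    have "bous_rho \<nu> lam t = (exp (- \<nu> * t) - exp (- lam * t)) / (lam - \<nu>)"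
      using less by (simp add: bous_rho_def field_simps)
    then show ?thesis using *[OF less] less by (simp add: min_def)
  next
    case equal
    then show ?thesis using assms by (simp add: bous_rho_def)
  next
    case greater
    then show ?thesis using *[OF greater] by (simp add: bous_rho_def min_def)
  qed
  then show "0 \<le> bous_rho \<nu> lam t" "bous_rho \<nu> lam t \<le> t * exp (- min \<nu> lam * t)" by auto
qed

text \<open>
  A common majorant of \<open>e\<^sup>-\<^sup>\<nu>\<^sup>t\<close>, \<open>e\<^sup>-\<^sup>\<lambda>\<^sup>t\<close> and \<open>\<rho>(t)\<close> for \<open>\<mu> = min \<nu> \<lambda>\<close>: half of the decay rate is spent on
  absorbing the factor \<open>t\<close> in \<open>\<rho>(t) \<le> t e\<^sup>-\<^sup>\<mu>\<^sup>t\<close>.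
\<close>

definition envelope :: "real \<Rightarrow> real \<Rightarrow> real" where
  "envelope \<mu> t = (1 + 2 / \<mu>) * exp (- (\<mu> / 2) * t)"

lemma envelope_bounds:
  assumes \<nu>: "\<nu> > 0" "lam > 0" and t: "t \<ge> 0"
  defines "\<mu> \<equiv> min \<nu> lam"
  shows "exp (- \<nu> * t) \<le> envelope \<mu> t" "exp (- lam * t) \<le> envelope \<mu> t" "\<bar>bous_rho \<nu> lam t\<bar> \<le> envelope \<mu> t"
    "envelope \<mu> t \<ge> 0"
proof -
  have \<mu>: "\<mu> > 0" "\<mu> \<le> \<nu>" "\<mu> \<le> lam" using \<nu> by (auto simp: \<mu>_def)
  have *: "exp (- a * t) \<le> envelope \<mu> t" if "\<mu> \<le> a" for a
  proof -
    have "\<mu> / 2 * t \<le> a * t" using that \<mu> t by (intro mult_right_mono) auto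
    then have "1 * exp (- a * t) \<le> (1 + 2 / \<mu>) * exp (- (\<mu> / 2) * t)" using \<mu> by (intro mult_mono) auto
    then show ?thesis by (simp add: envelope_def)
  qed
  show "exp (- \<nu> * t) \<le> envelope \<mu> t" "exp (- lam * t) \<le> envelope \<mu> t" using * \<mu> by auto
  have "\<mu> / 2 * t \<le> exp (\<mu> / 2 * t)"
    using exp_ge_add_one_self[of "\<mu> / 2 * t"] by linarith
  then have "t \<le> 2 / \<mu> * exp (\<mu> / 2 * t)" using \<mu> by (simp add: field_simps)
  then have "t * exp (- \<mu> * t) \<le> 2 / \<mu> * exp (\<mu> / 2 * t) * exp (- \<mu> * t)"
    by (rule mult_right_mono) simp
  also have "\<dots> = 2 / \<mu> * exp (- (\<mu> / 2) * t)"
    by (simp add: exp_add[symmetric] field_simps)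
  also have "\<dots> \<le> envelope \<mu> t"
    unfolding envelope_def using \<mu> by (intro mult_right_mono) auto
  finally show "\<bar>bous_rho \<nu> lam t\<bar> \<le> envelope \<mu> t"
    using bous_rho_bounds[OF \<nu> t] by (simp add: \<mu>_def)
  show "envelope \<mu> t \<ge> 0" using \<mu> by (simp add: envelope_def)
qed

lemma nn_integral_exp_decay:
  assumes \<mu>: "\<mu> > 0" and c: "c \<ge> 0"
  shows "(\<integral>\<^sup>+ t\<in>{0..}. ennreal (c * exp (- \<mu> * t)) \<partial>lborel) = ennreal (c / \<mu>)"
proof -
  interpret prob_space "density lborel (exponential_density \<mu>)"
    using \<mu> by (rule prob_space_exponential_density)
  have "(\<integral>\<^sup>+ t. ennreal (exponential_density \<mu> t) \<partial>lborel) = 1"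
    using emeasure_space_1 by (simp add: emeasure_density)
  moreover have "ennreal (c * exp (- \<mu> * t)) * indicator {0..} t = ennreal (c / \<mu>) * ennreal (exponential_density \<mu> t)" for t
    using \<mu> c by (auto simp: exponential_density_def indicator_def ennreal_mult[symmetric] mult.commute)
  ultimately show ?thesis by (simp add: nn_integral_cmult)
qed

section \<open>The nonlinear terms\<close>

text \<open>
  The transforms of \<open>u\<^sub>j\<close> and \<open>\<partial>\<^sub>j f\<close> are multiples of the same \<open>g\<close>, so the bilinear symbol factors
  into \<open>\<i> \<tau>(\<eta>)\<close> and \<open>\<Sum> \<upsilon>\<^sub>j(\<xi>) \<eta>\<^sub>j\<close>. The bound \<open>A\<close> on the latter is where the smallness
  of the data enters.
\<close>

lemma advect_sobolev_bound:
  fixes u :: "real ^ 'n \<Rightarrow> real ^ 'n" and f :: "real ^ 'n \<Rightarrow> real"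
  assumes u: "\<And>j. has_spectrum R (\<lambda>x. u x $ j) (\<lambda>\<xi>. \<upsilon> j \<xi> * g \<xi>)"
    and f: "has_spectrum R f (\<lambda>\<xi>. \<tau> \<xi> * g \<xi>)"
    and g: "integrable lborel g" "L2sq g \<le> ennreal (N\<^sup>2)" and N: "N \<ge> 0"
    and A: "\<And>\<xi> \<eta>. g \<xi> \<noteq> 0 \<Longrightarrow> g \<eta> \<noteq> 0 \<Longrightarrow> norm (\<Sum>j\<in>UNIV. \<upsilon> j \<xi> * of_real (\<eta> $ j)) \<le> A"
    and B: "\<And>\<eta>. g \<eta> \<noteq> 0 \<Longrightarrow> norm (\<tau> \<eta>) \<le> B" and AB: "A \<ge> 0" "B \<ge> 0"
  shows "sobolev_norm 3 (advect u f) \<le> ennreal (sqrt ((1 + (2 * R)\<^sup>2) powr 3) * (A * B * L1_norm g * N))"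
proof (rule sobolev_norm_le)
  let ?p = "\<lambda>j \<xi>. \<upsilon> j \<xi> * g \<xi>" and ?q = "\<lambda>j \<eta>. \<i> * of_real (\<eta> $ j) * (\<tau> \<eta> * g \<eta>)"
  have [measurable]: "g \<in> borel_measurable borel" using g by auto
  note q = has_spectrum_partial[OF f]
  show "has_spectrum (2 * R) (advect u f) (\<lambda>\<xi>. \<Sum>j\<in>UNIV. spectral_product (?p j) (?q j) \<xi>)"
    unfolding advect_def[abs_def] by (intro has_spectrum_sum has_spectrum_mult u q) auto
  have "L2sq (\<lambda>\<xi>. \<Sum>j\<in>UNIV. spectral_product (?p j) (?q j) \<xi>) \<le> ennreal ((L1_norm (\<lambda>\<xi>. A * B * norm (g \<xi>)))\<^sup>2) * L2sq g"
  proof (rule spectral_product_sum_L2_bound)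
    fix \<xi> \<eta>
    have "(\<Sum>j\<in>UNIV. ?p j \<xi> * ?q j \<eta>) = (\<Sum>j\<in>UNIV. \<upsilon> j \<xi> * of_real (\<eta> $ j)) * (\<i> * \<tau> \<eta> * (g \<xi> * g \<eta>))"
      unfolding sum_distrib_right by (intro sum.cong refl) (simp add: mult_ac)
    then have eq: "norm (\<Sum>j\<in>UNIV. ?p j \<xi> * ?q j \<eta>) = norm (\<Sum>j\<in>UNIV. \<upsilon> j \<xi> * of_real (\<eta> $ j)) * norm (\<tau> \<eta>) * (norm (g \<xi>) * norm (g \<eta>))"
      by (simp add: norm_mult mult_ac)
    show "norm (\<Sum>j\<in>UNIV. ?p j \<xi> * ?q j \<eta>) \<le> A * B * norm (g \<xi>) * norm (g \<eta>)"
    proof (cases "g \<xi> = 0 \<or> g \<eta> = 0")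
      case False
      then show ?thesis
        unfolding eq mult.assoc[of "A * B"] using A[of \<xi> \<eta>] B[of \<eta>] AB by (intro mult_mono) auto
    qed (auto simp: eq)
  qed (use has_spectrumD(2)[OF u] has_spectrumD(2)[OF q] g AB in auto)
  also have "L1_norm (\<lambda>\<xi>. A * B * norm (g \<xi>)) = A * B * L1_norm g"
    using AB by (simp add: L1_norm_def)
  also have "ennreal ((A * B * L1_norm g)\<^sup>2) * L2sq g \<le> ennreal ((A * B * L1_norm g)\<^sup>2) * ennreal (N\<^sup>2)"
    by (intro mult_left_mono g) auto
  also have "\<dots> = ennreal ((A * B * L1_norm g * N)\<^sup>2)"
    by (simp add: ennreal_mult[symmetric] power_mult_distrib)
  finally show "L2sq (\<lambda>\<xi>. \<Sum>j\<in>UNIV. spectral_product (?p j) (?q j) \<xi>) \<le> ennreal ((A * B * L1_norm g * N)\<^sup>2)" .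
  show "0 \<le> A * B * L1_norm g * N" using AB N by (simp add: L1_norm_def)
qed simp

lemma sobolev_norm_vec_le:
  fixes v :: "'a::euclidean_space \<Rightarrow> real ^ 'm"
  assumes "\<And>i. sobolev_norm s (\<lambda>x. v x $ i) \<le> ennreal b" and b: "b \<ge> 0"
  shows "sobolev_norm_vec s v \<le> ennreal (real CARD('m) * b)"
proof -
  have "(\<Sum>i\<in>UNIV. (sobolev_norm s (\<lambda>x. v x $ i))\<^sup>2) \<le> (\<Sum>i\<in>(UNIV :: 'm set). (ennreal b)\<^sup>2)"
    by (intro sum_mono power_mono assms) auto
  also have "\<dots> = ennreal (real CARD('m) * b\<^sup>2)"
    using b by (simp add: ennreal_power ennreal_mult ennreal_of_nat_eq_real_of_nat)
  also have "\<dots> \<le> ennreal ((real CARD('m) * b)\<^sup>2)"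
  proof (intro ennreal_leI)
    have "real CARD('m) \<le> (real CARD('m))\<^sup>2" by (intro self_le_power) (auto simp: Suc_le_eq)
    then show "real CARD('m) * b\<^sup>2 \<le> (real CARD('m) * b)\<^sup>2"
      unfolding power_mult_distrib by (rule mult_right_mono) simp
  qed
  finally have "sobolev_norm_vec s v \<le> ennreal_sqrt (ennreal ((real CARD('m) * b)\<^sup>2))"
    unfolding sobolev_norm_vec_def by (rule ennreal_sqrt_mono)
  then show ?thesis using b by (simp add: ennreal_sqrt_ennreal)
qed

text \<open>
  The summand \<open>1\<close> in \<open>n + 1\<close> accounts for the temperature, \<open>2 * (R + 2)\<close> for the two symbol bounds, and
  \<open>(1 + 2 / \<mu>)\<^sup>2 / \<mu>\<close> is the integral of the squared envelope.
\<close>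

definition E_const :: "real \<Rightarrow> real \<Rightarrow> nat \<Rightarrow> real" where
  "E_const R \<mu> n = (real n + 1) * (sqrt ((1 + (2 * R)\<^sup>2) powr 3) * (2 * (R + 2))) * (1 + 2 / \<mu>)\<^sup>2 / \<mu>"

definition F_const :: "real \<Rightarrow> real \<Rightarrow> nat \<Rightarrow> real" where
  "F_const R \<mu> n = (real n + 1) * (R + 2) * (1 + 2 / \<mu>) / (\<mu> / 2)"

lemma E_F_const_nonneg: "R \<ge> 0 \<Longrightarrow> \<mu> > 0 \<Longrightarrow> 0 \<le> E_const R \<mu> n" "R \<ge> 0 \<Longrightarrow> \<mu> > 0 \<Longrightarrow> 0 \<le> F_const R \<mu> n"
  by (auto simp: E_const_def F_const_def)

text \<open>
  At time \<open>t\<close> the velocity has the symbol \<open>e\<^sup>-\<^sup>\<nu>\<^sup>t \<sigma>\<^sub>j + \<rho>(t) m\<^sub>j\<close>, with \<open>m\<close> the Leray symbol. Both parts are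
  bounded and have products with \<open>\<eta>\<close> of size \<open>D\<close>; the nonlinear terms are quadratic in the envelope
  and linear in \<open>D\<close>.
\<close>

lemma E_F_zero_bounds:
  fixes U0 :: "real ^ 'n \<Rightarrow> real ^ 'n" and a0 :: "real ^ 'n \<Rightarrow> real"
  assumes \<nu>: "\<nu> > 0" "lam > 0" and a: "has_spectrum R a0 g"
    and U0: "\<And>j. has_spectrum R (\<lambda>x. U0 x $ j) (\<lambda>\<xi>. \<sigma> j \<xi> * g \<xi>)"
    and R: "R \<ge> 0" and \<sigma>R: "\<And>j \<xi>. g \<xi> \<noteq> 0 \<Longrightarrow> norm (\<sigma> j \<xi>) \<le> R"
    and D: "D \<ge> 0" "\<And>\<xi> \<eta>. g \<xi> \<noteq> 0 \<Longrightarrow> g \<eta> \<noteq> 0 \<Longrightarrow> norm (\<Sum>j\<in>UNIV. \<sigma> j \<xi> * of_real (\<eta> $ j)) \<le> D"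
      "\<And>\<xi> \<eta>. g \<xi> \<noteq> 0 \<Longrightarrow> g \<eta> \<noteq> 0 \<Longrightarrow> \<bar>\<Sum>j\<in>UNIV. leray_symbol d j \<xi> * \<eta> $ j\<bar> \<le> D"
    and N: "L2sq g \<le> ennreal (N\<^sup>2)" "N \<ge> 0"
  defines "\<mu> \<equiv> min \<nu> lam"
  shows "E_zero \<nu> lam d U0 a0 \<le> ennreal (E_const R \<mu> CARD('n) * D * L1_norm g * N)"
    and "F_zero \<nu> lam d U0 a0 \<le> ennreal (F_const R \<mu> CARD('n) * L1_norm g)"
proof -
  let ?n = "real CARD('n)"
  let ?U = "bous_U \<nu> lam d U0 a0" and ?\<Theta> = "bous_Theta lam a0"
  let ?W = "sqrt ((1 + (2 * R)\<^sup>2) powr 3)"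
  have \<mu>: "\<mu> > 0" using \<nu> by (simp add: \<mu>_def)
  note gi = has_spectrumD(2)[OF a]
  have [measurable]: "g \<in> borel_measurable borel" using gi by auto
  have g0: "L1_norm g \<ge> 0" by (simp add: L1_norm_def)
  define \<upsilon> where "\<upsilon> t j \<xi> = of_real (exp (- \<nu> * t)) * \<sigma> j \<xi> + of_real (bous_rho \<nu> lam t * leray_symbol d j \<xi>)" for t j \<xi>
  have U: "has_spectrum R (\<lambda>x. ?U t x $ j) (\<lambda>\<xi>. \<upsilon> t j \<xi> * g \<xi>)" for t j
  proof -
    have "has_spectrum R (\<lambda>x. exp (- \<nu> * t) * U0 x $ j + bous_rho \<nu> lam t * leray (\<lambda>y. a0 y *\<^sub>R axis d 1) x $ j)
      (\<lambda>\<xi>. of_real (exp (- \<nu> * t)) * (\<sigma> j \<xi> * g \<xi>) + of_real (bous_rho \<nu> lam t) * (of_real (leray_symbol d j \<xi>) * g \<xi>))"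
      by (intro has_spectrum_add has_spectrum_cmult U0 leray_vertical_has_spectrum a)
    then show ?thesis by (simp add: bous_U_def \<upsilon>_def distrib_right mult.assoc)
  qed
  have \<Theta>: "has_spectrum R (?\<Theta> t) (\<lambda>\<xi>. of_real (exp (- lam * t)) * g \<xi>)" for t
    using has_spectrum_cmult[OF a, of "exp (- lam * t)"] by (simp add: bous_Theta_def[abs_def])
  have \<upsilon>_bound: "norm (\<upsilon> t j \<xi>) \<le> envelope \<mu> t * (R + 2)"
    and \<upsilon>_cancel: "g \<eta> \<noteq> 0 \<Longrightarrow> norm (\<Sum>j\<in>UNIV. \<upsilon> t j \<xi> * of_real (\<eta> $ j)) \<le> 2 * envelope \<mu> t * D"
    if t: "t \<ge> 0" and g: "g \<xi> \<noteq> 0" for t j \<xi> \<eta>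
  proof -
    note s = envelope_bounds[OF \<nu> t, folded \<mu>_def]
    have "norm (\<upsilon> t j \<xi>) \<le> exp (- \<nu> * t) * norm (\<sigma> j \<xi>) + \<bar>bous_rho \<nu> lam t\<bar> * \<bar>leray_symbol d j \<xi>\<bar>"
      unfolding \<upsilon>_def by (rule order_trans[OF norm_triangle_ineq]) (simp add: norm_mult abs_mult)
    also have "\<dots> \<le> envelope \<mu> t * R + envelope \<mu> t * 2"
      using s \<sigma>R[OF g] by (intro add_mono mult_mono leray_symbol_bound) auto
    finally show "norm (\<upsilon> t j \<xi>) \<le> envelope \<mu> t * (R + 2)" by (simp add: distrib_left)
    assume \<eta>: "g \<eta> \<noteq> 0"
    have "(\<Sum>j\<in>UNIV. \<upsilon> t j \<xi> * of_real (\<eta> $ j)) = of_real (exp (- \<nu> * t)) * (\<Sum>j\<in>UNIV. \<sigma> j \<xi> * of_real (\<eta> $ j))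
       + of_real (bous_rho \<nu> lam t * (\<Sum>j\<in>UNIV. leray_symbol d j \<xi> * \<eta> $ j))"
      unfolding \<upsilon>_def by (simp add: distrib_right sum.distrib sum_distrib_left mult.assoc)
    then have "norm (\<Sum>j\<in>UNIV. \<upsilon> t j \<xi> * of_real (\<eta> $ j)) \<le> exp (- \<nu> * t) * norm (\<Sum>j\<in>UNIV. \<sigma> j \<xi> * of_real (\<eta> $ j))
       + \<bar>bous_rho \<nu> lam t\<bar> * \<bar>\<Sum>j\<in>UNIV. leray_symbol d j \<xi> * \<eta> $ j\<bar>"
      by (simp only:) (rule order_trans[OF norm_triangle_ineq], simp add: norm_mult abs_mult del: of_real_sum)
    also have "\<dots> \<le> envelope \<mu> t * D + envelope \<mu> t * D"
      using s D(2,3)[OF g \<eta>] by (intro add_mono mult_mono) auto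
    also have "\<dots> = 2 * envelope \<mu> t * D" by simp
    finally show "norm (\<Sum>j\<in>UNIV. \<upsilon> t j \<xi> * of_real (\<eta> $ j)) \<le> 2 * envelope \<mu> t * D" .
  qed
  have adv: "sobolev_norm 3 (advect (?U t) f) \<le> ennreal (?W * (2 * envelope \<mu> t * D * (envelope \<mu> t * (R + 2)) * L1_norm g * N))"
    if t: "t \<ge> 0" and f: "has_spectrum R f (\<lambda>\<xi>. \<tau> \<xi> * g \<xi>)" and \<tau>: "\<And>\<eta>. g \<eta> \<noteq> 0 \<Longrightarrow> norm (\<tau> \<eta>) \<le> envelope \<mu> t * (R + 2)" for t f \<tau>
    using envelope_bounds(4)[OF \<nu> t, folded \<mu>_def] D(1) R
    by (intro advect_sobolev_bound[OF U f gi N \<upsilon>_cancel[OF t] \<tau>]) auto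
  have \<Theta>_bound: "norm (complex_of_real (exp (- lam * t))) \<le> envelope \<mu> t * (R + 2)" if t: "t \<ge> 0" for t
  proof -
    note s = envelope_bounds[OF \<nu> t, folded \<mu>_def]
    have "envelope \<mu> t * 1 \<le> envelope \<mu> t * (R + 2)" using s R by (intro mult_left_mono) auto
    then show ?thesis using s by simp
  qed
  define c where "c = (?n + 1) * (?W * (2 * (R + 2))) * (1 + 2 / \<mu>)\<^sup>2 * (D * L1_norm g * N)"
  have c: "c \<ge> 0" using R D(1) g0 N by (simp add: c_def)
  have E: "sobolev_norm_vec 3 (advect_vec (?U t) (?U t)) + sobolev_norm 3 (advect (?U t) (?\<Theta> t)) \<le> ennreal (c * exp (- \<mu> * t))"
    if t: "t \<ge> 0" for t
  proof -
    note s = envelope_bounds[OF \<nu> t, folded \<mu>_def]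
    define b where "b = ?W * (2 * envelope \<mu> t * D * (envelope \<mu> t * (R + 2)) * L1_norm g * N)"
    have b: "b \<ge> 0" using s D(1) R g0 N by (simp add: b_def)
    have "sobolev_norm_vec 3 (advect_vec (?U t) (?U t)) \<le> ennreal (?n * b)"
      unfolding advect_vec_def
      by (rule sobolev_norm_vec_le[OF _ b]) (simp only: vec_lambda_beta b_def, rule adv[OF t U \<upsilon>_bound[OF t]])
    moreover have "sobolev_norm 3 (advect (?U t) (?\<Theta> t)) \<le> ennreal b"
      unfolding b_def by (rule adv[OF t \<Theta> \<Theta>_bound[OF t]])
    ultimately have "sobolev_norm_vec 3 (advect_vec (?U t) (?U t)) + sobolev_norm 3 (advect (?U t) (?\<Theta> t)) \<le> ennreal (?n * b) + ennreal b"
      by (rule add_mono)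
    also have "\<dots> = ennreal ((?n + 1) * b)" using b by (simp add: ennreal_plus[symmetric] distrib_right del: ennreal_plus)
    also have "(?n + 1) * b = (?n + 1) * (?W * (2 * (R + 2))) * (envelope \<mu> t)\<^sup>2 * (D * L1_norm g * N)"
      unfolding b_def power2_eq_square[of "envelope \<mu> t"] by (simp only: mult_ac)
    also have "(envelope \<mu> t)\<^sup>2 = (1 + 2 / \<mu>)\<^sup>2 * exp (- \<mu> * t)"
      unfolding envelope_def power_mult_distrib by (simp flip: exp_double)
    also have "(?n + 1) * (?W * (2 * (R + 2))) * ((1 + 2 / \<mu>)\<^sup>2 * exp (- \<mu> * t)) * (D * L1_norm g * N) = c * exp (- \<mu> * t)"
      unfolding c_def by (simp only: mult_ac)
    finally show ?thesis .
  qed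
  have "E_zero \<nu> lam d U0 a0 \<le> (\<integral>\<^sup>+ t\<in>{0..}. ennreal (c * exp (- \<mu> * t)) \<partial>lborel)"
    unfolding E_zero_def Let_def using E by (intro nn_integral_mono) (auto simp: indicator_def)
  also have "\<dots> = ennreal (c / \<mu>)" by (rule nn_integral_exp_decay[OF \<mu> c])
  also have "c / \<mu> = E_const R \<mu> CARD('n) * D * L1_norm g * N"
    by (simp add: c_def E_const_def)
  finally show "E_zero \<nu> lam d U0 a0 \<le> ennreal (E_const R \<mu> CARD('n) * D * L1_norm g * N)" .

  define c' where "c' = (?n + 1) * (R + 2) * (1 + 2 / \<mu>) * L1_norm g"
  have c': "c' \<ge> 0" using R \<mu> g0 by (simp add: c'_def)
  have sp_bound: "L1_norm (\<lambda>\<xi>. m \<xi> * g \<xi>) \<le> B * L1_norm g"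
    if "\<And>\<xi>. g \<xi> \<noteq> 0 \<Longrightarrow> norm (m \<xi>) \<le> B" "integrable lborel (\<lambda>\<xi>. m \<xi> * g \<xi>)" for m :: "real^'n \<Rightarrow> complex" and B
  proof -
    have "L1_norm (\<lambda>\<xi>. m \<xi> * g \<xi>) \<le> (LINT \<xi>|lborel. B * norm (g \<xi>))"
      unfolding L1_norm_def
    proof (intro integral_mono integrable_norm that(2))
      show "norm (m \<xi> * g \<xi>) \<le> B * norm (g \<xi>)" for \<xi>
        using that(1)[of \<xi>] by (cases "g \<xi> = 0") (auto simp: norm_mult intro!: mult_right_mono)
    qed (use gi in auto)
    then show ?thesis by (simp add: L1_norm_def)
  qed
  have F: "Linf_norm (?U t) + Linf_norm (?\<Theta> t) \<le> ennreal (c' * exp (- (\<mu> / 2) * t))" if t: "t \<ge> 0" for t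
  proof -
    note s = envelope_bounds[OF \<nu> t, folded \<mu>_def]
    define b where "b = envelope \<mu> t * (R + 2) * L1_norm g"
    have b: "b \<ge> 0" using s R g0 by (simp add: b_def)
    have UA: "AE x in lborel. \<bar>?U t x $ i\<bar> \<le> b" for i
      unfolding b_def using has_spectrum_AE_bound[OF U[of t i]]
      by eventually_elim (erule order_trans[OF _ sp_bound[OF \<upsilon>_bound[OF t] has_spectrumD(2)[OF U[of t i]]]])
    have "?U t \<in> borel_measurable borel"
      unfolding borel_measurable_euclidean_space[of "?U t"]
      using has_spectrumD(1)[OF U] by (auto simp: Basis_vec_def inner_axis)
    then have "Linf_norm (?U t) \<le> ennreal (?n * b)"
      by (rule Linf_norm_le) (rule UA)
    moreover have "AE x in lborel. \<bar>?\<Theta> t x\<bar> \<le> b"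
      unfolding b_def using has_spectrum_AE_bound[OF \<Theta>[of t]]
      by eventually_elim (erule order_trans[OF _ sp_bound[OF \<Theta>_bound[OF t] has_spectrumD(2)[OF \<Theta>[of t]]]])
    then have "Linf_norm (?\<Theta> t) \<le> ennreal b"
      unfolding Linf_norm_def using has_spectrumD(1)[OF \<Theta>[of t]]
      by (intro esssup_I) (auto intro: ennreal_leI elim: eventually_mono)
    ultimately have "Linf_norm (?U t) + Linf_norm (?\<Theta> t) \<le> ennreal (?n * b) + ennreal b"
      by (rule add_mono)
    also have "\<dots> = ennreal ((?n + 1) * b)" using b by (simp add: ennreal_plus[symmetric] distrib_right del: ennreal_plus)
    also have "(?n + 1) * b = c' * exp (- (\<mu> / 2) * t)"
      by (simp add: b_def c'_def envelope_def)
    finally show ?thesis .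
  qed
  have "F_zero \<nu> lam d U0 a0 \<le> (\<integral>\<^sup>+ t\<in>{0..}. ennreal (c' * exp (- (\<mu> / 2) * t)) \<partial>lborel)"
    unfolding F_zero_def Let_def using F by (intro nn_integral_mono) (auto simp: indicator_def)
  also have "\<dots> = ennreal (c' / (\<mu> / 2))" using \<mu> c' by (intro nn_integral_exp_decay) auto
  also have "c' / (\<mu> / 2) = F_const R \<mu> CARD('n) * L1_norm g"
    by (simp add: c'_def F_const_def)
  finally show "F_zero \<nu> lam d U0 a0 \<le> ennreal (F_const R \<mu> CARD('n) * L1_norm g)" .
qed

section \<open>The size of \<open>L\<^sub>C\<close>\<close>

text \<open>The union of all open null sets is null by Lindelof's theorem.\<close>

lemma ess_support_AE:
  fixes g :: "'a::euclidean_space \<Rightarrow> complex"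
  assumes "ess_support g \<subseteq> S"
  shows "AE \<xi> in lborel. \<xi> \<notin> S \<longrightarrow> g \<xi> = 0"
proof -
  let ?F = "{V. open V \<and> (AE \<xi> in lborel. \<xi> \<in> V \<longrightarrow> g \<xi> = 0)}"
  obtain F' where F': "F' \<subseteq> ?F" "countable F'" "\<Union>F' = \<Union>?F"
    by (rule Lindelof[of ?F]) auto
  have "AE \<xi> in lborel. \<forall>V\<in>F'. \<xi> \<in> V \<longrightarrow> g \<xi> = 0"
    using F'(1) by (subst AE_ball_countable[OF F'(2)]) auto
  then show ?thesis
  proof eventually_elim
    fix \<xi> assume *: "\<forall>V\<in>F'. \<xi> \<in> V \<longrightarrow> g \<xi> = 0"
    have "\<xi> \<in> \<Union>F'" if "\<xi> \<notin> S" using that assms unfolding F'(3) ess_support_def by blast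
    with * show "\<xi> \<notin> S \<longrightarrow> g \<xi> = 0" by blast
  qed
qed

lemma sobolev_norm_zero: "s \<ge> 0 \<Longrightarrow> sobolev_norm s (\<lambda>_. 0 :: real) = 0"
  using sobolev_norm_le[OF has_spectrum_zero, of s 0 0] by (simp add: L2sq_def)

lemma L_quant_zero_perturbation_le:
  fixes U0 :: "real ^ 'n \<Rightarrow> real ^ 'n"
  assumes E: "E_zero \<nu> lam d U0 \<Theta>0 \<le> ennreal e" and F: "F_zero \<nu> lam d U0 \<Theta>0 \<le> ennreal f"
    and nonneg: "e \<ge> 0" "f \<ge> 0" "C \<ge> 0"
  shows "L_quant \<nu> lam d C U0 \<Theta>0 (\<lambda>_. 0) (\<lambda>_. 0) \<le> ennreal (e * exp (C * f + C * e))"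
proof -
  let ?E = "E_zero \<nu> lam d U0 \<Theta>0" and ?F = "F_zero \<nu> lam d U0 \<Theta>0"
  have z: "(sobolev_norm_vec 3 (\<lambda>_ :: real ^ 'n. 0 :: real ^ 'n))\<^sup>2 = 0"
    by (simp add: sobolev_norm_vec_def sobolev_norm_zero ennreal_sqrt_def)
  have fin: "?E \<noteq> \<infinity>" "?F \<noteq> \<infinity>" using E F by (auto simp: top_unique)
  have le: "enn2real ?E \<le> e" "enn2real ?F \<le> f"
    using enn2real_mono[OF E] enn2real_mono[OF F] nonneg by auto
  have "enn2real ?E * exp (C * enn2real ?F + C * enn2real ?E) \<le> e * exp (C * f + C * e)"
    using le nonneg by (intro mult_mono) (auto intro!: add_mono mult_left_mono)
  then show ?thesis
    using fin z by (simp add: L_quant_def Let_def sobolev_norm_zero ennreal_leI)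
qed

lemma L2sq_eq_L2_norm: "square_integrable f \<Longrightarrow> L2sq f = ennreal ((L2_norm f)\<^sup>2)"
  unfolding L2sq_def L2_norm_def square_integrable_def
  by (subst nn_integral_eq_integral) (auto simp: integral_nonneg_AE)

text \<open>
  The properties of the data that the estimate uses, common to the planar and the spatial case: the
  initial velocity has the symbol \<open>\<i> w\<close> with \<open>w\<close> real, and on the Fourier support both \<open>w(\<xi>) \<bullet> \<eta>\<close> and
  \<open>m(\<xi>) \<bullet> \<eta>\<close>, with \<open>m\<close> the Leray symbol, are at most \<open>\<delta>\<close> in size.
\<close>

definition degenerate_data :: "real \<Rightarrow> real \<Rightarrow> 'n \<Rightarrow> (real ^ 'n \<Rightarrow> real) \<Rightarrow> (real ^ 'n \<Rightarrow> real ^ 'n) \<Rightarrow> bool" where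
  "degenerate_data R \<delta> d a0 U0 \<longleftrightarrow> square_integrable a0 \<and> integrable lborel (fourier a0) \<and>
     (\<exists>S w. closed S \<and> S \<subseteq> cball 0 R \<and> ess_support (fourier a0) \<subseteq> S \<and>
        (\<forall>j h. has_spectrum R a0 h \<longrightarrow> has_spectrum R (\<lambda>x. U0 x $ j) (\<lambda>\<xi>. \<i> * of_real (w j \<xi>) * h \<xi>)) \<and>
        (\<forall>j. \<forall>\<xi>\<in>S. \<bar>w j \<xi>\<bar> \<le> R) \<and>
        (\<forall>\<xi>\<in>S. \<forall>\<eta>\<in>S. \<bar>\<Sum>j\<in>UNIV. w j \<xi> * \<eta> $ j\<bar> \<le> \<delta>) \<and>
        (\<forall>\<xi>\<in>S. \<forall>\<eta>\<in>S. \<bar>\<Sum>j\<in>UNIV. leray_symbol d j \<xi> * \<eta> $ j\<bar> \<le> \<delta>))"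

text \<open>
  The Fourier transform of \<open>a\<^sub>0\<close> is replaced by its restriction \<open>g\<close> to the support, which changes it
  only on a null set and provides exact support.
\<close>

lemma L_quant_bound:
  fixes \<nu> lam R K C :: real and d :: "'n::finite"
  assumes \<nu>: "\<nu> > 0" "lam > 0" and C: "C > 0" and R: "R \<ge> 0" and K: "K \<ge> 0"
  shows "\<exists>C'>0. \<forall>\<epsilon> a0 U0. 0 < \<epsilon> \<longrightarrow> degenerate_data R (K * \<epsilon>) d a0 U0 \<longrightarrow>
       L_quant \<nu> lam d C U0 a0 (\<lambda>_. 0) (\<lambda>_. 0)
          \<le> ennreal (C' * \<epsilon> * L2_norm a0 * L1_norm (fourier a0)
              * exp (C' * \<epsilon> * L2_norm a0 * L1_norm (fourier a0) + C' * L1_norm (fourier a0)))"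
proof -
  define \<mu> where "\<mu> = min \<nu> lam"
  have \<mu>: "\<mu> > 0" using \<nu> by (simp add: \<mu>_def)
  let ?p = "4 * (2 * pi) ^ DIM(real ^ 'n)"
  define KE where "KE = E_const R \<mu> CARD('n) * K * sqrt ?p"
  define KF where "KF = F_const R \<mu> CARD('n)"
  have K0: "KE \<ge> 0" "KF \<ge> 0" using E_F_const_nonneg[OF R \<mu>] K by (auto simp: KE_def KF_def)
  \<comment> \<open>one constant that dominates the prefactor and both exponents\<close>
  define C' where "C' = KE + C * KE + C * KF + 1"
  have C': "C' > 0" "KE \<le> C'" "C * KE \<le> C'" "C * KF \<le> C'"
    using K0 C by (auto simp: C'_def add_nonneg_pos)
  show ?thesis
  proof (intro exI[of _ C'] conjI allI impI C'(1))
    fix \<epsilon> :: real and a0 :: "real ^ 'n \<Rightarrow> real" and U0 :: "real ^ 'n \<Rightarrow> real ^ 'n"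
    assume \<epsilon>: "0 < \<epsilon>" and data: "degenerate_data R (K * \<epsilon>) d a0 U0"
    then have a0: "square_integrable a0" and fi: "integrable lborel (fourier a0)"
      by (simp_all add: degenerate_data_def)
    obtain S w where S: "closed S" "S \<subseteq> cball 0 R" and supp: "ess_support (fourier a0) \<subseteq> S"
      and U0': "\<forall>j h. has_spectrum R a0 h \<longrightarrow> has_spectrum R (\<lambda>x. U0 x $ j) (\<lambda>\<xi>. \<i> * of_real (w j \<xi>) * h \<xi>)"
      and wR': "\<forall>j. \<forall>\<xi>\<in>S. \<bar>w j \<xi>\<bar> \<le> R"
      and w': "\<forall>\<xi>\<in>S. \<forall>\<eta>\<in>S. \<bar>\<Sum>j\<in>UNIV. w j \<xi> * \<eta> $ j\<bar> \<le> K * \<epsilon>"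
      and l': "\<forall>\<xi>\<in>S. \<forall>\<eta>\<in>S. \<bar>\<Sum>j\<in>UNIV. leray_symbol d j \<xi> * \<eta> $ j\<bar> \<le> K * \<epsilon>"
      using data unfolding degenerate_data_def by (elim conjE exE) (rule that)
    note U0 = U0'[rule_format] and wR = wR'[rule_format] and w = w'[rule_format] and l = l'[rule_format]
    define g where "g \<xi> = indicator S \<xi> * fourier a0 \<xi>" for \<xi>
    have [measurable]: "S \<in> sets borel" "fourier a0 \<in> borel_measurable borel"
      using S(1) fi by auto
    have ae: "AE \<xi> in lborel. fourier a0 \<xi> = g \<xi>"
      using ess_support_AE[OF supp] by eventually_elim (auto simp: g_def indicator_def)
    have gm[measurable]: "g \<in> borel_measurable borel" unfolding g_def by measurable
    have gi: "integrable lborel g"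
      using fi by (subst integrable_cong_AE[of _ _ "fourier a0"]) (use ae in \<open>auto elim: eventually_mono\<close>)
    have L1: "L1_norm g = L1_norm (fourier a0)"
      unfolding L1_norm_def by (rule integral_cong_AE) (use ae in \<open>auto elim: eventually_mono\<close>)
    have gS: "\<xi> \<in> S" if "g \<xi> \<noteq> 0" for \<xi> using that by (auto simp: g_def indicator_def split: if_splits)
    have a: "has_spectrum R a0 g"
    proof (rule has_spectrumI_fourier[OF a0 ae gi])
      fix \<xi> :: "real ^ 'n" assume "R < norm \<xi>"
      then have "\<xi> \<notin> S" using S(2) by auto
      then show "g \<xi> = 0" by (simp add: g_def)
    qed
    let ?x = "L2_norm a0" and ?y = "L1_norm (fourier a0)"
    have xy: "?x \<ge> 0" "?y \<ge> 0" by (auto simp: L2_norm_def L1_norm_def integral_nonneg_AE)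
    have N: "L2sq g \<le> ennreal ((sqrt ?p * ?x)\<^sup>2)"
    proof -
      have "L2sq g \<le> ennreal ?p * ennreal (?x\<^sup>2)"
        using has_spectrum_bound[OF a] by (simp only: L2sq_eq_L2_norm[OF a0])
      also have "\<dots> = ennreal ((sqrt ?p * ?x)\<^sup>2)"
        unfolding power_mult_distrib by (subst ennreal_mult[symmetric]) auto
      finally show ?thesis .
    qed
    have E: "E_zero \<nu> lam d U0 a0 \<le> ennreal (E_const R \<mu> CARD('n) * (K * \<epsilon>) * L1_norm g * (sqrt ?p * ?x))"
      and F: "F_zero \<nu> lam d U0 a0 \<le> ennreal (F_const R \<mu> CARD('n) * L1_norm g)"
    proof (atomize(full), unfold \<mu>_def, intro conjI)
      have b1: "norm (\<i> * complex_of_real (w j \<xi>)) \<le> R" if "g \<xi> \<noteq> 0" for j \<xi>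
        using wR[OF gS[OF that]] by (simp add: norm_mult)
      have b2: "norm (\<Sum>j\<in>UNIV. \<i> * complex_of_real (w j \<xi>) * complex_of_real (\<eta> $ j)) \<le> K * \<epsilon>"
        if "g \<xi> \<noteq> 0" "g \<eta> \<noteq> 0" for \<xi> \<eta>
      proof -
        have "(\<Sum>j\<in>UNIV. \<i> * complex_of_real (w j \<xi>) * complex_of_real (\<eta> $ j)) = \<i> * of_real (\<Sum>j\<in>UNIV. w j \<xi> * \<eta> $ j)"
          by (simp add: sum_distrib_left mult.assoc)
        then show ?thesis using w[OF gS[OF that(1)] gS[OF that(2)]] by (simp only: norm_mult norm_of_real norm_ii mult_1)
      qed
      note bounds = E_F_zero_bounds[OF \<nu> a U0[OF a] R b1 _ b2 l[OF gS gS] N]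
      show "E_zero \<nu> lam d U0 a0 \<le> ennreal (E_const R (min \<nu> lam) CARD('n) * (K * \<epsilon>) * L1_norm g * (sqrt ?p * ?x))"
        by (rule bounds(1)) (use K \<epsilon> xy in auto)
      show "F_zero \<nu> lam d U0 a0 \<le> ennreal (F_const R (min \<nu> lam) CARD('n) * L1_norm g)"
        by (rule bounds(2)) (use K \<epsilon> xy in auto)
    qed
    let ?e = "KE * (\<epsilon> * ?x * ?y)" and ?f = "KF * ?y"
    have e0: "0 \<le> \<epsilon> * ?x * ?y" using \<epsilon> xy by simp
    have "E_const R \<mu> CARD('n) * (K * \<epsilon>) * L1_norm g * (sqrt ?p * ?x) = ?e"
      unfolding KE_def L1 by (simp only: mult_ac)
    with E have E': "E_zero \<nu> lam d U0 a0 \<le> ennreal ?e" by (simp only:)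
    from F have F': "F_zero \<nu> lam d U0 a0 \<le> ennreal ?f" by (simp add: KF_def L1)
    have "L_quant \<nu> lam d C U0 a0 (\<lambda>_. 0) (\<lambda>_. 0) \<le> ennreal (?e * exp (C * ?f + C * ?e))"
      using K0 xy e0 C by (intro L_quant_zero_perturbation_le[OF E' F']) auto
    also have "\<dots> \<le> ennreal (C' * (\<epsilon> * ?x * ?y) * exp (C' * (\<epsilon> * ?x * ?y) + C' * ?y))"
    proof (rule ennreal_leI, rule mult_mono)
      show "?e \<le> C' * (\<epsilon> * ?x * ?y)" by (rule mult_right_mono[OF C'(2) e0])
      have "C * ?e \<le> C' * (\<epsilon> * ?x * ?y)" "C * ?f \<le> C' * ?y"
        using mult_right_mono[OF C'(3) e0] mult_right_mono[OF C'(4) xy(2)] by (simp_all only: mult.assoc)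
      then show "exp (C * ?f + C * ?e) \<le> exp (C' * (\<epsilon> * ?x * ?y) + C' * ?y)" by simp
    qed (use C' e0 in auto)
    finally show "L_quant \<nu> lam d C U0 a0 (\<lambda>_. 0) (\<lambda>_. 0)
          \<le> ennreal (C' * \<epsilon> * ?x * ?y * exp (C' * \<epsilon> * ?x * ?y + C' * ?y))"
      by (simp only: mult.assoc)
  qed
qed

text \<open>The cross product vanishes if both points are on the diagonal, and it is Lipschitz on bounded sets.\<close>

lemma cross_near_diagonal:
  fixes x y x' y' :: real
  assumes "\<bar>x - y\<bar> \<le> \<epsilon>" "\<bar>x' - y'\<bar> \<le> \<epsilon>" "\<bar>x\<bar> \<le> 3 / 2" "\<bar>x'\<bar> \<le> 3 / 2"
  shows "\<bar>y * x' - x * y'\<bar> \<le> 3 * \<epsilon>"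
proof -
  have "y * x' - x * y' = (y - x) * x' + x * (x' - y')" by (simp add: algebra_simps)
  also have "\<bar>\<dots>\<bar> \<le> \<bar>y - x\<bar> * \<bar>x'\<bar> + \<bar>x\<bar> * \<bar>x' - y'\<bar>" by (metis abs_mult abs_triangle_ineq)
  also have "\<dots> \<le> \<epsilon> * (3 / 2) + (3 / 2) * \<epsilon>" using assms by (intro add_mono mult_mono) auto
  finally show ?thesis by simp
qed

lemma leray_symbol_inner:
  fixes \<xi> \<eta> :: "real ^ 'n"
  shows "(\<Sum>j\<in>UNIV. leray_symbol d j \<xi> * \<eta> $ j) = \<eta> $ d - \<xi> $ d * (\<xi> \<bullet> \<eta>) / (norm \<xi>)\<^sup>2"
proof -
  have "(\<Sum>j\<in>UNIV. leray_symbol d j \<xi> * \<eta> $ j)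
     = (\<Sum>j\<in>UNIV. (if j = d then \<eta> $ j else 0)) - (\<Sum>j\<in>UNIV. \<xi> $ d / (norm \<xi>)\<^sup>2 * (\<xi> $ j * \<eta> $ j))"
    unfolding sum_subtractf[symmetric] leray_symbol_def by (intro sum.cong refl) (simp add: field_simps)
  also have "\<dots> = \<eta> $ d - \<xi> $ d / (norm \<xi>)\<^sup>2 * (\<xi> \<bullet> \<eta>)"
    by (simp add: sum_distrib_left inner_vec_def)
  finally show ?thesis by simp
qed

text \<open>
  In the plane the Leray projection of the vertical unit vector is orthogonal to \<open>\<xi>\<close>, hence a multiple of the
  rotated frequency, namely by \<open>\<xi>\<^sub>1 / \<bar>\<xi>\<bar>\<^sup>2\<close>.
\<close>

lemma leray_cross_2:
  fixes \<xi> \<eta> :: "real ^ 2"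
  assumes 1: "norm \<xi> \<ge> 1" and cross: "\<bar>\<xi> $ 2 * \<eta> $ 1 - \<xi> $ 1 * \<eta> $ 2\<bar> \<le> c"
  shows "\<bar>\<Sum>j\<in>UNIV. leray_symbol 2 j \<xi> * \<eta> $ j\<bar> \<le> c"
proof -
  let ?X = "\<xi> $ 2 * \<eta> $ 1 - \<xi> $ 1 * \<eta> $ 2"
  have n: "(norm \<xi>)\<^sup>2 = (\<xi> $ 1)\<^sup>2 + (\<xi> $ 2)\<^sup>2"
    unfolding power2_norm_eq_inner inner_vec_def sum_2 by (simp add: power2_eq_square)
  have n1: "norm \<xi> > 0" using 1 by linarith
  have "(\<Sum>j\<in>UNIV. leray_symbol 2 j \<xi> * \<eta> $ j) = (\<eta> $ 2 * (norm \<xi>)\<^sup>2 - \<xi> $ 2 * (\<xi> \<bullet> \<eta>)) / (norm \<xi>)\<^sup>2"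
    using n1 by (simp add: leray_symbol_inner diff_divide_distrib)
  also have "\<eta> $ 2 * (norm \<xi>)\<^sup>2 - \<xi> $ 2 * (\<xi> \<bullet> \<eta>) = - \<xi> $ 1 * ?X"
    unfolding n by (simp add: inner_vec_def sum_2 algebra_simps power2_eq_square)
  finally have eq: "\<bar>\<Sum>j\<in>UNIV. leray_symbol 2 j \<xi> * \<eta> $ j\<bar> = \<bar>\<xi> $ 1\<bar> * \<bar>?X\<bar> / (norm \<xi>)\<^sup>2"
    by (simp add: abs_mult)
  have "\<bar>\<xi> $ 1\<bar> \<le> (norm \<xi>)\<^sup>2"
    using component_le_norm_cart[of \<xi> 1] mult_right_mono[OF 1, of "norm \<xi>"] by (simp add: power2_eq_square)
  then have "\<bar>\<xi> $ 1\<bar> * \<bar>?X\<bar> \<le> (norm \<xi>)\<^sup>2 * c" using cross by (intro mult_mono) auto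
  then show ?thesis unfolding eq using n1 by (simp add: divide_le_eq mult.commute)
qed

lemma has_spectrum_minus_partial:
  fixes a :: "real ^ 'n \<Rightarrow> real"
  assumes "has_spectrum R a h"
  shows "has_spectrum R (\<lambda>x. - partial j a x) (\<lambda>\<xi>. \<i> * of_real (- \<xi> $ j) * h \<xi>)"
  using has_spectrum_cmult[OF has_spectrum_partial[OF assms, of j], of "-1"] by simp

lemma planar_degenerate_data:
  fixes a0 :: "real ^ 2 \<Rightarrow> real"
  assumes a0: "square_integrable a0" "integrable lborel (fourier a0)"
    and supp: "ess_support (fourier a0) \<subseteq> {\<xi>. \<bar>\<xi> $ 1 - \<xi> $ 2\<bar> \<le> \<epsilon> \<and> 4 / 3 \<le> norm \<xi> \<and> norm \<xi> \<le> 3 / 2}"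
  shows "degenerate_data (3 / 2) (3 * \<epsilon>) 2 a0 (\<lambda>x. vector [partial 2 a0 x, - partial 1 a0 x])"
proof -
  let ?S = "{\<xi> :: real ^ 2. \<bar>\<xi> $ 1 - \<xi> $ 2\<bar> \<le> \<epsilon> \<and> 4 / 3 \<le> norm \<xi> \<and> norm \<xi> \<le> 3 / 2}"
  let ?U0 = "\<lambda>x. vector [partial 2 a0 x, - partial 1 a0 x] :: real ^ 2"
  let ?w = "\<lambda>(j :: 2) (\<xi> :: real ^ 2). if j = 1 then \<xi> $ 2 else - \<xi> $ 1"
  have comp: "\<bar>\<xi> $ j\<bar> \<le> 3 / 2" if "\<xi> \<in> ?S" for j \<xi>
    using that component_le_norm_cart[of \<xi> j] by auto
  have cross: "\<bar>\<xi> $ 2 * \<eta> $ 1 - \<xi> $ 1 * \<eta> $ 2\<bar> \<le> 3 * \<epsilon>" if "\<xi> \<in> ?S" "\<eta> \<in> ?S" for \<xi> \<eta>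
    by (rule cross_near_diagonal) (use that comp[of \<xi>] comp[of \<eta>] in auto)
  show ?thesis
    unfolding degenerate_data_def
  proof (intro conjI a0 exI[of _ ?S] exI[of _ ?w] allI impI ballI supp)
    show "closed ?S"
      by (intro closed_Collect_conj closed_Collect_le continuous_intros)
    show "?S \<subseteq> cball 0 (3 / 2)" by auto
    show "has_spectrum (3 / 2) (\<lambda>x. ?U0 x $ j) (\<lambda>\<xi>. \<i> * of_real (?w j \<xi>) * h \<xi>)"
      if "has_spectrum (3 / 2) a0 h" for j h
      using has_spectrum_partial[OF that, of 2] has_spectrum_minus_partial[OF that, of 1] exhaust_2[of j] by auto
    show "\<bar>\<Sum>j\<in>UNIV. leray_symbol 2 j \<xi> * \<eta> $ j\<bar> \<le> 3 * \<epsilon>" if "\<xi> \<in> ?S" "\<eta> \<in> ?S" for \<xi> \<eta>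
      by (rule leray_cross_2[OF _ cross[OF that]]) (use that in auto)
    show "\<bar>\<Sum>j\<in>UNIV. ?w j \<xi> * \<eta> $ j\<bar> \<le> 3 * \<epsilon>" if "\<xi> \<in> ?S" "\<eta> \<in> ?S" for \<xi> \<eta>
      using cross[OF that] by (simp add: sum_2)
    show "\<bar>?w j \<xi>\<bar> \<le> 3 / 2" if "\<xi> \<in> ?S" for j \<xi>
      using comp[OF that] by auto
  qed
qed

text \<open>
  The bound \<open>8 \<epsilon>\<close> comes from \<open>\<bar>\<eta>\<^sub>3\<bar> \<le> 2 \<epsilon>\<close> and \<open>\<bar>\<xi>\<^sub>3\<bar> \<bar>\<xi> \<bullet> \<eta>\<bar> / \<bar>\<xi>\<bar>\<^sup>2 \<le> 6 \<epsilon>\<close>. Small \<open>\<epsilon>\<close> serves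
  only to keep the support in a fixed ball.
\<close>

lemma spatial_degenerate_data:
  fixes a0 :: "real ^ 3 \<Rightarrow> real"
  assumes \<epsilon>: "0 < \<epsilon>" "\<epsilon> < 1" and a0: "square_integrable a0" "integrable lborel (fourier a0)"
    and supp: "ess_support (fourier a0)
          \<subseteq> {\<xi>. \<bar>\<xi> $ 1 - \<xi> $ 2\<bar> \<le> \<epsilon>
                \<and> 41 / 30 \<le> sqrt ((\<xi> $ 1)\<^sup>2 + (\<xi> $ 2)\<^sup>2) \<and> sqrt ((\<xi> $ 1)\<^sup>2 + (\<xi> $ 2)\<^sup>2) \<le> 22 / 15
                \<and> \<epsilon> \<le> \<bar>\<xi> $ 3\<bar> \<and> \<bar>\<xi> $ 3\<bar> \<le> 2 * \<epsilon>}" (is "_ \<subseteq> ?S")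
  shows "degenerate_data 3 (8 * \<epsilon>) 3 a0 (\<lambda>x. vector [partial 2 a0 x, - partial 1 a0 x, 0])"
proof -
  let ?U0 = "\<lambda>x. vector [partial 2 a0 x, - partial 1 a0 x, 0] :: real ^ 3"
  let ?w = "\<lambda>(j :: 3) (\<xi> :: real ^ 3). if j = 1 then \<xi> $ 2 else if j = 2 then - \<xi> $ 1 else 0"
  have hor: "\<bar>\<xi> $ 1\<bar> \<le> 3 / 2" "\<bar>\<xi> $ 2\<bar> \<le> 3 / 2" "1 \<le> norm \<xi>" "norm \<xi> \<le> 3" if "\<xi> \<in> ?S" for \<xi>
  proof -
    let ?r = "sqrt ((\<xi> $ 1)\<^sup>2 + (\<xi> $ 2)\<^sup>2)"
    have n: "norm \<xi> = sqrt (?r\<^sup>2 + (\<xi> $ 3)\<^sup>2)"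
      by (simp add: norm_vec_def L2_set_def sum_3)
    have "?r \<le> norm \<xi>" unfolding n by (rule real_sqrt_sum_squares_ge1)
    then show "1 \<le> norm \<xi>" using that by simp
    show "\<bar>\<xi> $ 1\<bar> \<le> 3 / 2" "\<bar>\<xi> $ 2\<bar> \<le> 3 / 2"
    proof -
      have "\<bar>\<xi> $ 1\<bar> \<le> ?r" "\<bar>\<xi> $ 2\<bar> \<le> ?r"
        by (rule real_le_rsqrt; simp)+
      moreover have "?r \<le> 22 / 15" using that by simp
      ultimately show "\<bar>\<xi> $ 1\<bar> \<le> 3 / 2" "\<bar>\<xi> $ 2\<bar> \<le> 3 / 2" by linarith+
    qed
    have "(norm \<xi>)\<^sup>2 = ?r\<^sup>2 + (\<xi> $ 3)\<^sup>2" unfolding n by simp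
    also have "\<dots> \<le> (22 / 15)\<^sup>2 + 2\<^sup>2"
    proof (intro add_mono)
      show "?r\<^sup>2 \<le> (22 / 15)\<^sup>2" using that by (intro power_mono) auto
      show "(\<xi> $ 3)\<^sup>2 \<le> 2\<^sup>2" using that \<epsilon> by (intro power2_le_iff_abs_le[THEN iffD2]) auto
    qed
    also have "\<dots> \<le> (3::real)\<^sup>2" by (simp add: power2_eq_square)
    finally show "norm \<xi> \<le> 3" by (rule power2_le_imp_le) simp
  qed
  have cross: "\<bar>\<xi> $ 2 * \<eta> $ 1 - \<xi> $ 1 * \<eta> $ 2\<bar> \<le> 3 * \<epsilon>" if "\<xi> \<in> ?S" "\<eta> \<in> ?S" for \<xi> \<eta>
    by (rule cross_near_diagonal) (use that hor[of \<xi>] hor[of \<eta>] in auto)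
  show ?thesis
    unfolding degenerate_data_def
  proof (intro conjI a0 exI[of _ ?S] exI[of _ ?w] allI impI ballI supp)
    show "closed ?S"
      by (intro closed_Collect_conj closed_Collect_le continuous_intros)
    show "has_spectrum 3 (\<lambda>x. ?U0 x $ j) (\<lambda>\<xi>. \<i> * of_real (?w j \<xi>) * h \<xi>)"
      if "has_spectrum 3 a0 h" for j h
      using exhaust_3[of j]
      by (elim disjE)
         (use has_spectrum_partial[OF that, of 2] has_spectrum_minus_partial[OF that, of 1] in \<open>simp_all add: vector_3\<close>)
    show "\<bar>\<Sum>j\<in>UNIV. leray_symbol 3 j \<xi> * \<eta> $ j\<bar> \<le> 8 * \<epsilon>" if "\<xi> \<in> ?S" "\<eta> \<in> ?S" for \<xi> \<eta>
    proof -
      note n = hor[OF that(1)] hor[OF that(2)]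
      have "\<bar>\<xi> \<bullet> \<eta>\<bar> \<le> norm \<xi> * norm \<eta>" by (rule Cauchy_Schwarz_ineq2)
      also have "\<dots> \<le> norm \<xi> * (3 * norm \<xi>)" using n by (intro mult_left_mono) auto
      finally have "\<bar>\<xi> \<bullet> \<eta>\<bar> / (norm \<xi>)\<^sup>2 \<le> 3"
        using n by (subst divide_le_eq) (auto simp: power2_eq_square)
      moreover have "\<bar>\<xi> $ 3\<bar> \<le> 2 * \<epsilon>" "\<bar>\<eta> $ 3\<bar> \<le> 2 * \<epsilon>" using that by auto
      ultimately have "\<bar>\<xi> $ 3\<bar> * (\<bar>\<xi> \<bullet> \<eta>\<bar> / (norm \<xi>)\<^sup>2) \<le> 2 * \<epsilon> * 3" using \<epsilon> by (intro mult_mono) auto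
      then have "\<bar>\<xi> $ 3 * (\<xi> \<bullet> \<eta>) / (norm \<xi>)\<^sup>2\<bar> \<le> 6 * \<epsilon>" by (simp add: abs_mult)
      then show ?thesis unfolding leray_symbol_inner using \<open>\<bar>\<eta> $ 3\<bar> \<le> 2 * \<epsilon>\<close> by linarith
    qed
    show "\<bar>\<Sum>j\<in>UNIV. ?w j \<xi> * \<eta> $ j\<bar> \<le> 8 * \<epsilon>" if "\<xi> \<in> ?S" "\<eta> \<in> ?S" for \<xi> \<eta>
      using cross[OF that] \<epsilon> by (simp add: sum_3)
    show "\<bar>?w j \<xi>\<bar> \<le> 3" if "\<xi> \<in> ?S" for j \<xi>
      using hor[OF that] by auto
    show "?S \<subseteq> cball 0 3" using hor(4) by auto
  qed
qed

theorem corollary1p1: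
  fixes \<nu> lam :: real
  assumes "\<nu> > 0" and "lam > 0"
  shows
    "(\<forall>C>0. \<exists>C'>0. \<forall>\<epsilon>>0. \<forall>a0 :: real ^ 2 \<Rightarrow> real.
        square_integrable a0 \<longrightarrow>
        integrable lborel (fourier a0) \<longrightarrow>
        ess_support (fourier a0)
          \<subseteq> {\<xi>. \<bar>\<xi> $ 1 - \<xi> $ 2\<bar> \<le> \<epsilon> \<and> 4 / 3 \<le> norm \<xi> \<and> norm \<xi> \<le> 3 / 2} \<longrightarrow>
        L_quant \<nu> lam 2 C (\<lambda>x. vector [partial 2 a0 x, - partial 1 a0 x]) a0 (\<lambda>_. 0) (\<lambda>_. 0)
          \<le> ennreal (C' * \<epsilon> * L2_norm a0 * L1_norm (fourier a0)
              * exp (C' * \<epsilon> * L2_norm a0 * L1_norm (fourier a0) + C' * L1_norm (fourier a0))))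
     \<and>
     (\<exists>\<epsilon>0>0. \<forall>C>0. \<exists>C'>0. \<forall>\<epsilon>. 0 < \<epsilon> \<and> \<epsilon> < \<epsilon>0 \<longrightarrow> (\<forall>a0 :: real ^ 3 \<Rightarrow> real.
        square_integrable a0 \<longrightarrow>
        integrable lborel (fourier a0) \<longrightarrow>
        ess_support (fourier a0)
          \<subseteq> {\<xi>. \<bar>\<xi> $ 1 - \<xi> $ 2\<bar> \<le> \<epsilon>
                \<and> 41 / 30 \<le> sqrt ((\<xi> $ 1)\<^sup>2 + (\<xi> $ 2)\<^sup>2) \<and> sqrt ((\<xi> $ 1)\<^sup>2 + (\<xi> $ 2)\<^sup>2) \<le> 22 / 15
                \<and> \<epsilon> \<le> \<bar>\<xi> $ 3\<bar> \<and> \<bar>\<xi> $ 3\<bar> \<le> 2 * \<epsilon>} \<longrightarrow>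
        L_quant \<nu> lam 3 C (\<lambda>x. vector [partial 2 a0 x, - partial 1 a0 x, 0]) a0 (\<lambda>_. 0) (\<lambda>_. 0)
          \<le> ennreal (C' * \<epsilon> * L2_norm a0 * L1_norm (fourier a0)
              * exp (C' * \<epsilon> * L2_norm a0 * L1_norm (fourier a0) + C' * L1_norm (fourier a0)))))"
proof (rule conjI, goal_cases)
  case 1
  show ?case
  proof (intro allI impI, goal_cases)
    case (1 C)
    show ?case
    \<comment> \<open>the first two goals are the sign conditions on the radius and on the smallness constant\<close>
    proof (rule ex_forward[OF L_quant_bound[OF assms 1, of "3 / 2" 3 "2 :: 2"]], goal_cases)
      case (3 C')
      note C' = 3[THEN conjunct1] and bound = 3[THEN conjunct2, rule_format]
      show ?case
        by (intro conjI C' allI impI bound planar_degenerate_data; assumption)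
    qed auto
  qed
next
  case 2
  show ?case
  \<comment> \<open>for \<open>\<epsilon> < 1\<close> the support lies in the ball of radius \<open>3\<close>\<close>
  proof (rule exI[of _ 1], intro conjI zero_less_one allI impI, goal_cases)
    case (1 C)
    show ?case
    proof (rule ex_forward[OF L_quant_bound[OF assms 1, of 3 8 "3 :: 3"]], goal_cases)
      case (3 C')
      note C' = 3[THEN conjunct1] and bound = 3[THEN conjunct2, rule_format]
      show ?case
        by (intro conjI C' allI impI bound spatial_degenerate_data; (elim conjE)?, assumption)
    qed auto
  qed
qed

end
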